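(* Let $F$ be a field. For arbitrary real numbers $2\leq \gamma \leq \alpha\leq \beta < \infty$ there exist finitely generated primitive monomial $F$-algebras $A,B$ such that $$ \operatorname{GKdim}(A)=\alpha,\qquad \operatorname{GKdim}(B)=\beta,\qquad \operatorname{GKdim}(A\otimes_F B)=\beta+\gamma. $$
   Context: For a finitely generated $F$-algebra $A$ generated by a finite-dimensional subspace $V$ containing $1$, the Gel'fand-Kirillov dimension is $\operatorname{GKdim}(A)=\limsup_{n\to\infty}\frac{\log\dim_F V^n}{\log n}$ (independent of $V$). A monomial algebra is a quotient of a free associative algebra $F\langle x_1,\dots,x_d\rangle$ by an ideal generated by monomials in $x_1,\dots,x_d$. A ring is primitive if it has a faithful simple module. *)

theory Defs
  imports
    "HOL-Algebra.QuotRing"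
    "HOL-Algebra.Subrings"
    "HOL-Library.Extended_Real"
    "HOL-Library.Liminf_Limsup"
    "Jordan_Normal_Form.Missing_VectorSpace"
begin

hide_const (open) Multiset.mult

text \<open>
  Algebras over a field \<open>F\<close>, not necessarily commutative, are represented by the record type
  \<^typ>\<open>('f, 'a) module\<close>, which has a ring structure together with a scalar multiplication.
  (The library locale \<^locale>\<open>algebra\<close> would force the ring to be commutative.)
\<close>

section \<open>Monoid algebras, quotients, monomial algebras and tensor products\<close>

definition monoid_algebra ::
  "('f, 'r) ring_scheme \<Rightarrow> ('m, 's) monoid_scheme \<Rightarrow> ('f, 'm \<Rightarrow> 'f) module" where
  "monoid_algebra F M =
    \<lparr>carrier = {f. range f \<subseteq> carrier F \<and> {x. f x \<noteq> \<zero>\<^bsub>F\<^esub>} \<subseteq> carrier M \<and> finite {x. f x \<noteq> \<zero>\<^bsub>F\<^esub>}},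
     mult = (\<lambda>f g z. \<Oplus>\<^bsub>F\<^esub>p \<in> {(x, y). f x \<noteq> \<zero>\<^bsub>F\<^esub> \<and> g y \<noteq> \<zero>\<^bsub>F\<^esub> \<and> x \<otimes>\<^bsub>M\<^esub> y = z}.
                      f (fst p) \<otimes>\<^bsub>F\<^esub> g (snd p)),
     one = (\<lambda>x. if x = \<one>\<^bsub>M\<^esub> then \<one>\<^bsub>F\<^esub> else \<zero>\<^bsub>F\<^esub>),
     zero = (\<lambda>x. \<zero>\<^bsub>F\<^esub>),
     add = (\<lambda>f g x. f x \<oplus>\<^bsub>F\<^esub> g x),
     smult = (\<lambda>r f x. r \<otimes>\<^bsub>F\<^esub> f x)\<rparr>"

definition basis_elem :: "('f, 'r) ring_scheme \<Rightarrow> 'm \<Rightarrow> 'm \<Rightarrow> 'f" where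
  "basis_elem F x = (\<lambda>y. if y = x then \<one>\<^bsub>F\<^esub> else \<zero>\<^bsub>F\<^esub>)"

text \<open>
  The ring \<^term>\<open>A Quot I\<close> with the induced scalar multiplication
  \<open>r \<cdot> (x + I) = r \<cdot> x + I\<close>, where \<open>I\<close> is a two-sided ideal.
\<close>
definition quot_algebra ::
  "('f, 'a, 'r) module_scheme \<Rightarrow> 'a set \<Rightarrow> ('f, 'a set) module" where
  "quot_algebra A I =
    \<lparr>carrier = carrier (A Quot I), mult = mult (A Quot I), one = one (A Quot I),
     zero = zero (A Quot I), add = add (A Quot I),
     smult = (\<lambda>r C. \<Union>x\<in>C. I +>\<^bsub>A\<^esub> (r \<odot>\<^bsub>A\<^esub> x))\<rparr>"

text \<open>The letters \<open>x\<^sub>1, \<dots>, x\<^sub>d\<close> are encoded as \<open>0, \<dots>, d - 1\<close>.\<close>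
definition word_monoid :: "nat \<Rightarrow> nat list monoid" where
  "word_monoid d = \<lparr>carrier = lists {..<d}, mult = (@), one = []\<rparr>"

definition free_algebra :: "('f, 'r) ring_scheme \<Rightarrow> nat \<Rightarrow> ('f, nat list \<Rightarrow> 'f) module" where
  "free_algebra F d = monoid_algebra F (word_monoid d)"

definition monomial_algebra ::
  "('f, 'r) ring_scheme \<Rightarrow> ('f, (nat list \<Rightarrow> 'f) set) module \<Rightarrow> bool" where
  "monomial_algebra F A \<longleftrightarrow>
    (\<exists>d W. W \<subseteq> lists {..<d} \<and>
      A = quot_algebra (free_algebra F d) (Idl\<^bsub>free_algebra F d\<^esub> (basis_elem F ` W)))"

text \<open>
  For \<open>F\<close>-algebras \<open>A\<close> and \<open>B\<close>: the free \<open>F\<close>-module on \<open>A \<times> B\<close> modulo the bilinearity relations. As the monoid algebra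
  of \<^term>\<open>A \<times>\<times> B\<close>, this free module carries the product \<open>(a, b)(a', b') = (aa', bb')\<close>.
  Multiplying a bilinearity relation by a basis element \<open>(c, d)\<close> on either side gives a
  bilinearity relation again, so that the \<open>F\<close>-submodule generated by the relations is already
  a two-sided ideal: the underlying vector space of the quotient below is the usual
  tensor product, and its multiplication is \<open>(a \<otimes> b)(a' \<otimes> b') = aa' \<otimes> bb'\<close>.
\<close>
definition tensor_relations ::
  "('f, 'r) ring_scheme \<Rightarrow> ('f, 'a, 's) module_scheme \<Rightarrow> ('f, 'b, 't) module_scheme
    \<Rightarrow> ('a \<times> 'b \<Rightarrow> 'f) set" where
  "tensor_relations F A B =
    (let T = monoid_algebra F (A \<times>\<times> B); e = (\<lambda>a b. basis_elem F (a, b)) in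
      {e (a \<oplus>\<^bsub>A\<^esub> a') b \<ominus>\<^bsub>T\<^esub> (e a b \<oplus>\<^bsub>T\<^esub> e a' b) | a a' b.
         a \<in> carrier A \<and> a' \<in> carrier A \<and> b \<in> carrier B} \<union>
      {e a (b \<oplus>\<^bsub>B\<^esub> b') \<ominus>\<^bsub>T\<^esub> (e a b \<oplus>\<^bsub>T\<^esub> e a b') | a b b'.
         a \<in> carrier A \<and> b \<in> carrier B \<and> b' \<in> carrier B} \<union>
      {e (r \<odot>\<^bsub>A\<^esub> a) b \<ominus>\<^bsub>T\<^esub> (r \<odot>\<^bsub>T\<^esub> e a b) | r a b.
         r \<in> carrier F \<and> a \<in> carrier A \<and> b \<in> carrier B} \<union>
      {e a (r \<odot>\<^bsub>B\<^esub> b) \<ominus>\<^bsub>T\<^esub> (r \<odot>\<^bsub>T\<^esub> e a b) | r a b.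
         r \<in> carrier F \<and> a \<in> carrier A \<and> b \<in> carrier B})"

definition tensor_algebra ::
  "('f, 'r) ring_scheme \<Rightarrow> ('f, 'a, 's) module_scheme \<Rightarrow> ('f, 'b, 't) module_scheme
    \<Rightarrow> ('f, ('a \<times> 'b \<Rightarrow> 'f) set) module" where
  "tensor_algebra F A B =
    quot_algebra (monoid_algebra F (A \<times>\<times> B))
      (Idl\<^bsub>monoid_algebra F (A \<times>\<times> B)\<^esub> (tensor_relations F A B))"

section \<open>Generation and Gelfand--Kirillov dimension\<close>

definition algebra_generated ::
  "('f, 'r) ring_scheme \<Rightarrow> ('f, 'a, 's) module_scheme \<Rightarrow> 'a set \<Rightarrow> 'a set" where
  "algebra_generated F A G =
    \<Inter>{S. subring S A \<and> (\<forall>r \<in> carrier F. \<forall>s \<in> S. r \<odot>\<^bsub>A\<^esub> s \<in> S) \<and> G \<subseteq> S}"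

definition finitely_generated_algebra ::
  "('f, 'r) ring_scheme \<Rightarrow> ('f, 'a, 's) module_scheme \<Rightarrow> bool" where
  "finitely_generated_algebra F A \<longleftrightarrow>
    (\<exists>G. finite G \<and> G \<subseteq> carrier A \<and> algebra_generated F A G = carrier A)"

definition generating_space ::
  "('f, 'r) ring_scheme \<Rightarrow> ('f, 'a, 's) module_scheme \<Rightarrow> 'a set \<Rightarrow> bool" where
  "generating_space F A V \<longleftrightarrow>
    subspace F V A \<and> vectorspace.fin_dim F (A\<lparr>carrier := V\<rparr>) \<and> \<one>\<^bsub>A\<^esub> \<in> V \<and>
    algebra_generated F A V = carrier A"

definition space_power ::
  "('f, 'r) ring_scheme \<Rightarrow> ('f, 'a, 's) module_scheme \<Rightarrow> 'a set \<Rightarrow> nat \<Rightarrow> 'a set" where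
  "space_power F A V n =
    LinearCombinations.module.span F A
      {foldr (mult A) vs \<one>\<^bsub>A\<^esub> | vs. length vs = n \<and> set vs \<subseteq> V}"

definition growth_exponent ::
  "('f, 'r) ring_scheme \<Rightarrow> ('f, 'a, 's) module_scheme \<Rightarrow> 'a set \<Rightarrow> ereal" where
  "growth_exponent F A V =
    limsup (\<lambda>n. ereal (ln (real (vectorspace.dim F (A\<lparr>carrier := space_power F A V n\<rparr>))) /
                       ln (real n)))"

text \<open>
  Only meaningful for finitely generated \<open>A\<close>; then a generating space exists and all of them
  have the same growth exponent, so the choice does not matter.
\<close>
definition GKdim :: "('f, 'r) ring_scheme \<Rightarrow> ('f, 'a, 's) module_scheme \<Rightarrow> ereal" where
  "GKdim F A = growth_exponent F A (SOME V. generating_space F A V)"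

section \<open>Primitive rings\<close>

text \<open>
  The library locale \<^locale>\<open>module\<close> requires a commutative ring of scalars. As there, the
  multiplicative part of the record \<open>M\<close> is irrelevant.
\<close>
locale left_module = A?: ring A + M?: abelian_group M
  for A :: "('a, 'r) ring_scheme" and M :: "('a, 'm, 's) module_scheme" (structure) +
  assumes smult_closed:
      "\<lbrakk>a \<in> carrier A; x \<in> carrier M\<rbrakk> \<Longrightarrow> a \<odot> x \<in> carrier M"
    and smult_l_distr:
      "\<lbrakk>a \<in> carrier A; b \<in> carrier A; x \<in> carrier M\<rbrakk> \<Longrightarrow> (a \<oplus>\<^bsub>A\<^esub> b) \<odot> x = a \<odot> x \<oplus> b \<odot> x"
    and smult_r_distr:
      "\<lbrakk>a \<in> carrier A; x \<in> carrier M; y \<in> carrier M\<rbrakk> \<Longrightarrow> a \<odot> (x \<oplus> y) = a \<odot> x \<oplus> a \<odot> y"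
    and smult_assoc:
      "\<lbrakk>a \<in> carrier A; b \<in> carrier A; x \<in> carrier M\<rbrakk> \<Longrightarrow> (a \<otimes>\<^bsub>A\<^esub> b) \<odot> x = a \<odot> (b \<odot> x)"
    and smult_one: "x \<in> carrier M \<Longrightarrow> \<one>\<^bsub>A\<^esub> \<odot> x = x"

definition simple_left_module :: "('a, 'r) ring_scheme \<Rightarrow> ('a, 'm, 's) module_scheme \<Rightarrow> bool" where
  "simple_left_module A M \<longleftrightarrow>
    left_module A M \<and> carrier M \<noteq> {\<zero>\<^bsub>M\<^esub>} \<and>
    (\<forall>N. Module.submodule N A M \<longrightarrow> N = {\<zero>\<^bsub>M\<^esub>} \<or> N = carrier M)"

definition faithful_left_module :: "('a, 'r) ring_scheme \<Rightarrow> ('a, 'm, 's) module_scheme \<Rightarrow> bool" where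
  "faithful_left_module A M \<longleftrightarrow>
    left_module A M \<and>
    (\<forall>a \<in> carrier A. (\<forall>x \<in> carrier M. a \<odot>\<^bsub>M\<^esub> x = \<zero>\<^bsub>M\<^esub>) \<longrightarrow> a = \<zero>\<^bsub>A\<^esub>)"

text \<open>
  Every simple left \<open>A\<close>-module is isomorphic to \<open>A / L\<close> for a maximal left ideal \<open>L\<close>, whose
  elements are subsets of \<open>A\<close>. So it is no restriction to look for the module on the
  type \<^typ>\<open>'a set\<close>.
\<close>
definition primitive_ring :: "('a, 'r) ring_scheme \<Rightarrow> bool" where
  "primitive_ring A \<longleftrightarrow>
    ring A \<and> (\<exists>M :: ('a, 'a set) module. simple_left_module A M \<and> faithful_left_module A M)"

end

theory Submission
  imports Defs "HOL-Library.Sublist"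
begin

text \<open>
  A factorial language \<open>L\<close> is a basis of the monomial algebra whose relations are the words outside \<open>L\<close>, and
  the growth of that algebra counts the words of \<open>L\<close> of length at most \<open>n\<close>. For a tensor product the
  two counting functions are multiplied.

  If \<open>L\<close> is uniformly recurrent and its words can be isolated by a context, every nonzero ideal contains
  all words of some length \<open>n\<close>, hence \<open>T\<^sup>n\<close> for the sum \<open>T\<close> of the letters. Since \<open>T\<close> is not
  nilpotent, the left ideal generated by \<open>1 - T\<close> is proper; a maximal left ideal above it yields a faithful
  simple module.

  The languages are built from pairs of blocks \<open>P\<^sub>k, Q\<^sub>k\<close> of equal length. At each level \<open>t\<^sub>k\<close> words
  \<open>R\<^sub>i\<close> in \<open>P\<^sub>k, Q\<^sub>k\<close>, in which \<open>Q\<^sub>k\<close> occurs only sparsely, are concatenated to the new blocks. Up to the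
  length \<open>N\<^sub>k\<close> at which two occurrences of \<open>Q\<^sub>k\<close> become visible the complexity is linear. From there on it is
  of order \<open>n t\<^sub>k\<close>, and it is linear again from the length of the new blocks on. With \<open>t\<^sub>k\<close> about
  \<open>N\<^sub>k\<close> to the power \<open>s\<^sub>k - 2\<close> the growth is of order \<open>N\<^sub>k\<close> to the power \<open>s\<^sub>k\<close> near \<open>N\<^sub>k\<close>, and at most \<open>n\<close> to
  the power \<open>s\<^sub>k\<close> until \<open>N\<^sub>k\<^sub>+\<^sub>1\<close>. The exponents of the two languages alternate between \<open>\<alpha>, \<gamma>\<close> and \<open>2, \<beta>\<close>, so
  that the product grows with the exponents \<open>\<alpha> + 2\<close> and \<open>\<gamma> + \<beta>\<close> in turn.
\<close>

section \<open>Comma-free codes and words with large gaps\<close>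

text \<open>The difficulty lies in the product: at a scale where both languages were near their
  largest exponents, the tensor product would grow with exponent \<alpha> + \<beta>. Hence both
  languages run over the same scales \<open>N k\<close>, which depend only on a common integer bound
  \<open>b\<close> for the exponents, and their bursts can be switched on at different
  \<open>k\<close>. Without a burst the complexity is linear and the growth quadratic; this is the
  source of the bound 2 for the exponents.

  A burst of exponent s needs about N^(s-2) code words whose length stays within a constant factor
  of \<open>q k\<close>, although their number may be a high power of \<open>q k\<close>. For this
  reason the information sits in the sizes of the gaps: m gaps with q possible sizes each give q^m
  words of length of order m q, and a fixed m proportional to \<open>b\<close> is enough. The scales
  must be so sparse that the blocks built at one scale are short at the next; the exponent 2 b + 4
  in \<open>N\<close> achieves this. Finally \<alpha> + 2 \<le> \<beta> + \<gamma>, so the second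
  kind of scale decides the exponent of the product.\<close>

definition comma_free :: "'a list set \<Rightarrow> bool" where
  "comma_free B \<longleftrightarrow> (\<forall>X\<in>B. \<forall>Y\<in>B. \<forall>Z\<in>B. \<forall>a b. X @ Y = a @ Z @ b \<longrightarrow> a = [] \<or> b = [])"

text \<open>A copy of \<open>Z\<close> that starts before the end of the first word either coincides
  with that word or straddles the first two words; comma-freeness forbids the latter. A copy that
  starts later is handled by induction.\<close>

lemma comma_free_alignment:
  assumes cf: "comma_free B" and len: "\<forall>X\<in>B. length X = l" and l: "l > 0" and Z: "Z \<in> B"
    and "set ws \<subseteq> B" "concat ws = a @ Z @ b"
  shows "\<exists>us vs. ws = us @ Z # vs \<and> a = concat us \<and> b = concat vs"
  using assms(5,6)
proof (induction ws arbitrary: a)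
  case Nil
  then show ?case using len l Z by auto
next
  case (Cons X ws)
  have lX: "length X = l" and lZ: "length Z = l" using Cons.prems len Z by auto
  show ?case
  proof (cases "l \<le> length a")
    case True
    then obtain a' where a: "a = X @ a'"
      using Cons.prems(2) lX by (auto simp: append_eq_append_conv2)
    then have "concat ws = a' @ Z @ b" using Cons.prems(2) by simp
    then obtain us vs where "ws = us @ Z # vs \<and> a' = concat us \<and> b = concat vs"
      using Cons.IH Cons.prems(1) by auto
    then have "X # ws = (X # us) @ Z # vs \<and> a = concat (X # us) \<and> b = concat vs" using a by simp
    then show ?thesis by blast
  next
    case False
    show ?thesis
    proof (cases "a = []")
      case True
      then have "X = Z \<and> concat ws = b" using Cons.prems(2) lX lZ by simp
      then have "X # ws = [] @ Z # ws \<and> a = concat [] \<and> b = concat ws" using True by simp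
      then show ?thesis by blast
    next
      case ne: False
      have "ws \<noteq> []"
      proof
        assume "ws = []"
        then have "length X = length a + length Z + length b" using Cons.prems(2)
            by (metis append_Nil2 concat.simps add.assoc length_append)
        then show False using lX lZ ne by simp
      qed
      then obtain Y ws' where ws: "ws = Y # ws'" by (cases ws) auto
      then have Y: "Y \<in> B" "length Y = l" using Cons.prems(1) len by auto
      \<comment> \<open>The part of the second word \<open>Y\<close> that remains behind the
        straddling copy of \<open>Z\<close>. It is nonempty because \<open>a\<close> is shorter than
        \<open>l\<close>.\<close>
      define b' where "b' = take (l - length a) b"
      have "X @ Y = take (2 * l) (concat (X # ws))" using ws lX Y by simp
      also have "\<dots> = a @ Z @ b'" using Cons.prems(2) lZ False by (simp add: b'_def)
      finally have e: "X @ Y = a @ Z @ b'" .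
      then have "length b' = l - length a" using lX Y lZ
        by (metis add_diff_cancel_right' add_implies_diff diff_diff_left length_append add.commute)
      then have "b' \<noteq> []" using False by auto
      then show ?thesis using cf e ne Cons.prems(1) Y Z unfolding comma_free_def
        by (metis list.set_intros(1) subsetD)
    qed
  qed
qed

text \<open>Unique decoding: images of equal length can be cut off one after the other, and
  \<open>g\<close> is injective.\<close>

lemma concat_map_prefix:
  assumes len: "\<forall>x\<in>S. length (g x) = l" and l: "l > 0" and inj: "inj_on g S"
    and "set zs \<subseteq> S" "set w \<subseteq> S" "concat (map g zs) @ b = concat (map g w)"
  shows "\<exists>v. w = zs @ v \<and> b = concat (map g v)"
  using assms(4-6)
proof (induction zs arbitrary: w)
  case Nil then show ?case by simp
next
  case (Cons z zs)
  have "w \<noteq> []" using Cons.prems len l by auto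
  then obtain y w' where w: "w = y # w'" by (cases w) auto
  have ly: "length (g y) = l" "length (g z) = l" using Cons.prems w len by auto
  then have "g z = g y" "concat (map g zs) @ b = concat (map g w')" using Cons.prems(3) w by simp_all
  then show ?case using Cons.IH[of w'] Cons.prems w inj by (auto dest: inj_onD)
qed

lemma comma_free_alignment_word:
  assumes cf: "comma_free (g ` S)" and len: "\<forall>x\<in>S. length (g x) = l" and l: "l > 0"
    and inj: "inj_on g S" and S: "set w \<subseteq> S" "set z \<subseteq> S" and z: "z \<noteq> []"
    and e: "concat (map g w) = a @ concat (map g z) @ b"
  shows "\<exists>u v. w = u @ z @ v \<and> a = concat (map g u) \<and> b = concat (map g v)"
proof -
  obtain z0 zs where zz: "z = z0 # zs" using z by (cases z) auto
  have "\<exists>us vs. map g w = us @ g z0 # vs \<and> a = concat us \<and> concat (map g zs) @ b = concat vs"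
    by (rule comma_free_alignment[OF cf _ l]) (use len S zz e in auto)
  then obtain us vs where uv: "map g w = us @ g z0 # vs" "a = concat us" "concat (map g zs) @ b
      = concat vs"
    by blast
  then obtain u w1 w2 where w: "w = u @ w1 # w2" "us = map g u" "g w1 = g z0" "vs = map g w2"
    by (auto simp: map_eq_append_conv map_eq_Cons_conv)
  then have "w1 = z0" using S zz inj by (auto dest: inj_onD)
  moreover obtain v where "w2 = zs @ v" "b = concat (map g v)"
    using concat_map_prefix[OF len l inj, of zs w2 b] S zz w uv by auto
  ultimately show ?thesis using w uv zz by auto
qed

text \<open>An occurrence is first aligned with the inner code and thus comes from an occurrence of
  words over \<open>S\<close>, where comma-freeness of \<open>C\<close> applies. This lets
  comma-freeness climb the tower.\<close>

lemma comma_free_compose: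
  assumes cf: "comma_free (g ` S)" and len: "\<forall>x\<in>S. length (g x) = l" and l: "l > 0"
    and inj: "inj_on g S" and C: "comma_free C" "\<forall>w\<in>C. set w \<subseteq> S \<and> w \<noteq> []"
  shows "comma_free ((\<lambda>w. concat (map g w)) ` C)"
  unfolding comma_free_def
proof (intro ballI allI impI, elim imageE)
  fix X Y Z a b x y z
  assume x: "x \<in> C" "y \<in> C" "z \<in> C"
      and X: "X = concat (map g x)" "Y = concat (map g y)" "Z = concat (map g z)"
    and e: "X @ Y = a @ Z @ b"
  have "concat (map g (x @ y)) = a @ concat (map g z) @ b" using e X by simp
  then obtain u v where uv: "x @ y = u @ z @ v" "a = concat (map g u)" "b = concat (map g v)"
    using comma_free_alignment_word[OF cf len l inj, of "x @ y" z a b] x C by auto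
  then have "u = [] \<or> v = []" using C(1) x unfolding comma_free_def by blast
  then show "a = [] \<or> b = []" using uv by auto
qed

text \<open>The letter \<open>c\<close> matches only at the start of \<open>X\<close> or of
  \<open>Y\<close>, so a copy of a third word starts at one of these two places.\<close>

lemma comma_free_first_letter:
  assumes "\<forall>w\<in>C. \<exists>v. w = c # v \<and> c \<notin> set v \<and> length v = n"
  shows "comma_free C"
  unfolding comma_free_def
proof (intro ballI allI impI)
  fix X Y Z a b assume C: "X \<in> C" "Y \<in> C" "Z \<in> C" and e: "X @ Y = a @ Z @ b"
  obtain x y z where w: "X = c # x" "Y = c # y" "Z = c # z" "c \<notin> set x" "c \<notin> set y"
    "length x = n" "length y = n" "length z = n" using assms C by blast
  have "(x @ c # y) = (tl a) @ c # z @ b" if "a \<noteq> []" using e w that by (cases a) auto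
  then have "a \<noteq> [] \<Longrightarrow> tl a = x \<and> y = z @ b"
    using w by (subst (asm) append_Cons_eq_iff) (auto simp: )
  then show "a = [] \<or> b = []" using w by (cases "a = []") auto
qed

section \<open>Words coded by the sizes of their gaps\<close>

definition gap_word :: "nat list \<Rightarrow> bool list" where
  "gap_word gs = concat (map (\<lambda>g. True # replicate g False) gs)"

lemma gap_word_simps [simp]: "gap_word [] = []"
  "gap_word (g # gs) = True # replicate g False @ gap_word gs"
  "gap_word (gs @ gs') = gap_word gs @ gap_word gs'"
  by (simp_all add: gap_word_def)

lemma length_gap_word: "length (gap_word gs) = length gs + sum_list gs"
  by (induction gs) auto

lemma gap_word_hd: "gap_word gs = b # w \<Longrightarrow> b"
  by (cases gs) auto

text \<open>A \<open>True\<close> occurs only at the start of a segment, so cutting the word at a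
  \<open>True\<close> cuts the list of gaps.\<close>

lemma gap_word_split:
  assumes "gap_word gs = a @ True # b"
  shows "\<exists>g1 g g2. gs = g1 @ g # g2 \<and> a = gap_word g1 \<and> b = replicate g False @ gap_word g2"
  using assms
proof (induction gs arbitrary: a)
  case Nil then show ?case by simp
next
  case (Cons g gs)
  show ?case
  proof (cases a)
    case Nil
    then have "g # gs = [] @ g # gs \<and> a = gap_word [] \<and> b = replicate g False @ gap_word gs"
      using Cons.prems by simp
    then show ?thesis by blast
  next
    case (Cons c a')
    have e: "replicate g False @ gap_word gs = a' @ True # b" and c: "c" using Cons.prems Cons
        by simp_all
    have "\<exists>a''. a' = replicate g False @ a'' \<and> gap_word gs = a'' @ True # b"
    proof (cases "length a' < g")
      case True
      then have "(replicate g False @ gap_word gs) ! length a' = False" by (simp add: nth_append)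
      then show ?thesis using e by simp
    next
      case False
      then have "take g a' = replicate g False" using arg_cong[OF e, of "take g"] by simp
      then have "a' = replicate g False @ drop g a'" by (metis append_take_drop_id)
      then show ?thesis using e by (metis append.assoc append_same_eq same_append_eq)
    qed
    then obtain a'' where a'': "a' = replicate g False @ a''" "gap_word gs = a'' @ True # b" by blast
    then obtain g1 g' g2 where "gs = g1 @ g' # g2" "a'' = gap_word g1" "b
        = replicate g' False @ gap_word g2"
      using Cons.IH by blast
    then have "g # gs = (g # g1) @ g' # g2 \<and> a = gap_word (g # g1) \<and> b
        = replicate g' False @ gap_word g2"
      using Cons c a'' by simp
    then show ?thesis by blast
  qed
qed

text \<open>Behind the first gap a gap word either ends or continues with \<open>True\<close>, so a
  run of \<open>False\<close> cannot be longer than that gap.\<close>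

lemma replicate_gap_word_le:
  assumes "replicate g False @ gap_word gs = replicate c False @ w"
  shows "c \<le> g"
proof (rule ccontr)
  assume "\<not> c \<le> g"
  then have "replicate c False = replicate g False @ False # replicate (c - Suc g) False"
    by (metis Suc_diff_Suc linorder_not_le replicate_Suc replicate_add le_add_diff_inverse less_imp_le)
  then have "gap_word gs = False # replicate (c - Suc g) False @ w" using assms by simp
  then show False by (auto dest: gap_word_hd)
qed

lemma gap_word_sparse:
  assumes "gap_word gs = a @ True # b @ True # c" "\<forall>g\<in>set gs. s \<le> g"
  shows "s \<le> length b"
proof (rule ccontr)
  assume n: "\<not> s \<le> length b"
  obtain g1 g g2 where g: "gs = g1 @ g # g2" "b @ True # c = replicate g False @ gap_word g2"
    using gap_word_split[OF assms(1)] by blast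
  then have "length b < g" using n assms(2) by auto
  then have "(replicate g False @ gap_word g2) ! length b = False" by (simp add: nth_append)
  then show False using g(2) by (metis nth_append_length)
qed

text \<open>Every list begins with the gap \<open>c\<close>, which exceeds all its other gaps. A
  copy of a code word therefore starts where a gap of size at least \<open>c\<close> starts, that
  is, at the start of \<open>X\<close> or of \<open>Y\<close>.\<close>

lemma comma_free_gap_words:
  assumes "\<forall>gs\<in>A. \<exists>hs. gs = c # hs \<and> (\<forall>h\<in>set hs. h < c)" "\<forall>gs\<in>A. length (gap_word gs) = r"
  shows "comma_free (gap_word ` A)"
  unfolding comma_free_def
proof (intro ballI allI impI, elim imageE)
  fix X Y Z a b x y z
  assume A: "x \<in> A" "y \<in> A" "z \<in> A" and X: "X = gap_word x" "Y = gap_word y" "Z = gap_word z"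
    and e: "X @ Y = a @ Z @ b"
  obtain x' where x': "x = c # x'" "\<forall>h\<in>set x'. h < c" 
    using bspec[OF assms(1) A(1)] by (elim exE conjE)
  obtain y' where y': "y = c # y'" "\<forall>h\<in>set y'. h < c" 
    using bspec[OF assms(1) A(2)] by (elim exE conjE)
  obtain z' where z': "z = c # z'" 
    using bspec[OF assms(1) A(3)] by (elim exE conjE)
  note h = x'(1) y'(1) z' and hx = x'(2) y'(2)
  have "gap_word (x @ y) = a @ True # (replicate c False @ gap_word z' @ b)" using e X h by simp
  then obtain g1 g g2 where g: "x @ y = g1 @ g # g2" "a = gap_word g1"
      "replicate c False @ gap_word z' @ b = replicate g False @ gap_word g2"
    using gap_word_split by blast
  \<comment> \<open>Only an inequality at this point: if \<open>z'\<close> is empty,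
    \<open>b\<close> could prolong the run of \<open>False\<close>.\<close>
  have "c \<le> g" using replicate_gap_word_le[OF g(3)[symmetric]] .
  have idx: "j = 0" if "\<forall>h\<in>set v. h < c" "j < Suc (length v)" "c \<le> (c # v) ! j" for v j
  proof (cases j)
    case (Suc i)
    then have "v ! i \<in> set v" "c \<le> v ! i" using that by auto
    then show ?thesis using that(1) by (meson linorder_not_le)
  qed
  have "g1 = [] \<or> g1 = x"
  proof (cases "length g1 < length x")
    case True
    then have "x ! length g1 = g" using g(1) by (metis nth_append nth_append_length)
    then show ?thesis using idx[OF hx(1), of "length g1"] h True \<open>c \<le> g\<close> by auto
  next
    case False
    define i where "i = length g1 - length x"
    have "y ! i = g" using g(1) False unfolding i_def by (metis nth_append nth_append_length)
    moreover have "i < length y" using arg_cong[OF g(1), of length] False unfolding i_def by simp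
    ultimately have "i = 0" using idx[OF hx(2), of i] h \<open>c \<le> g\<close> by auto
    then have "length g1 = length x" using False i_def by simp
    then show ?thesis using g(1) by simp
  qed
  then show "a = [] \<or> b = []"
  proof
    assume "g1 = x"
    then have "a = X" using g X by simp
    then have "length Y = length Z + length b" using e by simp
    moreover have "length Y = r" "length Z = r" using X A assms(2) by auto
    ultimately show ?thesis by simp
  qed (use g in simp)
qed

lemma uniform_length_concat: "\<forall>x\<in>set xs. length (g x) = l \<Longrightarrow> length (concat (map g xs)) = length xs * l"
  by (induction xs) auto

section \<open>Towers of comma-free blocks\<close>

definition digit_block :: "nat \<Rightarrow> 'a list \<Rightarrow> 'a list \<Rightarrow> nat list \<Rightarrow> 'a list" where
  "digit_block q P Q d = concat (map (\<lambda>b. if b then Q else P)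
     (gap_word (6 * q # concat (map (\<lambda>i. [3 * q + i, 4 * q - i]) d))))"

text \<open>
  A list \<open>d\<close> of \<open>m\<close> digits is coded by the gaps between the letters \<open>True\<close>. The marker \<open>6 q\<close>, the largest
  gap, occurs only in front and makes the code comma-free. Each digit \<open>i\<close> contributes the gaps \<open>3 q + i\<close> and
  \<open>4 q - i\<close>, so that all code words have the same length.

  In both new blocks \<open>x\<close> comes first and occurs only there, which makes these comma-free again, while \<open>z\<close> is always
  preceded by \<open>y\<close>, so that a left context of \<open>z\<close> is determined.
\<close>
locale block_tower =
  fixes m :: nat and q :: "nat \<Rightarrow> nat" and x y z :: "nat \<Rightarrow> nat list" and ds :: "nat \<Rightarrow> nat list list"
    and P Q :: "nat \<Rightarrow> nat list"
  assumes q_pos: "q k > 0"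
    and digits: "d \<in> set (x k # ds k @ [y k, z k]) \<Longrightarrow> length d = m \<and> (\<forall>i\<in>set d. i < q k)"
    and dist: "distinct (x k # ds k @ [y k, z k])"
    and len_ds: "length (ds k) \<ge> 2"
    and P_0: "P 0 = [0]" and Q_0: "Q 0 = [1]"
    and P_Suc: "P (Suc k) = concat (map (digit_block (q k) (P k) (Q k)) (x k # ds k @ [y k, z k]))"
    and Q_Suc: "Q (Suc k) = concat (map (digit_block (q k) (P k) (Q k)) (x k # rev (ds k) @ [y k, z k]))"
begin

definition gaps where "gaps k d = 6 * q k # concat (map (\<lambda>i. [3 * q k + i, 4 * q k - i]) d)"
definition codeword where "codeword k d = gap_word (gaps k d)"
definition block where "block k b = (if b then Q k else P k)"
definition expand where "expand k w = concat (map (block k) w)"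
definition code_block where "code_block k d = expand k (codeword k d)"
definition digit_words where "digit_words k = set (x k # ds k @ [y k, z k])"
text \<open>Reversing the middle part gives a second block with the same code blocks, hence of the
  same length, while \<open>x k\<close>, \<open>y k\<close> and \<open>z k\<close> keep their
  places.\<close>

definition arrangement where "arrangement k b = x k # (if b then rev (ds k) else ds k) @ [y k, z k]"
definition block_length where "block_length k = length (P k)"
text \<open>The marker takes \<open>1 + 6 * q k\<close> letters. A digit takes two gaps of total
  size \<open>7 * q k\<close> with their two letters \<open>True\<close>; the complementary gap
  \<open>4 * q k - i\<close> makes this total independent of the digit.\<close>

definition code_length where "code_length k = 1 + 6 * q k + m * (7 * q k + 2)"
definition num_codes where "num_codes k = length (ds k) + 3"
text \<open>The factors of the blocks \<open>Q k\<close> are covered as well, since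
  \<open>Q k\<close> occurs in \<open>P (Suc k)\<close>.\<close>

definition language where "language = {w. \<exists>k. sublist w (P k)}"

lemma expand_simps [simp]: "expand k [] = []" "expand k (b # w) = block k b @ expand k w"
    "expand k (v @ w) = expand k v @ expand k w"
  "expand k (replicate 0 False) = []"
  by (simp_all add: expand_def)

lemma block_Suc: "block (Suc k) b = concat (map (code_block k) (arrangement k b))"
proof -
  have "code_block k = digit_block (q k) (P k) (Q k)"
    by (simp add: fun_eq_iff code_block_def expand_def codeword_def gaps_def block_def[abs_def] digit_block_def)
  then show ?thesis by (simp add: block_def arrangement_def P_Suc Q_Suc)
qed

lemma set_arrangement: "set (arrangement k b) = digit_words k"
    by (auto simp: arrangement_def digit_words_def)

lemma length_arrangement: "length (arrangement k b) = num_codes k"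
    by (simp add: arrangement_def num_codes_def)

lemma concat_map_pairs: "length (concat (map (\<lambda>i. [f i, g i]) d)) = 2 * length d"
  by (induction d) auto

lemma length_codeword: "d \<in> digit_words k \<Longrightarrow> length (codeword k d) = code_length k"
proof -
  assume d: "d \<in> digit_words k"
  have "sum_list (concat (map (\<lambda>i. [3 * q k + i, 4 * q k - i]) d')) = length d' * (7 * q k)"
    if "\<forall>i\<in>set d'. i < q k" for d' using that by (induction d') auto
  then show ?thesis using digits[of d k] d
    by (simp add: codeword_def gaps_def digit_words_def length_gap_word concat_map_pairs code_length_def algebra_simps)
qed

text \<open>Both claims go together: the length of the blocks of level \<open>Suc k\<close> is known
  only once \<open>P k\<close> and \<open>Q k\<close> are known to be equally long.\<close>

lemma block_length_Suc: "length (Q k) = block_length k \<and> block_length (Suc k)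
    = num_codes k * code_length k * block_length k"
proof -
  have *: "length (block (Suc k) b) = num_codes k * (code_length k * block_length k)"
      if "length (Q k) = block_length k" for k b
  proof -
    have "\<forall>b\<in>set w. length (block k b) = block_length k" for w using that
        by (auto simp: block_def block_length_def)
    then have "length (expand k w) = length w * block_length k" for w unfolding expand_def
      by (rule uniform_length_concat)
    then have "\<forall>d\<in>set (arrangement k b). length (code_block k d) = code_length k * block_length k"
      using set_arrangement[of k b] by (simp add: code_block_def length_codeword)
    from uniform_length_concat[of "arrangement k b" "code_block k", OF this] show ?thesis
      by (simp add: block_Suc length_arrangement)
  qed
  have Q: "length (Q k) = block_length k" for k
  proof (induction k)
    case 0 then show ?case by (simp add: block_length_def P_0 Q_0)
  next
    case (Suc k)
    then show ?case using *[of k True] *[of k False] by (simp add: block_def block_length_def)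
  qed
  show ?thesis using Q[of k] *[of k False] by (simp add: block_def block_length_def)
qed

lemma length_block [simp]: "length (block k b) = block_length k"
  using block_length_Suc[of k] by (simp add: block_def block_length_def)

lemma length_expand [simp]: "length (expand k w) = length w * block_length k"
  unfolding expand_def by (rule uniform_length_concat) simp

lemma length_code_block: "d \<in> digit_words k \<Longrightarrow> length (code_block k d) = code_length k * block_length k"
  by (simp add: code_block_def length_codeword)

lemma code_length_pos: "code_length k > 0" by (simp add: code_length_def)
lemma num_codes_ge: "num_codes k \<ge> 5" using len_ds[of k] by (simp add: num_codes_def)

lemma block_length_pos [simp]: "block_length k > 0"
proof (induction k)
  case (Suc k)
  then show ?case using block_length_Suc[of k] code_length_pos[of k] num_codes_ge[of k] by simp
qed (simp add: block_length_def P_0)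

lemma block_length_Suc_ge: "block_length (Suc k) \<ge> 2 * block_length k"
proof -
  have "2 * 1 \<le> num_codes k * code_length k" using num_codes_ge[of k] code_length_pos[of k]
      by (intro mult_mono) auto
  then have "(2 * 1) * block_length k \<le> (num_codes k * code_length k) * block_length k"
      by (intro mult_right_mono) auto
  then show ?thesis using block_length_Suc[of k] by simp
qed

lemma block_length_gt: "k < block_length k"
proof (induction k)
  case (Suc k)
  then show ?case using block_length_Suc_ge[of k] by linarith
qed simp

lemma inj_gaps: "inj (gaps k)"
proof (rule injI)
  fix d d' assume "gaps k d = gaps k d'"
  then have "concat (map (\<lambda>i. [3 * q k + i, 4 * q k - i]) d)
      = concat (map (\<lambda>i. [3 * q k + i, 4 * q k - i]) d')"
    by (simp add: gaps_def)
  then show "d = d'"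
  proof (induction d arbitrary: d')
    case Nil then show ?case by (cases d') auto
  next
    case (Cons a d) then show ?case by (cases d') auto
  qed
qed

lemma inj_gap_word: "inj gap_word"
proof (rule injI)
  fix gs hs assume "gap_word gs = gap_word hs"
  then show "gs = hs"
  proof (induction gs arbitrary: hs)
    case Nil then show ?case by (cases hs) auto
  next
    case (Cons g gs)
    then obtain h hs' where h: "hs = h # hs'" by (cases hs) auto
    then have e: "replicate g False @ gap_word gs = replicate h False @ gap_word hs'" using Cons.prems
        by simp
    then have "g = h" using replicate_gap_word_le[OF e] replicate_gap_word_le[OF e[symmetric]] by simp
    then show ?case using e h Cons.IH by simp
  qed
qed

lemma inj_codeword: "inj (codeword k)"
  using inj_compose[OF inj_gap_word inj_gaps[of k]] by (simp add: codeword_def[abs_def] comp_def)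

text \<open>The smallest gaps are those of the digits, and \<open>4 * q k - i > 3 * q k\<close>. As
  a consequence, \<open>3 * q k\<close> consecutive letters contain at most one \<open>True\<close>,
  which is what keeps the complexity linear at first.\<close>

lemma gaps_bounds: "d \<in> digit_words k \<Longrightarrow> g \<in> set (gaps k d) \<Longrightarrow> 3 * q k \<le> g"
  using digits[of d k] by (fastforce simp: gaps_def digit_words_def)

lemma comma_free_codeword: "comma_free (codeword k ` digit_words k)"
proof -
  have "comma_free (gap_word ` (gaps k ` digit_words k))"
  proof (rule comma_free_gap_words)
    show "\<forall>gs\<in>gaps k ` digit_words k. \<exists>hs. gs = 6 * q k # hs \<and> (\<forall>h\<in>set hs. h < 6 * q k)"
      using digits[of _ k] q_pos[of k] by (fastforce simp: gaps_def digit_words_def)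
    show "\<forall>gs\<in>gaps k ` digit_words k. length (gap_word gs) = code_length k"
      using length_codeword by (auto simp: codeword_def)
  qed
  then show ?thesis by (simp add: image_image codeword_def[abs_def])
qed

lemma comma_free_arrangement: "comma_free (range (arrangement k))"
proof (rule comma_free_first_letter)
  show "\<forall>w\<in>range (arrangement k). \<exists>v. w = x k # v \<and> x k \<notin> set v \<and> length v = num_codes k - 1"
    using dist[of k] by (auto simp: arrangement_def num_codes_def)
qed

text \<open>A list of at least two distinct entries differs from its reversal in the first
  place.\<close>

lemma inj_arrangement: "inj (arrangement k)"
proof -
  have "ds k \<noteq> rev (ds k)"
  proof
    assume e: "ds k = rev (ds k)"
    have "ds k ! 0 = ds k ! (length (ds k) - 1)"
      using len_ds[of k] by (subst e) (subst rev_nth, auto)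
    moreover have "distinct (ds k)" "0 < length (ds k)" "length (ds k) - 1 < length (ds k)"
      using dist[of k] len_ds[of k] by auto
    ultimately have "0 = length (ds k) - 1" using nth_eq_iff_index_eq by blast
    then show False using len_ds[of k] by simp
  qed
  then show ?thesis by (auto simp: inj_def arrangement_def)
qed

text \<open>Comma-freeness passes from the blocks of level \<open>k\<close> to the code blocks by
  \<open>comma_free_codeword\<close>, and from these to the blocks of level \<open>Suc k\<close> by
  \<open>comma_free_arrangement\<close>. The first passage is isolated as \<open>aux\<close>, since
  both claims need it.\<close>

lemma block_comma_free: "comma_free (block k ` UNIV) \<and> inj (block k)"
  and code_block_comma_free_aux: "comma_free (block k ` UNIV) \<and> inj (block k)
      \<Longrightarrow> comma_free (code_block k ` digit_words k) \<and> inj_on (code_block k) (digit_words k)"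
proof -
  have aux: "comma_free (code_block k ` digit_words k) \<and> inj_on (code_block k) (digit_words k)"
    if h: "comma_free (block k ` UNIV) \<and> inj (block k)" for k
  proof
    have "comma_free ((\<lambda>w. concat (map (block k) w)) ` (codeword k ` digit_words k))"
      by (rule comma_free_compose[where l =
          "block_length k"]) (use h comma_free_codeword[of k] in \<open>auto simp: codeword_def gaps_def\<close>)
    then show "comma_free (code_block k ` digit_words k)"
        by (simp add: image_image code_block_def[abs_def] expand_def)
    have "w = w'" if "expand k w = expand k w'" for w w'
      using concat_map_prefix[of UNIV "block k" "block_length k" w w' "[]"] concat_map_prefix[of UNIV
          "block k" "block_length k" w' w "[]"] h that
      by (auto simp: expand_def)
    then show "inj_on (code_block k) (digit_words k)" using inj_codeword[of k]
        by (auto simp: inj_on_def inj_def code_block_def)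
  qed
  show "comma_free (code_block k ` digit_words k) \<and> inj_on (code_block k) (digit_words k)"
    if h: "comma_free (block k ` UNIV) \<and> inj (block k)" using aux[OF h] .
  show "comma_free (block k ` UNIV) \<and> inj (block k)"
  proof (induction k)
    case 0
    have "comma_free {[0], [1::nat]}" unfolding comma_free_def
      by (auto simp: append_eq_Cons_conv Cons_eq_append_conv)
    moreover have "range (block 0) = {[0], [1]}" by (auto simp: block_def P_0 Q_0)
    ultimately show ?case by (simp add: inj_def block_def P_0 Q_0)
  next
    case (Suc k)
    note h = aux[OF Suc]
    have "comma_free ((\<lambda>w. concat (map (code_block k) w)) ` range (arrangement k))"
      by (rule comma_free_compose[where l = "code_length k * block_length k" and S = "digit_words k"])
        (use h comma_free_arrangement[of k] length_code_block code_length_pos[of k] in \<open>auto simp: set_arrangement, auto simp: arrangement_def\<close>)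
    then have "comma_free (range (block (Suc k)))" by (simp add: image_image block_Suc[abs_def])
    moreover have "b = b'" if "block (Suc k) b = block (Suc k) b'" for b b'
    proof -
      have "\<exists>v. arrangement k b' = arrangement k b @ v \<and> [] = concat (map (code_block k) v)"
        by (rule concat_map_prefix[of "digit_words k" "code_block k" "code_length k * block_length k"])
         (use h that length_code_block[of _ k] code_length_pos[of k] in \<open>auto simp: set_arrangement block_Suc\<close>)
      then have "arrangement k b' = arrangement k b"
          using length_arrangement[of k b] length_arrangement[of k b'] by auto
      then show ?thesis using inj_arrangement[of k] by (auto dest: injD)
    qed
    ultimately show ?case by (simp add: inj_def)
  qed
qed

lemma code_block_comma_free: "comma_free (code_block k ` digit_words k)"
    "inj_on (code_block k) (digit_words k)"
  using code_block_comma_free_aux[OF block_comma_free] by auto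

lemma code_block_alignment:
  assumes "set w \<subseteq> digit_words k" "d \<in> digit_words k" "concat (map (code_block k) w)
      = a @ code_block k d @ b"
  shows "\<exists>u v. w = u @ d # v \<and> a = concat (map (code_block k) u) \<and> b = concat (map (code_block k) v)"
  using comma_free_alignment_word[of "code_block k" "digit_words k" "code_length k * block_length k" w
      "[d]" a b]
    code_block_comma_free[of k] length_code_block[of _ k] code_length_pos[of k] assms by auto

lemma expand_alignment:
  assumes "expand k w = a @ block k c @ b"
  shows "\<exists>u v. w = u @ c # v \<and> a = expand k u \<and> b = expand k v"
  using comma_free_alignment_word[of "block k" UNIV "block_length k" w
      "[c]" a b] block_comma_free[of k] assms
  by (auto simp: expand_def)

text \<open>The substitution that rewrites a word over the two blocks of level \<open>Suc k\<close>
  as a word over those of level \<open>k\<close>. Its values consist of complete code words.\<close>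

definition refine where "refine k w = concat (map (\<lambda>b. concat (map (codeword k) (arrangement k b))) w)"

lemma expand_Suc: "expand (Suc k) w = expand k (refine k w)"
proof -
  have "concat (map (code_block k) v) = expand k (concat (map (codeword k) v))" for v
    by (induction v) (auto simp: code_block_def)
  then show ?thesis by (induction w) (auto simp: refine_def block_Suc)
qed

lemma block_ex_le: "k \<le> j \<Longrightarrow> \<exists>w. block j b = expand k w"
proof (induction j arbitrary: b rule: dec_induct)
  case base
  have "block k b = expand k [b]" by simp
  then show ?case by blast
next
  case (step j)
  then obtain f where f: "\<And>b. block j b = expand k (f b)" by metis
  have "expand j v = expand k (concat (map f v))" for v by (induction v) (auto simp: f)
  then show ?case using expand_Suc[of j "[b]"] by auto
qed

text \<open>The strict inequality matters: only blocks of a higher level split into complete code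
  words of level \<open>k\<close>.\<close>

lemma block_ex_refine: "k < j \<Longrightarrow> \<exists>w. block j b = expand k (refine k w)"
  using block_ex_le[of "Suc k" j b] expand_Suc[of k] by (metis Suc_leI)

end

section \<open>Extension, recurrence and isolation of words\<close>

context block_tower begin

text \<open>The marker gap has size at least 2. This produces the factor \<open>P k @ P k\<close> in
  the next block, on which the extension of words and the lower bound for the complexity
  rest.\<close>

lemma codeword_start: "\<exists>w. codeword k d = True # False # False # w"
proof -
  have "2 \<le> 6 * q k" using q_pos[of k] by linarith
  then obtain n where n: "6 * q k = Suc (Suc n)" by (metis add_2_eq_Suc le_Suc_ex)
  show ?thesis by (simp add: codeword_def gaps_def n del: mult_Suc mult_Suc_right)
qed

lemma code_block_start: "\<exists>w. code_block k d = Q k @ P k @ P k @ w"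
  using codeword_start[of k d] by (auto simp: code_block_def block_def)

lemma block_Suc_start: "\<exists>w. block (Suc k) b = Q k @ P k @ P k @ w"
  using code_block_start[of k "x k"] by (auto simp: block_Suc arrangement_def)

lemma sublist_block_Suc: "sublist (block k c) (block (Suc k) b)"
proof -
  obtain w where w: "block (Suc k) b = Q k @ P k @ P k @ w" using block_Suc_start by blast
  have "sublist (Q k) (Q k @ P k @ P k @ w)" "sublist (P k) (Q k @ P k @ P k @ w)"
    unfolding sublist_def by (metis append_Nil, blast)
  then show ?thesis using w by (cases c) (simp_all only: block_def if_True if_False)
qed

lemma sublist_P_mono: "k \<le> j \<Longrightarrow> sublist (P k) (P j)"
proof (induction j rule: dec_induct)
  case (step j)
  then show ?case using sublist_block_Suc[of j False False]
    by (auto simp: block_def intro: sublist_order.order.trans)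
qed simp

lemma language_sublist: "w \<in> language \<Longrightarrow> sublist u w \<Longrightarrow> u \<in> language"
  unfolding language_def by (blast intro: sublist_order.order.trans)

text \<open>The level may be taken as high as needed; the proof of \<open>isolation\<close> takes it
  above the length of the word.\<close>

lemma language_above: "w \<in> language \<Longrightarrow> \<exists>j>k. sublist w (P j)"
proof -
  assume "w \<in> language"
  then obtain i where "sublist w (P i)" by (auto simp: language_def)
  then have "sublist w (P (Suc (max i k)))"
    using sublist_P_mono[of i "Suc (max i k)"] sublist_order.order.trans
        by (metis le_SucI max.cobounded1)
  then show ?thesis by (metis less_Suc_eq_le max.cobounded2)
qed

lemma language_refine: "w \<in> language \<Longrightarrow> \<exists>v a b. expand k (refine k v) = a @ w @ b"
proof -
  assume "w \<in> language"
  then obtain j where j: "k < j" "sublist w (P j)" using language_above by blast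
  obtain v where "P j = expand k (refine k v)" using block_ex_refine[OF j(1), of False]
      by (auto simp: block_def)
  then show ?thesis using j(2) unfolding sublist_def by metis
qed

lemma P_in_language: "P k \<in> language" by (auto simp: language_def)

lemma PP_in_language: "P k @ P k \<in> language"
proof -
  obtain w where "P (Suc k) = Q k @ (P k @ P k) @ w" using block_Suc_start[of k False]
      by (auto simp: block_def)
  then have "sublist (P k @ P k) (P (Suc k))" by (auto simp: sublist_def)
  then show ?thesis using P_in_language language_sublist by blast
qed

lemma language_letters: "w \<in> language \<Longrightarrow> set w \<subseteq> {..<2}"
proof -
  have "set (block k b) \<subseteq> {..<2}" for k b
  proof (induction k arbitrary: b)
    case 0 then show ?case by (auto simp: block_def P_0 Q_0)
  next
    case (Suc k)
    then have "set (expand k v) \<subseteq> {..<2}" for v by (induction v) auto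
    then show ?case by (auto simp: block_Suc code_block_def)
  qed
  then have P: "set (P k) \<subseteq> {..<2}" for k using block_def[of k False] by metis
  assume "w \<in> language"
  then obtain k where "sublist w (P k)" by (auto simp: language_def)
  then show "set w \<subseteq> {..<2}" using P[of k] set_mono_sublist by blast
qed

lemma language_extend: "w \<in> language \<Longrightarrow> \<exists>c. w @ [c] \<in> language"
proof -
  assume "w \<in> language"
  then obtain k a b where e: "P k = a @ w @ b" by (auto simp: language_def sublist_def)
  have "P k \<noteq> []" using block_length_pos[of k] by (auto simp: block_length_def)
  then obtain c d where c: "b @ P k = c # d" by (cases "b @ P k") auto
  have "P k @ P k = a @ (w @ [c]) @ d" using e c by (metis append.assoc append_Cons append_Nil)
  then have "sublist (w @ [c]) (P k @ P k)" by (auto simp: sublist_def)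
  then show ?thesis using PP_in_language language_sublist by blast
qed

lemma window_block:
  assumes e: "expand k v = a @ w @ b" and w: "2 * block_length k \<le> length w"
  shows "\<exists>c. sublist (block k c) w"
proof -
  \<comment> \<open>\<open>i\<close> numbers the first block boundary strictly after the start of
    the window, even if the window starts at a boundary; so its distance \<open>c\<close> is at most
    one block length.\<close>
  define i where "i = Suc (length a div block_length k)"
  define c where "c = i * block_length k - length a"
  have "length a < i * block_length k"
    unfolding i_def using block_length_pos[of k] by (metis div_less_iff_less_mult lessI)
  moreover have "i * block_length k \<le> length a + block_length k"
    using div_times_less_eq_dividend[of "length a" "block_length k"] unfolding i_def mult_Suc by linarith
  ultimately have c: "length a + c = i * block_length k" "c \<le> block_length k" by (auto simp: c_def)
  have "length (expand k v) = length a + length w + length b" using e by simp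
  then have "i * block_length k + block_length k \<le> length v * block_length k" using c w by simp
  then have "Suc i \<le> length v" using block_length_pos[of k]
      by (metis add.commute mult_Suc mult_le_cancel2)
  then have v: "v = take i v @ v ! i # drop (Suc i) v" by (simp add: id_take_nth_drop)
  have "expand k (take i v) @ block k (v ! i) @ expand k (drop (Suc i) v)
      = (a @ take c w) @ drop c w @ b"
    using e v by (metis append.assoc append_take_drop_id expand_simps(2,3))
  then have "block k (v ! i) @ expand k (drop (Suc i) v) = drop c w @ b"
    using c w \<open>Suc i \<le> length v\<close> by (subst (asm) append_eq_append_conv) auto
  from arg_cong[OF this, of "take (block_length k)"] have "block k (v ! i)
      = take (block_length k) (drop c w)"
    using c w by simp
  then show ?thesis
    by (metis sublist_order.order.trans sublist_take sublist_drop)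
qed

text \<open>A window of twice the block length of level \<open>Suc k\<close> contains a complete
  block of that level, and either of the two blocks contains \<open>P k\<close>.\<close>

lemma uniformly_recurrent:
  assumes "u \<in> language" shows "\<exists>N. \<forall>w\<in>language. N \<le> length w \<longrightarrow> sublist u w"
proof -
  obtain k where k: "sublist u (P k)" using assms by (auto simp: language_def)
  have "sublist u w" if w: "w \<in> language" "2 * block_length (Suc k) \<le> length w" for w
  proof -
    obtain v a b where "expand (Suc k) v = a @ w @ b" using language_refine[OF w(1), of "Suc k"] by blast
    then obtain c where "sublist (block (Suc k) c) w" using window_block w(2) by blast
    moreover have "sublist (P k) (block (Suc k) c)" using sublist_block_Suc[of k False c]
        by (simp add: block_def)
    ultimately show ?thesis using k by (meson sublist_order.order.trans)
  qed
  then show ?thesis by blast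
qed

text \<open>In each arrangement \<open>z k\<close> occurs only at the end, behind
  \<open>y k\<close>; as the word consists of complete arrangements, no other predecessor is
  possible.\<close>

lemma arrangement_before_z:
  "concat (map (arrangement k) v) = us @ z k # vs \<Longrightarrow> \<exists>us'. us = us' @ [y k]"
proof (induction v arbitrary: us)
  case (Cons b v)
  obtain s where s: "arrangement k b = s @ [y k, z k]" "z k \<notin> set (s @ [y k])"
    using dist[of k] by (auto simp: arrangement_def)
  have "(s @ [y k]) @ z k # concat (map (arrangement k) v) = us @ z k # vs" using Cons.prems s(1) by simp
  then consider us2 where "us = s @ [y k]" | us2
      where "us = (s @ [y k, z k]) @ us2" "concat (map (arrangement k) v) = us2 @ z k # vs"
    | us2 where "s @ [y k] = us @ z k # us2"
    by (auto simp: append_eq_append_conv2 Cons_eq_append_conv append_eq_Cons_conv)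
  then show ?case
  proof cases
    case 2
    then obtain us' where "us2 = us' @ [y k]" using Cons.IH by blast
    then show ?thesis using 2 by simp
  next
    case 3
    then show ?thesis using s(2) by (metis in_set_conv_decomp)
  qed blast
qed simp

text \<open>The word \<open>w0\<close> is found in the copy of \<open>P k\<close> behind the leading
  \<open>Q k\<close> of the code block of \<open>y k\<close>, and the code block of
  \<open>z k\<close> is added on the right. In any word of the language the latter is aligned, so
  the code block of \<open>y k\<close> precedes it. A shorter word in the place of \<open>w0\<close>
  would shift \<open>Q k\<close> inside that code block by less than one block length, against the
  alignment of the blocks.\<close>

lemma isolation:
  assumes "w0 \<in> language"
  shows "\<exists>u v. u @ w0 @ v \<in> language \<and> (\<forall>w. length w \<le> length w0 \<and> u @ w @ v \<in> language \<longrightarrow> w = w0)"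
proof -
  obtain k where k: "k > length w0" "sublist w0 (P k)" using language_above[OF assms] by blast
  then obtain a b' where P: "P k = a @ w0 @ b'" by (auto simp: sublist_def)
  have lw: "length w0 < block_length k" using k(1) block_length_gt[of k] by simp
  obtain c where c: "code_block k (y k) = Q k @ P k @ c" using code_block_start[of k "y k"] by auto
  define u where "u = Q k @ a"
  define b where "b = b' @ c"
  define v where "v = b @ code_block k (z k)"
  have y: "code_block k (y k) = u @ w0 @ b" using c P by (simp add: u_def b_def)
  have S: "y k \<in> digit_words k" "z k \<in> digit_words k" by (auto simp: digit_words_def)
  have "P (Suc k) = concat (map (code_block k) (x k # ds k)) @ (u @ w0 @ v) @ []"
    using block_Suc[of k False] y by (simp add: arrangement_def v_def block_def)
  then have "sublist (u @ w0 @ v) (P (Suc k))" unfolding sublist_def by blast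
  then have "u @ w0 @ v \<in> language" by (auto simp: language_def)
  moreover have "w = w0" if w: "length w \<le> length w0" "u @ w @ v \<in> language" for w
  proof -
    obtain v' p s where "expand k (refine k v') = p @ (u @ w @ v) @ s" using language_refine[OF w(2)]
        by blast
    moreover have "expand k (refine k v')
        = concat (map (code_block k) (concat (map (arrangement k) v')))"
    proof -
      have "expand k (concat (map (codeword k) us)) = concat (map (code_block k) us)" for us
        by (induction us) (auto simp: code_block_def)
      then show ?thesis by (induction v') (auto simp: refine_def)
    qed
    ultimately have e: "concat (map (code_block k) (concat (map (arrangement k) v')))
        = (p @ u @ w @ b) @ code_block k (z k) @ s"
      by (simp add: v_def)
    have "\<exists>us vs. concat (map (arrangement k) v') = us @ z k # vs \<and> p @ u @ w @ b
        = concat (map (code_block k) us) \<and> s = concat (map (code_block k) vs)"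
      by (rule code_block_alignment[OF _ S(2) e]) (auto simp: set_arrangement)
    then obtain us vs where us: "concat (map (arrangement k) v') = us @ z k # vs" "p @ u @ w @ b
        = concat (map (code_block k) us)"
      by blast
    obtain us' where "us = us' @ [y k]" using arrangement_before_z[OF us(1)] by blast
    then have e2: "p @ u @ w @ b = concat (map (code_block k) us') @ u @ w0 @ b" using us(2) y by simp
    then have len: "length p + length w = length (concat (map (code_block k) us')) + length w0"
      using arg_cong[OF e2, of length] by simp
    \<comment> \<open>The amount by which \<open>u\<close> starts too late in the code block of
      \<open>y k\<close>; it makes up for the letters that \<open>w\<close> lacks compared with
      \<open>w0\<close>.\<close>
    define e where "e = drop (length (concat (map (code_block k) us'))) p"
    have lp: "length (concat (map (code_block k) us')) \<le> length p" using len w(1) by linarith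
    have "take (length (concat (map (code_block k) us'))) p = concat (map (code_block k) us')"
      using arg_cong[OF e2, of "take (length (concat (map (code_block k) us')))"] lp by simp
    then have p: "p = concat (map (code_block k) us') @ e" unfolding e_def by (metis append_take_drop_id)
    have "(e @ u @ w) @ b = (u @ w0) @ b" using e2 unfolding p by simp
    then have e3: "e @ u @ w = u @ w0" by (rule append_same_eq[THEN iffD1])
    have e4: "length e + length w = length w0" using arg_cong[OF e3, of length] by simp
    have "expand k (codeword k (y k)) = (u @ w0) @ b" using y by (simp add: code_block_def)
    also have "\<dots> = e @ block k True @ (a @ w @ b)" unfolding e3[symmetric] by (simp add: block_def u_def)
    finally have "expand k (codeword k (y k)) = e @ block k True @ (a @ w @ b)" .
    then obtain u' where "e = expand k u'" using expand_alignment by blast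
    then have "length e = length u' * block_length k" by simp
    \<comment> \<open>The length of \<open>e\<close> is a multiple of the block length and at most
      \<open>length w0\<close>, hence zero.\<close>
    then have "u' = []" using e4 lw by (cases u') auto
    then show ?thesis using e3 \<open>e = expand k u'\<close> by simp
  qed
  ultimately show ?thesis by blast
qed

end

section \<open>Complexity and growth of the language\<close>

context block_tower begin

definition complexity where "complexity n = card {w \<in> language. length w = n}"

lemma finite_language_le: "finite {w \<in> language. length w \<le> n}"
proof (rule finite_subset)
  show "{w \<in> language. length w \<le> n} \<subseteq> {w. set w \<subseteq> {..<2} \<and> length w \<le> n}" using language_letters by auto
  show "finite {w::nat list. set w \<subseteq> {..<2} \<and> length w \<le> n}" by (rule finite_lists_length_le) simp
qed

lemma finite_language_eq: "finite {w \<in> language. length w = n}"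
  by (rule finite_subset[OF _ finite_language_le[of n]]) auto

text \<open>A word of length \<open>n\<close> is determined by its offset in the first block that it
  meets and by the \<open>h\<close> level-\<open>k\<close> letters from there on; the extra block in
  the bound for \<open>h\<close> leaves room for every offset. Near the end of
  \<open>refine k u\<close> the window is filled up with \<open>False\<close>, so that all windows
  have length \<open>h\<close>.\<close>

lemma complexity_window_bound:
  assumes V: "finite V" "\<And>u i. take h (drop i (refine k u)) @ replicate (h - length (drop i (refine k u))) False \<in> V"
    and h: "n + block_length k \<le> h * block_length k"
  shows "complexity n \<le> card V * block_length k"
proof -
  have "{w \<in> language. length w = n}
      \<subseteq> (\<lambda>(v, s). take n (drop s (expand k v))) ` (V \<times> {..<block_length k})"
  proof
    fix w assume "w \<in> {w \<in> language. length w = n}"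
    then have w: "w \<in> language" "length w = n" by auto
    obtain u a b where e: "expand k (refine k u) = a @ w @ b" using language_refine[OF w(1)] by blast
    define i where "i = length a div block_length k"
    define s where "s = length a mod block_length k"
    define v where "v = take h (drop i (refine k u)) @ replicate (h - length (drop i (refine k u))) False"
    have a: "length a = i * block_length k + s" "s < block_length k"
        by (simp_all add: i_def s_def div_mult_mod_eq)
    have lw: "length a + n \<le> length (refine k u) * block_length k"
      using arg_cong[OF e, of length] w by simp
    have w': "w = take n (drop (length a) (expand k (refine k u)))" using e w by simp
    have "expand k (refine k u) = expand k (take i (refine k u)) @ expand k (drop i (refine k u))"
      by (metis append_take_drop_id expand_simps(3))
    moreover have "i \<le> length (refine k u)"
    proof -
      have "i * block_length k \<le> length (refine k u) * block_length k" using lw a by linarith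
      then show ?thesis using block_length_pos[of k] by simp
    qed
    ultimately have "drop (length a) (expand k (refine k u)) = drop s (expand k (drop i (refine k u)))"
      using a by simp
    also have "expand k (drop i (refine k u))
        = expand k (take h (drop i (refine k u))) @ expand k (drop h (drop i (refine k u)))"
      by (metis append_take_drop_id expand_simps(3))
    finally have w2: "w = take n (drop s (expand k (take h (drop i (refine k u))) @ expand k (drop h (drop i (refine k u)))))"
      using w' by simp
    have "w = take n (drop s (expand k v))"
    proof (cases "h \<le> length (drop i (refine k u))")
      case True
      then have "length (expand k (take h (drop i (refine k u)))) = h * block_length k" by simp
      then show ?thesis using w2 h a True by (simp add: v_def)
    next
      case False
      have "n + s \<le> length (drop i (refine k u)) * block_length k"
        using lw a by (simp add: diff_mult_distrib)
      then show ?thesis using w2 False by (simp add: v_def)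
    qed
    moreover have "v \<in> V" using V(2) by (simp add: v_def)
    ultimately show "w \<in> (\<lambda>(v, s). take n (drop s (expand k v))) ` (V \<times> {..<block_length k})" using a(2)
        by force
  qed
  then have "complexity n \<le> card ((\<lambda>(v, s). take n (drop s (expand k v))) ` (V \<times> {..<block_length k}))"
    unfolding complexity_def using V(1) by (intro card_mono) auto
  also have "\<dots> \<le> card (V \<times> {..<block_length k})" using V(1) by (intro card_image_le) auto
  finally show ?thesis by (simp add: card_cartesian_product)
qed

text \<open>Two consecutive blocks cover the word, and there are four pairs of blocks.\<close>

lemma complexity_le_small:
  assumes "n \<le> block_length k" shows "complexity n \<le> 4 * block_length k"
proof -
  have "complexity n \<le> card {v::bool list. set v \<subseteq> UNIV \<and> length v = 2} * block_length k"
    by (rule complexity_window_bound[of _ 2]) (use assms finite_lists_length_eq[of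
        "UNIV::bool set" 2] in auto)
  also have "card {v::bool list. set v \<subseteq> UNIV \<and> length v = 2} = 4"
    using card_lists_length_eq[of "UNIV::bool set" 2] by simp
  finally show ?thesis .
qed

text \<open>Concatenated code words form a gap word again, so the sparsity of \<open>True\<close>
  also holds across their borders.\<close>

lemma refine_gap_word: "\<exists>gs. refine k u = gap_word gs \<and> (\<forall>g\<in>set gs. 3 * q k \<le> g)"
proof -
  have *: "concat (map (codeword k) ts) = gap_word (concat (map (gaps k) ts))" for ts
    by (induction ts) (auto simp: codeword_def)
  show ?thesis
  proof (induction u)
    case Nil
    have "refine k [] = gap_word []" by (simp add: refine_def)
    then show ?case by (metis emptyE list.set(1))
  next
    case (Cons b u)
    then obtain gs where gs: "refine k u = gap_word gs" "\<forall>g\<in>set gs. 3 * q k \<le> g" by blast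
    have "refine k (b # u) = gap_word (concat (map (gaps k) (arrangement k b)) @ gs)"
      using gs(1) * by (simp add: refine_def)
    moreover have "\<forall>g\<in>set (concat (map (gaps k) (arrangement k b)) @ gs). 3 * q k \<le> g"
      using gs(2) gaps_bounds set_arrangement by auto
    ultimately show ?case by blast
  qed
qed

lemma gap_word_sparse_nth:
  assumes "\<forall>g\<in>set gs. s \<le> g" "i < j" "j < length (gap_word gs)" "gap_word gs ! i" "gap_word gs ! j"
  shows "i + s < j"
proof -
  let ?w = "gap_word gs"
  have "?w = take i ?w @ True # drop (Suc i) ?w" using assms
      by (metis (full_types) id_take_nth_drop less_trans)
  moreover have "drop (Suc i) ?w
      = take (j - Suc i) (drop (Suc i) ?w) @ True # drop (Suc (j - Suc i)) (drop (Suc i) ?w)"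
    using assms id_take_nth_drop[of "j - Suc i" "drop (Suc i) ?w"] by simp
  ultimately have "?w = take i ?w @ True # take (j - Suc i) (drop (Suc i) ?w) @ True # drop (Suc (j - Suc i)) (drop (Suc i) ?w)"
    by metis
  then have "s \<le> length (take (j - Suc i) (drop (Suc i) ?w))" using gap_word_sparse assms(1) by blast
  then show ?thesis using assms by simp
qed

text \<open>At most one entry is \<open>True\<close>, and its place determines the word.\<close>

lemma card_sparse_words:
  "finite {v::bool list. length v = h \<and> (\<forall>i<h. \<forall>j<h. v ! i \<and> v ! j \<longrightarrow> i = j)} \<and>
   card {v::bool list. length v = h \<and> (\<forall>i<h. \<forall>j<h. v ! i \<and> v ! j \<longrightarrow> i = j)} \<le> h + 1"
proof -
  let ?W = "insert (replicate h False) ((\<lambda>i. (replicate h False)[i := True]) ` {..<h})"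
  have sub: "{v::bool list. length v = h \<and> (\<forall>i<h. \<forall>j<h. v ! i \<and> v ! j \<longrightarrow> i = j)} \<subseteq> ?W"
  proof
    fix v assume "v \<in> {v::bool list. length v = h \<and> (\<forall>i<h. \<forall>j<h. v ! i \<and> v ! j \<longrightarrow> i = j)}"
    then have v: "length v = h" "\<forall>i<h. \<forall>j<h. v ! i \<and> v ! j \<longrightarrow> i = j" by auto
    show "v \<in> ?W"
    proof (cases "\<exists>i<h. v ! i")
      case True
      then obtain i where i: "i < h" "v ! i" by blast
      then have "v = (replicate h False)[i := True]"
        using v by (intro nth_equalityI) (auto simp: nth_list_update)
      then show ?thesis using i by blast
    next
      case False
      then have "v = replicate h False" using v by (intro nth_equalityI) auto
      then show ?thesis by blast
    qed
  qed
  have fin: "finite ?W" by simp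
  have "card ?W \<le> h + 1"
    by (rule order.trans[OF card_insert_le_m1[of "Suc h"]]) (auto intro: card_image_le[THEN order.trans])
  then show ?thesis using card_mono[OF fin sub] finite_subset[OF sub fin] by linarith
qed

text \<open>As long as a window sees at most one \<open>True\<close>, the number of windows is
  linear in their length. The two extra blocks in \<open>h\<close> account for rounding and offset;
  since \<open>q k\<close> is positive, \<open>h\<close> still does not exceed the smallest gap
  \<open>3 * q k\<close>.\<close>

lemma complexity_le_linear:
  assumes "block_length k \<le> n" "n div block_length k \<le> q k"
  shows "complexity n \<le> 4 * n"
proof -
  define h where "h = n div block_length k + 2"
  let ?V = "{v::bool list. length v = h \<and> (\<forall>i<h. \<forall>j<h. v ! i \<and> v ! j \<longrightarrow> i = j)}"
  have h3: "h \<le> 3 * q k" using assms q_pos[of k] by (simp add: h_def)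
  have "complexity n \<le> card ?V * block_length k"
  proof (rule complexity_window_bound)
    show "finite ?V" using card_sparse_words by blast
    show "n + block_length k \<le> h * block_length k"
      using div_mult_mod_eq[of n "block_length k"] mod_less_divisor[OF block_length_pos[of k], of n]
      unfolding h_def add_mult_distrib by linarith
    fix u i
    obtain gs where gs: "refine k u = gap_word gs" "\<forall>g\<in>set gs. 3 * q k \<le> g" using refine_gap_word
        by blast
    let ?w = "refine k u" let ?v = "take h (drop i ?w) @ replicate (h - length (drop i ?w)) False"
    have lv: "length ?v = h" by simp
    have nth: "a < length (drop i ?w) \<and> ?w ! (i + a)" if "a < h" "?v ! a" for a
      using that by (auto simp: nth_append split: if_splits)
    have "\<not> (a < b)" if ab: "a < h" "b < h" "?v ! a" "?v ! b" for a b
    proof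
      assume "a < b"
      have "i + a + 3 * q k < i + b"
        by (rule gap_word_sparse_nth[OF gs(2)])
          (use nth[of a] nth[of b] ab \<open>a < b\<close> gs(1) in auto)
      then show False using h3 ab by linarith
    qed
    then have "\<forall>a<h. \<forall>b<h. ?v ! a \<and> ?v ! b \<longrightarrow> a = b" by (metis linorder_neqE_nat)
    then show "?v \<in> ?V" using lv by blast
  qed
  also have "\<dots> \<le> (h + 1) * block_length k" using card_sparse_words[of h] by (intro mult_right_mono) auto
  also have "\<dots> = n div block_length k * block_length k + 3 * block_length k"
      by (simp add: h_def algebra_simps)
  also have "\<dots> \<le> 4 * n" using assms(1) div_times_less_eq_dividend[of n "block_length k"] by linarith
  finally show ?thesis .
qed

text \<open>Words extend to the right, so truncation maps the longer words onto the shorter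
  ones.\<close>

lemma complexity_mono: "n \<le> n' \<Longrightarrow> complexity n \<le> complexity n'"
proof -
  have "complexity n \<le> complexity (Suc n)" for n
  proof -
  have "{w \<in> language. length w = n} \<subseteq> take n ` {w \<in> language. length w = Suc n}"
  proof
    fix w assume w: "w \<in> {w \<in> language. length w = n}"
    then obtain c where "w @ [c] \<in> language" using language_extend by blast
    then show "w \<in> take n ` {w \<in> language. length w = Suc n}" using w
        by (intro image_eqI[of _ _ "w @ [c]"]) auto
  qed
  then have "complexity n \<le> card (take n ` {w \<in> language. length w = Suc n})"
    unfolding complexity_def using finite_language_eq by (intro card_mono) auto
  also have "\<dots> \<le> complexity (Suc n)" unfolding complexity_def
      by (rule card_image_le[OF finite_language_eq])
  finally show "complexity n \<le> complexity (Suc n)" .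
  qed
  then show "n \<le> n' \<Longrightarrow> complexity n \<le> complexity n'" by (rule lift_Suc_mono_le)
qed

text \<open>Take two adjacent copies of \<open>P (Suc k)\<close>. The windows of length
  \<open>2 * \<rho>\<close> that start in the first copy are pairwise different: each contains a
  complete code block, and as the code blocks of one copy are distinct, this one fixes the start
  modulo the length of the copy.\<close>

lemma complexity_ge: "num_codes k * (code_length k * block_length k)
    \<le> complexity (2 * (code_length k * block_length k))"
proof -
  define \<rho> where "\<rho> = code_length k * block_length k"
  have \<rho>: "\<rho> > 0" using code_length_pos block_length_pos by (simp add: \<rho>_def)
  define T where "T = arrangement k False @ arrangement k False"
  have lT: "length T = 2 * num_codes k" by (simp add: T_def length_arrangement)
  have sT: "set T \<subseteq> digit_words k" by (simp add: T_def set_arrangement)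
  define W where "W = P (Suc k) @ P (Suc k)"
  have W: "W = concat (map (code_block k) T)" using block_Suc[of k False]
      by (simp add: W_def T_def block_def)
  have len: "\<forall>d\<in>digit_words k. length (code_block k d) = \<rho>" by (simp add: length_code_block \<rho>_def)
  have lW: "length W = 2 * num_codes k * \<rho>"
    unfolding W using uniform_length_concat[of T "code_block k" \<rho>] len sT lT by auto
  have WL: "W \<in> language" using PP_in_language by (simp add: W_def)
  let ?f = "\<lambda>s. take (2 * \<rho>) (drop s W)"
  have "inj_on ?f {..<num_codes k * \<rho>}"
  proof -
    \<comment> \<open>One inequality suffices, by symmetry.\<close>
    have "s' \<le> s" if s: "s < num_codes k * \<rho>" "s' < num_codes k * \<rho>" "?f s = ?f s'" for s s'
    proof -
      \<comment> \<open>The code block with index \<open>i\<close> is the first that starts strictly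
        after \<open>s\<close>. It starts at distance \<open>d \<le> \<rho>\<close> and so ends
        within the window.\<close>
      define i where "i = Suc (s div \<rho>)"
      define d where "d = i * \<rho> - s"
      have si: "s < i * \<rho>" "i * \<rho> \<le> s + \<rho>"
        using div_times_less_eq_dividend[of s \<rho>] dividend_less_div_times[OF \<rho>, of s] \<rho>
            by (auto simp: i_def)
      from si have d: "s + d = i * \<rho>" "d \<le> \<rho>" by (auto simp: d_def)
      have "s div \<rho> < num_codes k" using s(1) \<rho> by (simp add: less_mult_imp_div_less)
      then have it: "i \<le> num_codes k" by (simp add: i_def)
      have iT: "i < length T" using it lT num_codes_ge[of k] by simp
      then have TS: "T ! i \<in> digit_words k" using sT by auto
      have cT: "W = concat (map (code_block k) (take i T)) @ code_block k (T ! i) @ concat (map (code_block k) (drop (Suc i) T))"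
        unfolding W by (metis (no_types) id_take_nth_drop[OF iT] concat.simps(2) concat_append list.simps(9) map_append)
      have lt: "length (concat (map (code_block k) (take i T))) = i * \<rho>"
        using uniform_length_concat[of "take i T" "code_block k" \<rho>] len sT iT
            by (auto dest: in_set_takeD)
      have dd: "take \<rho> (drop d (?f s)) = take \<rho> (drop (d + s) W)" for s
      proof -
        have "min \<rho> (2 * \<rho> - d) = \<rho>" using d(2) by simp
        then show ?thesis by (simp add: drop_take)
      qed
      have "take \<rho> (drop d (?f s)) = take \<rho> (drop (i * \<rho>) W)"
        using d(1) dd[of s] by (simp add: add.commute)
      also have "\<dots> = code_block k (T ! i)" using lt len TS by (subst cT) simp
      finally have "take \<rho> (drop d (?f s')) = code_block k (T ! i)" using s(3) by simp
      then have "take \<rho> (drop (d + s') W) = code_block k (T ! i)" using dd[of s'] by simp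
      then have "W = take (d + s') W @ code_block k (T ! i) @ drop \<rho> (drop (d + s') W)"
          by (metis append_take_drop_id)
      then obtain u v where u: "T = u @ T ! i # v" "take (d + s') W = concat (map (code_block k) u)"
        using code_block_alignment[OF sT TS] unfolding W by metis
      have "d + s' \<le> length W"
      proof -
        have "1 * \<rho> \<le> num_codes k * \<rho>" using num_codes_ge[of k] by (intro mult_right_mono) auto
        moreover have "length W = num_codes k * \<rho> + num_codes k * \<rho>" using lW by simp
        ultimately show ?thesis using s(2) d(2) by linarith
      qed
      moreover have "set u \<subseteq> digit_words k" using u(1) sT by (metis Un_subset_iff set_append)
      then have "length (concat (map (code_block k) u)) = length u * \<rho>"
          using uniform_length_concat[of u "code_block k" \<rho>] len by auto
      ultimately have ds: "d + s' = length u * \<rho>" using u(2) by (metis length_take min.absorb2)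
      have lu: "length u < length T" using arg_cong[OF u(1), of length] by simp
      have "T ! length u = T ! i" using u(1) by (metis nth_append_length)
      \<comment> \<open>\<open>T\<close> has period \<open>num_codes k\<close>, and its entries
        within one period are distinct.\<close>
      then have mod: "length u mod num_codes k = i mod num_codes k"
      proof -
        have D: "distinct (arrangement k False)" using dist[of k] by (simp add: arrangement_def)
        have "T ! j = arrangement k False ! (j mod num_codes k)" if "j < 2 * num_codes k" for j
          using that num_codes_ge[of k]
              by (cases "j < num_codes k") (auto simp: T_def nth_append length_arrangement mod_if)
        then have "arrangement k False ! (length u mod num_codes k)
            = arrangement k False ! (i mod num_codes k)"
          using \<open>T ! length u = T ! i\<close> lu iT lT by simp
        then show ?thesis using D num_codes_ge[of k]
            by (subst (asm) nth_eq_iff_index_eq) (auto simp: length_arrangement)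
      qed
      \<comment> \<open>A larger index would differ by at least one full period and push
        \<open>s'\<close> out of the first copy.\<close>
      have "length u \<le> i"
      proof (rule ccontr)
        assume "\<not> length u \<le> i"
        then have "num_codes k dvd length u - i" using mod by (metis mod_eq_dvd_iff_nat nat_le_linear)
        then have "num_codes k \<le> length u - i" using \<open>\<not> length u \<le> i\<close> by (intro dvd_imp_le) auto
        then have "(i + num_codes k) * \<rho> \<le> length u * \<rho>" using \<open>\<not> length u \<le> i\<close>
            by (intro mult_right_mono) auto
        then have "s + d + num_codes k * \<rho> \<le> d + s'" using ds d by (simp add: add_mult_distrib)
        then show False using s(2) by linarith
      qed
      then have "length u * \<rho> \<le> i * \<rho>" by (intro mult_right_mono) auto
      then show ?thesis using ds d by linarith
    qed
    then show ?thesis by (intro inj_onI) (metis le_antisym lessThan_iff)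
  qed
  then have "num_codes k * \<rho> = card (?f ` {..<num_codes k * \<rho>})" by (simp add: card_image)
  also have "\<dots> \<le> complexity (2 * \<rho>)" unfolding complexity_def
  proof (rule card_mono[OF finite_language_eq], rule image_subsetI)
    fix s assume "s \<in> {..<num_codes k * \<rho>}"
    moreover have "2 * \<rho> \<le> num_codes k * \<rho>" using num_codes_ge[of k] by (intro mult_right_mono) auto
    moreover have "length W = num_codes k * \<rho> + num_codes k * \<rho>" using lW by simp
    ultimately have "2 * \<rho> \<le> length W - s" by (simp only: lessThan_iff)
    then have "length (?f s) = 2 * \<rho>" by simp
    moreover have "?f s \<in> language"
        using WL language_sublist sublist_order.order.trans[OF sublist_take sublist_drop] by blast
    ultimately show "?f s \<in> {w \<in> language. length w = 2 * \<rho>}" by simp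
  qed
  finally show ?thesis by (simp add: \<rho>_def)
qed

definition growth where "growth n = card {w \<in> language. length w \<le> n}"

lemma growth_sum: "growth n = (\<Sum>i\<le>n. complexity i)"
proof -
  have "{w \<in> language. length w \<le> n} = (\<Union>i\<in>{..n}. {w \<in> language. length w = i})" by auto
  then have "growth n = card (\<Union>i\<in>{..n}. {w \<in> language. length w = i})" by (simp add: growth_def)
  also have "\<dots> = (\<Sum>i\<in>{..n}. complexity i)" unfolding complexity_def
    by (rule card_UN_disjoint) (auto simp: finite_language_eq)
  finally show ?thesis .
qed

lemma growth_le: "growth n \<le> (n + 1) * complexity n"
  using sum_bounded_above[of "{..n}" complexity "complexity n"] complexity_mono by (simp add: growth_sum)

lemma growth_ge: "n * complexity n \<le> growth (2 * n)"
proof -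
  have "n * complexity n \<le> (\<Sum>i\<in>{n..2 * n}. complexity i)"
    using sum_bounded_below[of "{n..2 * n}" "complexity n" complexity] complexity_mono by simp
  also have "\<dots> \<le> growth (2 * n)" unfolding growth_sum by (intro sum_mono2) auto
  finally show ?thesis .
qed

text \<open>From \<open>q k\<close> blocks on, the next block length is at most a constant times
  \<open>num_codes k * n\<close>. Up to that length the crude bound
  \<open>complexity_le_small\<close> of level \<open>Suc k\<close> has the right order; beyond it
  the linear bound of level \<open>Suc k\<close> takes over.\<close>

lemma growth_upper:
  assumes "q k * block_length k \<le> n" "n div block_length (Suc k) \<le> q (Suc k)"
  shows "growth n \<le> 8 * (9 * m + 7) * num_codes k * n\<^sup>2"
proof -
  \<comment> \<open>The constant \<open>9 * m + 7\<close> arises from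
    \<open>1 + 6 * q k + m * (7 * q k + 2)\<close> by replacing 1 with \<open>q k\<close> and 2 with
    \<open>2 * q k\<close>.\<close>
  have "2 * m * 1 \<le> 2 * m * q k" using q_pos[of k] by (intro mult_left_mono) auto
  then have "code_length k \<le> (9 * m + 7) * q k" using q_pos[of k]
      by (simp add: code_length_def algebra_simps)
  then have "num_codes k * code_length k * block_length k
      \<le> num_codes k * ((9 * m + 7) * q k) * block_length k" by (intro mult_mono) auto
  also have "\<dots> = num_codes k * (9 * m + 7) * (q k * block_length k)" by simp
  also have "\<dots> \<le> num_codes k * (9 * m + 7) * n" using assms by (intro mult_left_mono) auto
  finally have l: "block_length (Suc k) \<le> num_codes k * (9 * m + 7) * n" using block_length_Suc[of k]
      by simp
  have n: "n > 0" using assms(1) q_pos[of k] block_length_pos[of k]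
      by (metis mult_pos_pos order_less_le_trans)
  have "complexity n \<le> 4 * (num_codes k * (9 * m + 7) * n)"
  proof (cases "n \<le> block_length (Suc k)")
    case True then show ?thesis using complexity_le_small[OF True] l by linarith
  next
    case False
    have "1 * n \<le> num_codes k * (9 * m + 7) * n" using num_codes_ge[of k] by (intro mult_right_mono) auto
    moreover have "complexity n \<le> 4 * n" using False assms(2) by (intro complexity_le_linear) auto
    ultimately show ?thesis by linarith
  qed
  then have "growth n \<le> (n + 1) * (4 * (num_codes k * (9 * m + 7) * n))"
    using growth_le[of n] by (meson mult_le_mono2 order_trans)
  also have "\<dots> \<le> (2 * n) * (4 * (num_codes k * (9 * m + 7) * n))" using n by (intro mult_right_mono) auto
  finally show ?thesis by (simp add: power2_eq_square algebra_simps)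
qed

lemma growth_lower: "2 * num_codes k * (code_length k * block_length k)\<^sup>2
    \<le> growth (4 * (code_length k * block_length k))"
proof -
  have "2 * (code_length k * block_length k) * (num_codes k * (code_length k * block_length k))
      \<le> 2 * (code_length k * block_length k) * complexity (2 * (code_length k * block_length k))"
    using complexity_ge[of k] by (intro mult_left_mono) auto
  also have "\<dots> \<le> growth (2 * (2 * (code_length k * block_length k)))" by (rule growth_ge)
  finally show ?thesis by (simp add: power2_eq_square algebra_simps)
qed

end

text \<open>The interface to the algebra: \<open>extendable\<close> will make a left ideal proper,
  \<open>recurrent\<close> and \<open>isolated\<close> will put all long words into a nonzero ideal.
  In \<open>isolated\<close> only words not longer than \<open>w0\<close> are compared, because
  \<open>w0\<close> will be a longest word in the support of an element.\<close>

locale recurrent_language =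
  fixes L :: "nat list set"
  assumes letters: "w \<in> L \<Longrightarrow> set w \<subseteq> {..<2}"
    and factor: "w \<in> L \<Longrightarrow> sublist u w \<Longrightarrow> u \<in> L"
    and nonempty: "L \<noteq> {}"
    and extendable: "w \<in> L \<Longrightarrow> \<exists>c. w @ [c] \<in> L"
    and recurrent: "u \<in> L \<Longrightarrow> \<exists>N. \<forall>w\<in>L. N \<le> length w \<longrightarrow> sublist u w"
    and isolated: "w0 \<in> L \<Longrightarrow>
      \<exists>u v. u @ w0 @ v \<in> L \<and> (\<forall>w. length w \<le> length w0 \<and> u @ w @ v \<in> L \<longrightarrow> w = w0)"

context block_tower begin

lemma recurrent_language: "recurrent_language language"
  using language_letters language_sublist P_in_language language_extend uniformly_recurrent isolation
      by unfold_locales blast+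

end

section \<open>Towers with prescribed numbers of code words\<close>

definition digit_list :: "nat \<Rightarrow> nat \<Rightarrow> nat \<Rightarrow> nat list list" where
  "digit_list m q t = (SOME xs. distinct xs \<and> length xs = t \<and> (\<forall>d\<in>set xs. length d = m
      \<and> (\<forall>i\<in>set d. i < q)))"

lemma digit_list:
  assumes "t \<le> q ^ m"
  shows "distinct (digit_list m q t)" "length (digit_list m q t) = t"
    "d \<in> set (digit_list m q t) \<Longrightarrow> length d = m \<and> (\<forall>i\<in>set d. i < q)"
proof -
  let ?D = "{d. set d \<subseteq> {..<q} \<and> length d = m}"
  have "card ?D = q ^ m" by (simp add: card_lists_length_eq)
  then have "t \<le> card ?D" using assms by simp
  then obtain A where A: "A \<subseteq> ?D" "card A = t" "finite A" by (rule obtain_subset_with_card_n)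
  obtain xs where xs: "set xs = A" "distinct xs" using finite_distinct_list[OF A(3)] by blast
  have "length xs = t" using distinct_card[OF xs(2)] A(2) xs(1) by simp
  then have "distinct xs \<and> length xs = t \<and> (\<forall>d\<in>set xs. length d = m \<and> (\<forall>i\<in>set d. i < q))"
    using A(1) xs by auto
  then have "distinct (digit_list m q t) \<and> length (digit_list m q t) = t \<and>
      (\<forall>d\<in>set (digit_list m q t). length d = m \<and> (\<forall>i\<in>set d. i < q))"
    unfolding digit_list_def by (rule someI)
  then show "distinct (digit_list m q t)" "length (digit_list m q t) = t"
    "d \<in> set (digit_list m q t) \<Longrightarrow> length d = m \<and> (\<forall>i\<in>set d. i < q)" by blast+
qed

lemma length_digit_block:
  assumes "length P = l" "length Q = l" "\<forall>i\<in>set d. i < q"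
  shows "length (digit_block q P Q d) = (1 + 6 * q + length d * (7 * q + 2)) * l"
proof -
  have "length (concat (map (\<lambda>b. if b then Q else P) w)) = length w * l" for w
    using assms by (intro uniform_length_concat) auto
  moreover have "length (gap_word (concat (map (\<lambda>i. [3 * q + i, 4 * q - i]) d)))
      = length d * (7 * q + 2)"
    using assms(3) by (induction d) (auto simp: length_gap_word)
  then have "length (gap_word (6 * q # concat (map (\<lambda>i. [3 * q + i, 4 * q - i]) d)))
      = 1 + 6 * q + length d * (7 * q + 2)"
    by simp
  ultimately show ?thesis unfolding digit_block_def by presburger
qed

text \<open>Of the \<open>t k\<close> digit lists the first three play the roles of
  \<open>x k\<close>, \<open>y k\<close>, \<open>z k\<close> and the others form
  \<open>ds k\<close>, so that \<open>num_codes k\<close> becomes \<open>t k\<close>. The number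
  \<open>q\<close> is chosen so that \<open>q\<close> blocks reach approximately the scale
  \<open>N k\<close>.\<close>

primrec tower :: "nat \<Rightarrow> (nat \<Rightarrow> nat) \<Rightarrow> (nat \<Rightarrow> nat) \<Rightarrow> nat \<Rightarrow> nat list \<times> nat list" where
  "tower m N t 0 = ([0], [1])"
| "tower m N t (Suc k) =
    (let P = fst (tower m N t k); Q = snd (tower m N t k); q = N k div length P; xs
        = digit_list m q (t k)
     in (concat (map (digit_block q P Q) (xs ! 0 # drop 3 xs @ [xs ! 1, xs ! 2])),
         concat (map (digit_block q P Q) (xs ! 0 # rev (drop 3 xs) @ [xs ! 1, xs ! 2]))))"

lemma first_three: "3 \<le> length v \<Longrightarrow> v = v ! 0 # v ! 1 # v ! 2 # drop 3 v"
  by (cases v; cases "tl v"; cases "tl (tl v)") (auto simp: numeral_eq_Suc)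

text \<open>
  The blocks satisfy \<open>l\<^sub>k\<^sup>2 \<le> N\<^sub>k\<close> throughout. So \<open>q\<^sub>k\<close>, the integer part of \<open>N\<^sub>k / l\<^sub>k\<close>, satisfies \<open>N\<^sub>k \<le> q\<^sub>k\<^sup>4\<close>, and \<open>4 b\<close> digits below
  \<open>q\<^sub>k\<close> suffice for \<open>t\<^sub>k\<close> code words. Their length is at most \<open>(9 * 4 b + 7) q\<^sub>k\<close>.
\<close>
theorem language_with_bursts:
  fixes b :: nat and t N :: "nat \<Rightarrow> nat"
  defines "N \<equiv> (\<lambda>k. (36 * b + 7) ^ ((2 * b + 4) ^ k))"
  assumes t: "\<And>k. 5 \<le> t k \<and> t k \<le> N k ^ b"
  shows "\<exists>L. recurrent_language L \<and>
    (\<forall>k n. N k \<le> n \<and> n < N (Suc k) \<longrightarrow> card {w \<in> L. length w \<le> n} \<le> 8 * (36 * b + 7) * t k * n\<^sup>2) \<and>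
    (\<forall>k. t k * (N k)\<^sup>2 \<le> card {w \<in> L. length w \<le> 4 * (36 * b + 7) * N k})"
proof -
  define D where "D = 36 * b + 7"
  define m where "m = 4 * b"
  define P where "P k = fst (tower m N t k)" for k
  define Q where "Q k = snd (tower m N t k)" for k
  define q where "q k = N k div length (P k)" for k
  define xs where "xs k = digit_list m (q k) (t k)" for k
  define r where "r k = 1 + 6 * q k + m * (7 * q k + 2)" for k
  note r_eq = r_def
  have N_Suc: "N (Suc k) = N k ^ (2 * b + 4)" for k
    by (simp only: N_def power_Suc2 power_mult)
  have ND: "D \<le> N k" for k
    unfolding N_def D_def by (rule self_le_power) auto
  have N7: "7 \<le> N k" for k using ND[of k] by (simp add: D_def)
  have P0: "P 0 = [0]" "Q 0 = [1]" by (simp_all add: P_def Q_def)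
  have PS: "P (Suc k) = concat (map (digit_block (q k) (P k) (Q k)) (xs k ! 0 # drop 3 (xs k) @ [xs k ! 1, xs k ! 2]))"
    "Q (Suc k) = concat (map (digit_block (q k) (P k) (Q k)) (xs k ! 0 # rev (drop 3 (xs k)) @ [xs k ! 1, xs k ! 2]))" for k
    by (simp_all add: P_def Q_def q_def xs_def Let_def)
  \<comment> \<open>Squaring \<open>N k < (q k + 1) * length (P k)\<close> and using the square
    bound for the block length, one factor \<open>N k\<close> cancels. With
    \<open>7 \<le> N k\<close> this forces \<open>2 \<le> q k\<close>, and then
    \<open>q k + 1 \<le> (q k)\<^sup>2\<close> leads to the fourth power.\<close>
  have q_facts: "2 \<le> q k" "t k \<le> q k ^ m" if l: "(length (P k))\<^sup>2 \<le> N k" "0 < length (P k)" for k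
  proof -
    let ?l = "length (P k)"
    have "N k < (q k + 1) * ?l" unfolding q_def using dividend_less_div_times[OF l(2), of "N k"] by simp
    then have "(N k)\<^sup>2 < ((q k + 1) * ?l)\<^sup>2" by (rule power_strict_mono) auto
    also have "\<dots> = (q k + 1)\<^sup>2 * ?l\<^sup>2" by (rule power_mult_distrib)
    also have "\<dots> \<le> (q k + 1)\<^sup>2 * N k" using l(1) by (intro mult_left_mono) auto
    finally have "N k * N k < (q k + 1)\<^sup>2 * N k" by (simp add: power2_eq_square)
    then have N: "N k < (q k + 1)\<^sup>2" by simp
    show q2: "2 \<le> q k"
    proof (rule ccontr)
      assume "\<not> 2 \<le> q k"
      then have "(q k + 1)\<^sup>2 \<le> 2\<^sup>2" by (intro power_mono) auto
      then show False using N N7[of k] by simp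
    qed
    then have "2 * q k \<le> q k * q k" by (intro mult_right_mono) auto
    then have "q k + 1 \<le> (q k)\<^sup>2" using q2 unfolding power2_eq_square by linarith
    then have "(q k + 1)\<^sup>2 \<le> ((q k)\<^sup>2)\<^sup>2" by (intro power_mono) auto
    then have "N k \<le> q k ^ 4" using N by simp
    then have "N k ^ b \<le> (q k ^ 4) ^ b" by (intro power_mono) auto
    then have "t k \<le> (q k ^ 4) ^ b" using t[of k] by linarith
    then show "t k \<le> q k ^ m" by (simp only: m_def power_mult)
  qed
  have mD: "9 * m + 7 = D" by (simp add: m_def D_def)
  have rD: "r k \<le> D * q k" if "2 \<le> q k" for k
  proof -
    have "2 * m * 1 \<le> 2 * m * q k" using that by (intro mult_left_mono) auto
    then show ?thesis using that unfolding mD[symmetric] by (simp add: r_def algebra_simps)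
  qed
  have inv: "length (P k) = length (Q k) \<and> 0 < length (P k) \<and> (length (P k))\<^sup>2 \<le> N k" for k
  proof (induction k)
    case 0
    then show ?case using N7[of 0] P0 by simp
  next
    case (Suc k)
    then have q: "2 \<le> q k" "t k \<le> q k ^ m" using q_facts[of k] by blast+
    note dl = digit_list[OF q(2), folded xs_def]
    have t5: "5 \<le> t k" using t by blast
    have idx: "set (xs k ! 0 # drop 3 (xs k) @ [xs k ! 1, xs k ! 2]) \<subseteq> set (xs k)"
      using dl(2) t5 by (auto dest: in_set_dropD intro!: nth_mem)
    have idx': "set (xs k ! 0 # rev (drop 3 (xs k)) @ [xs k ! 1, xs k ! 2]) \<subseteq> set (xs k)"
      using dl(2) t5 by (auto dest: in_set_dropD)
    have len: "\<forall>d\<in>set (xs k). length (digit_block (q k) (P k) (Q k) d) = r k * length (P k)"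
    proof
      fix d assume "d \<in> set (xs k)"
      then have d: "length d = m" "\<forall>i\<in>set d. i < q k" using dl(3) by blast+
      have "length (Q k) = length (P k)" using Suc by argo
      from length_digit_block[OF refl this d(2)]
      show "length (digit_block (q k) (P k) (Q k) d) = r k * length (P k)" unfolding r_def d(1) .
    qed
    have lP: "length (P (Suc k)) = t k * (r k * length (P k))"
    proof -
      have "length (P (Suc k)) = length (xs k ! 0 # drop 3 (xs k) @ [xs k ! 1, xs k ! 2]) * (r k * length (P k))"
        unfolding PS by (rule uniform_length_concat) (use len idx in blast)
      moreover have "length (xs k ! 0 # drop 3 (xs k) @ [xs k ! 1, xs k ! 2]) = t k" using dl(2) t5
          by simp
      ultimately show ?thesis by (simp only:)
    qed
    have lQ: "length (Q (Suc k)) = t k * (r k * length (P k))"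
    proof -
      have "length (Q (Suc k)) = length (xs k ! 0 # rev (drop 3 (xs k)) @ [xs k ! 1, xs k ! 2]) * (r k * length (P k))"
        unfolding PS by (rule uniform_length_concat) (use len idx' in blast)
      moreover have "length (xs k ! 0 # rev (drop 3 (xs k)) @ [xs k ! 1, xs k ! 2]) = t k" using dl(2) t5
          by simp
      ultimately show ?thesis by (simp only:)
    qed
    \<comment> \<open>This estimate fixes the exponent in \<open>N\<close>: with
      \<open>D \<le> N k\<close> and \<open>q k * length (P k) \<le> N k\<close> the new block
      length is at most \<open>N k ^ (b + 2)\<close>, so its square is at most
      \<open>N k ^ (2 * b + 4)\<close>, the next scale. The base of \<open>N\<close> is
      \<open>D\<close> in order that \<open>D \<le> N k\<close>.\<close>
    have "t k * (r k * length (P k)) \<le> N k ^ b * ((D * q k) * length (P k))"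
      using t[of k] rD[OF q(1)] by (intro mult_mono) auto
    also have "\<dots> = N k ^ b * (D * (q k * length (P k)))" by simp
    also have "\<dots> \<le> N k ^ b * (N k * N k)"
      using ND[of k] by (intro mult_mono) (auto simp: q_def)
    finally have "length (P (Suc k)) \<le> N k ^ (b + 2)" unfolding lP[symmetric]
        by (simp only: power_add power2_eq_square)
    then have "(length (P (Suc k)))\<^sup>2 \<le> (N k ^ (b + 2))\<^sup>2" by (intro power_mono) auto
    also have "\<dots> = N k ^ ((b + 2) * 2)" by (rule power_mult[symmetric])
    also have "(b + 2) * 2 = 2 * b + 4" by simp
    also have "N k ^ (2 * b + 4) = N (Suc k)" by (rule N_Suc[symmetric])
    finally have "(length (P (Suc k)))\<^sup>2 \<le> N (Suc k)" .
    moreover have "0 < length (P k)" using Suc by blast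
    then have "0 < t k * (r k * length (P k))" using t5 unfolding r_def by simp
    ultimately show ?case using lP lQ by argo
  qed
  have q: "2 \<le> q k" "t k \<le> q k ^ m" for k using q_facts[of k] inv[of k] by blast+
  note dl = digit_list[OF q(2), folded xs_def]
  have dl3: "length d = m \<and> (\<forall>i\<in>set d. i < q k)" if "d \<in> set (xs k)" for d k
    using that by (rule dl(3))
  have xs3: "\<exists>d0 d1 d2 ds. xs k = d0 # d1 # d2 # ds \<and> 2 \<le> length ds" for k
  proof -
    have "5 \<le> length (xs k)" using dl(2)[of k] t[of k] by simp
    then have "2 \<le> length (drop 3 (xs k))" "xs k = xs k ! 0 # xs k ! 1 # xs k ! 2 # drop 3 (xs k)"
      using first_three[of "xs k"] by simp_all
    then show ?thesis by blast
  qed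
  interpret block_tower m q "\<lambda>k. xs k ! 0" "\<lambda>k. xs k ! 1" "\<lambda>k. xs k ! 2" "\<lambda>k. drop 3 (xs k)" P Q
  proof
    fix k
    obtain d0 d1 d2 ds where e: "xs k = d0 # d1 # d2 # ds" "2 \<le> length ds" using xs3 by blast
    show "0 < q k" using q(1)[of k] by simp
    show "length d = m \<and> (\<forall>i\<in>set d. i < q k)"
        if "d \<in> set (xs k ! 0 # drop 3 (xs k) @ [xs k ! 1, xs k ! 2])" for d
      using that e dl3[of d k] by (auto simp: numeral_eq_Suc)
    show "distinct (xs k ! 0 # drop 3 (xs k) @ [xs k ! 1, xs k ! 2])"
      using e dl(1)[of k] by (auto simp: numeral_eq_Suc)
    show "2 \<le> length (drop 3 (xs k))" using e by simp
  qed (use P0 PS in simp_all)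
  have lP: "block_length k = length (P k)" for k by (simp add: block_length_def)
  have tt: "block_tower.num_codes (\<lambda>k. drop 3 (xs k)) k = t k" for k
    using dl(2)[of k] t[of k] by (simp add: num_codes_def)
  have rr: "block_tower.code_length m q k = r k" for k
      by (simp add: block_tower.code_length_def[OF block_tower_axioms] r_eq)
  have "card {w \<in> language. length w \<le> n} \<le> 8 * D * t k * n\<^sup>2" if "N k \<le> n" "n < N (Suc k)" for k n
  proof -
    have "q k * block_length k \<le> N k" by (simp add: q_def lP)
    then have "q k * block_length k \<le> n" using that by simp
    \<comment> \<open>Below \<open>N (Suc k)\<close> the length stays within the linear range of
      level \<open>Suc k\<close>, as \<open>q (Suc k)\<close> is the quotient of
      \<open>N (Suc k)\<close> by the block length.\<close>
    moreover have "n div block_length (Suc k) \<le> q (Suc k)" unfolding q_def lP using that(2)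
        by (intro div_le_mono) simp
    ultimately show ?thesis using growth_upper[of k n] unfolding growth_def tt mD by blast
  qed
  moreover have "t k * (N k)\<^sup>2 \<le> card {w \<in> language. length w \<le> 4 * D * N k}" for k
  proof -
    have lpos: "0 < block_length k" by simp
    have "N k < (q k + 1) * block_length k" unfolding q_def lP
        using dividend_less_div_times[of "length (P k)" "N k"] block_length_pos[of k, unfolded lP]
        by simp
    \<comment> \<open>Here \<open>q k + 1 \<le> r k\<close>. Together with
      \<open>r k \<le> D * q k\<close> this places the length of a code block between
      \<open>N k\<close> and \<open>D * N k\<close>.\<close>
    also have "\<dots> \<le> r k * block_length k" by (intro mult_right_mono) (auto simp: r_eq)
    finally have "(N k)\<^sup>2 \<le> (r k * block_length k)\<^sup>2" by (intro power_mono) auto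
    then have "t k * (N k)\<^sup>2 \<le> 2 * t k * (r k * block_length k)\<^sup>2" by (intro mult_mono) auto
    also have "\<dots> \<le> growth (4 * (r k * block_length k))" using growth_lower[of k] unfolding tt rr .
    also have "\<dots> \<le> growth (4 * D * N k)"
    proof -
      have "r k * block_length k \<le> D * q k * block_length k" using rD[OF q(1)]
          by (intro mult_right_mono) auto
      also have "\<dots> \<le> D * N k" by (simp add: q_def lP)
      finally have "4 * (r k * block_length k) \<le> 4 * D * N k" by simp
      then show ?thesis unfolding growth_def by (intro card_mono finite_language_le) auto
    qed
    finally show ?thesis by (simp add: growth_def)
  qed
  ultimately show ?thesis using recurrent_language unfolding D_def by blast
qed

section \<open>Upper limits of logarithmic growth rates\<close>

text \<open>The reason why constant factors do not affect growth exponents.\<close>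

lemma ln_ratio_tendsto:
  assumes "strict_mono (\<nu> :: nat \<Rightarrow> nat)"
  shows "(\<lambda>j. a / ln (real (\<nu> j)) + M) \<longlonglongrightarrow> M"
proof -
  have "filterlim (\<lambda>j. ln (real (\<nu> j))) at_top sequentially"
    using filterlim_compose[OF ln_at_top filterlim_compose[OF filterlim_real_sequentially filterlim_subseq[OF assms]]]
    by simp
  then have "((\<lambda>j. a / ln (real (\<nu> j))) \<longlonglongrightarrow> 0)"
    by (rule real_tendsto_divide_at_top[OF tendsto_const])
  then show ?thesis using tendsto_add[OF _ tendsto_const[of M]] by fastforce
qed

lemma limsup_ln_le:
  fixes g :: "nat \<Rightarrow> real"
  assumes "eventually (\<lambda>n. ln (g n) \<le> a + M * ln (real n)) sequentially"
  shows "limsup (\<lambda>n. ereal (ln (g n) / ln (real n))) \<le> ereal M"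
proof -
  have "eventually (\<lambda>n. ereal (ln (g n) / ln (real n)) \<le> ereal (a / ln (real n) + M)) sequentially"
    using assms eventually_gt_at_top[of 1]
  proof eventually_elim
    case (elim n)
    then have "ln (real n) > 0" by simp
    then show ?case using elim by (simp add: field_simps)
  qed
  then have "limsup (\<lambda>n. ereal (ln (g n) / ln (real n))) \<le> limsup (\<lambda>n. ereal (a / ln (real n) + M))"
    by (rule Limsup_mono)
  also have "\<dots> = ereal M"
    using ln_ratio_tendsto[of id a M] by (intro lim_imp_Limsup) (auto simp: strict_mono_def)
  finally show ?thesis .
qed

lemma limsup_ln_eq:
  fixes g :: "nat \<Rightarrow> real"
  assumes g: "eventually (\<lambda>n. 0 < g n \<and> g n \<le> K * real n powr M) sequentially"
    and \<nu>: "strict_mono (\<nu> :: nat \<Rightarrow> nat)" "\<And>j. \<kappa> * real (\<nu> j) powr M \<le> g (\<nu> j)" and \<kappa>: "\<kappa> > 0"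
  shows "limsup (\<lambda>n. ereal (ln (g n) / ln (real n))) = ereal M"
proof (rule antisym)
  show "limsup (\<lambda>n. ereal (ln (g n) / ln (real n))) \<le> ereal M"
  proof (rule limsup_ln_le)
    show "eventually (\<lambda>n. ln (g n) \<le> ln K + M * ln (real n)) sequentially"
      using g eventually_gt_at_top[of 0]
    proof eventually_elim
      case (elim n)
      have "0 < real n powr M" using elim by simp
      then have K: "K > 0" using elim by (meson less_le_trans zero_less_mult_pos2)
      have "ln (g n) \<le> ln (K * real n powr M)" using elim by (subst ln_le_cancel_iff) auto
      also have "\<dots> = ln K + M * ln (real n)" using K elim by (simp add: ln_mult ln_powr)
      finally show ?case .
    qed
  qed
  have "eventually (\<lambda>j. ereal (ln \<kappa> / ln (real (\<nu> j)) + M)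
      \<le> ereal (ln (g (\<nu> j)) / ln (real (\<nu> j)))) sequentially"
    using eventually_gt_at_top[of 1]
  proof eventually_elim
    case (elim j)
    then have j: "1 < \<nu> j" using strict_mono_imp_increasing[OF \<nu>(1), of j] by linarith
    have "ln (\<kappa> * real (\<nu> j) powr M) \<le> ln (g (\<nu> j))"
      using \<nu>(2)[of j] \<kappa> j by (intro ln_mono) auto
    then have "ln \<kappa> + M * ln (real (\<nu> j)) \<le> ln (g (\<nu> j))" using \<kappa> j by (simp add: ln_mult ln_powr)
    moreover have l: "ln (real (\<nu> j)) > 0" using j by simp
    ultimately have "(ln \<kappa> + M * ln (real (\<nu> j))) / ln (real (\<nu> j)) \<le> ln (g (\<nu> j)) / ln (real (\<nu> j))"
      by (intro divide_right_mono) auto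
    then show ?case using l by (simp add: add_divide_distrib)
  qed
  then have "limsup (\<lambda>j. ereal (ln \<kappa> / ln (real (\<nu> j)) + M))
      \<le> limsup ((\<lambda>n. ereal (ln (g n) / ln (real n))) \<circ> \<nu>)"
    unfolding comp_def by (rule Limsup_mono)
  also have "\<dots> \<le> limsup (\<lambda>n. ereal (ln (g n) / ln (real n)))" by (rule limsup_subseq_mono[OF \<nu>(1)])
  finally show "ereal M \<le> limsup (\<lambda>n. ereal (ln (g n) / ln (real n)))"
    using ln_ratio_tendsto[OF \<nu>(1), of "ln \<kappa>" M] by (subst (asm) lim_imp_Limsup) auto
qed

text \<open>\<open>ln (s * n)\<close> and \<open>ln n\<close> differ by a constant, so a linear
  change of the argument does not alter the exponent. The estimate is made for every real
  \<open>c\<close> above the right-hand side, which may itself be infinite. This will make the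
  growth exponent independent of the generating space.\<close>

lemma limsup_ln_rescale:
  fixes d d' :: "nat \<Rightarrow> nat"
  assumes s: "s \<ge> 1" and d: "\<And>n. d n \<le> d' (s * n)" "\<And>n. 1 \<le> d n"
  shows "limsup (\<lambda>n. ereal (ln (real (d n)) / ln (real n)))
      \<le> limsup (\<lambda>n. ereal (ln (real (d' n)) / ln (real n)))"
proof (rule dense_ge)
  fix x assume x: "limsup (\<lambda>n. ereal (ln (real (d' n)) / ln (real n))) < x"
  obtain c where c: "limsup (\<lambda>n. ereal (ln (real (d' n)) / ln (real n))) < ereal c" "ereal c < x"
    using ereal_dense2[OF x] by (elim exE conjE)
  have "eventually (\<lambda>n. ereal (ln (real (d' n)) / ln (real n)) < ereal c) sequentially"
    using c(1) by (rule Limsup_lessD)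
  then obtain n0 where n0: "\<And>n. n \<ge> n0 \<Longrightarrow> ln (real (d' n)) / ln (real n) < c"
    by (auto simp: eventually_sequentially)
  have "eventually (\<lambda>n. ln (real (d n)) \<le> c * ln (real s) + c * ln (real n)) sequentially"
    using eventually_ge_at_top[of n0] eventually_gt_at_top[of 1]
  proof eventually_elim
    case (elim n)
    have sn: "1 * n \<le> s * n" using s by (intro mult_right_mono) auto
    have "real (d n) \<le> real (d' (s * n))" using d(1)[of n] by simp
    then have "ln (real (d n)) \<le> ln (real (d' (s * n)))" using d(2)[of n] by (intro ln_mono) auto
    also have "\<dots> \<le> c * ln (real (s * n))"
    proof -
      have "ln (real (s * n)) > 0" using elim sn by (intro ln_gt_zero) linarith
      moreover have "ln (real (d' (s * n))) / ln (real (s * n)) < c" using n0[of "s * n"] elim sn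
          by linarith
      ultimately show ?thesis by (simp add: field_simps)
    qed
    also have "ln (real (s * n)) = ln (real s) + ln (real n)" using s elim by (simp add: ln_mult)
    finally show ?case by (simp add: algebra_simps)
  qed
  then have "limsup (\<lambda>n. ereal (ln (real (d n)) / ln (real n))) \<le> ereal c"
    by (rule limsup_ln_le)
  then show "limsup (\<lambda>n. ereal (ln (real (d n)) / ln (real n))) \<le> x" using c(2)
      by (rule order.trans[OF _ less_imp_le])
qed

section \<open>Monoid algebras\<close>

lemma (in abelian_monoid) finsum_fibers:
  assumes "finite A" "finite B" "h ` A \<subseteq> B" "u \<in> A \<rightarrow> carrier G"
  shows "finsum G u A = (\<Oplus>b\<in>B. \<Oplus>a\<in>{a \<in> A. h a = b}. u a)"
proof -
  have "A = (\<Union>b\<in>B. {a \<in> A. h a = b})" using assms(3) by auto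
  then have "finsum G u A = finsum G u (\<Union>b\<in>B. {a \<in> A. h a = b})" by simp
  also have "\<dots> = (\<Oplus>b\<in>B. \<Oplus>a\<in>{a \<in> A. h a = b}. u a)"
    by (rule add.finprod_UN_disjoint) (use assms in \<open>auto simp: pairwise_def disjnt_def\<close>)
  finally show ?thesis .
qed

lemma (in abelian_monoid) finsum_Times:
  assumes "finite X" "finite Y" "\<And>x y. x \<in> X \<Longrightarrow> y \<in> Y \<Longrightarrow> u (x, y) \<in> carrier G"
  shows "finsum G u (X \<times> Y) = (\<Oplus>x\<in>X. \<Oplus>y\<in>Y. u (x, y))"
proof -
  have "finsum G u (X \<times> Y) = (\<Oplus>x\<in>X. \<Oplus>a\<in>{a \<in> X \<times> Y. fst a = x}. u a)"
    by (rule finsum_fibers) (use assms in auto)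
  also have "\<dots> = (\<Oplus>x\<in>X. \<Oplus>y\<in>Y. u (x, y))"
  proof (rule finsum_cong', simp)
    fix x assume x: "x \<in> X"
    then have "{a \<in> X \<times> Y. fst a = x} = Pair x ` Y" by auto
    then show "(\<Oplus>a\<in>{a \<in> X \<times> Y. fst a = x}. u a) = (\<Oplus>y\<in>Y. u (x, y))"
      using x assms(3) by (subst finsum_reindex[symmetric]) (auto simp: inj_on_def Pi_def)
  qed (use assms in auto)
  finally show ?thesis .
qed

text \<open>The value at \<open>f\<close> of the linear functional that extends
  \<open>\<phi>\<close>. Identities in the monoid algebra are checked by pairing with all
  \<open>\<phi>\<close>, because this turns the convolution product into composition with the
  product of the monoid.\<close>

definition pairing :: "('f, 'r) ring_scheme \<Rightarrow> ('m \<Rightarrow> 'f) \<Rightarrow> ('m \<Rightarrow> 'f) \<Rightarrow> 'f" where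
  "pairing F f \<phi> = (\<Oplus>\<^bsub>F\<^esub>x\<in>{x. f x \<noteq> \<zero>\<^bsub>F\<^esub>}. f x \<otimes>\<^bsub>F\<^esub> \<phi> x)"

lemma monoid_algebra_simps:
  "zero (monoid_algebra F M) = (\<lambda>x. \<zero>\<^bsub>F\<^esub>)"
  "one (monoid_algebra F M) = basis_elem F \<one>\<^bsub>M\<^esub>"
  "add (monoid_algebra F M) f g = (\<lambda>x. f x \<oplus>\<^bsub>F\<^esub> g x)"
  "smult (monoid_algebra F M) c f = (\<lambda>x. c \<otimes>\<^bsub>F\<^esub> f x)"
  by (simp_all add: monoid_algebra_def basis_elem_def)

lemma monoid_algebra_carrier:
  "f \<in> carrier (monoid_algebra F M) \<longleftrightarrow>
    (\<forall>x. f x \<in> carrier F) \<and> (\<forall>x. x \<notin> carrier M \<longrightarrow> f x = \<zero>\<^bsub>F\<^esub>) \<and> finite {x. f x \<noteq> \<zero>\<^bsub>F\<^esub>}"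
  by (auto simp: monoid_algebra_def)

locale monoid_algebra_data = F?: field F + M: monoid M
  for F :: "('f, 'r) ring_scheme" (structure) and M :: "('m, 's) monoid_scheme"
begin

abbreviation "T \<equiv> monoid_algebra F M"

lemma carr [simp, intro]: "f \<in> carrier T \<Longrightarrow> f x \<in> carrier F"
  by (simp add: monoid_algebra_carrier)

lemma pairing_eq_finsum:
  assumes "f \<in> carrier T" "\<phi> \<in> UNIV \<rightarrow> carrier F" "finite X" "{x. f x \<noteq> \<zero>} \<subseteq> X"
  shows "pairing F f \<phi> = (\<Oplus>x\<in>X. f x \<otimes> \<phi> x)"
  unfolding pairing_def
  by (rule add.finprod_mono_neutral_cong_left) (use assms in \<open>auto simp: Pi_def\<close>)

lemma pairing_closed [simp, intro]:
  "f \<in> carrier T \<Longrightarrow> \<phi> \<in> UNIV \<rightarrow> carrier F \<Longrightarrow> pairing F f \<phi> \<in> carrier F"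
  unfolding pairing_def by (intro finsum_closed) (auto simp: Pi_def)

lemma pairing_cong:
  assumes "f \<in> carrier T" "\<phi> \<in> UNIV \<rightarrow> carrier F" "\<And>x. x \<in> carrier M \<Longrightarrow> \<phi> x = \<psi> x"
  shows "pairing F f \<phi> = pairing F f \<psi>"
proof -
  have "\<psi> x = \<phi> x" if "f x \<noteq> \<zero>" for x using assms(1,3) that by (metis monoid_algebra_carrier)
  then show ?thesis unfolding pairing_def
    by (intro finsum_cong') (use assms(1,2) in \<open>auto simp: Pi_def\<close>)
qed

lemma finite_supp: "f \<in> carrier T \<Longrightarrow> finite {x. f x \<noteq> \<zero>}"
  by (simp add: monoid_algebra_carrier)

lemma T_add_closed: assumes "f \<in> carrier T" "g \<in> carrier T" shows "(\<lambda>x. f x \<oplus> g x) \<in> carrier T"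
proof -
  have "{x. f x \<oplus> g x \<noteq> \<zero>} \<subseteq> {x. f x \<noteq> \<zero>} \<union> {x. g x \<noteq> \<zero>}" using assms by auto
  then have "finite {x. f x \<oplus> g x \<noteq> \<zero>}" by (rule finite_subset) (use assms finite_supp in auto)
  then show ?thesis using assms by (simp add: monoid_algebra_carrier)
qed

lemma T_smult_closed: assumes "f \<in> carrier T" "c \<in> carrier F" shows "(\<lambda>x. c \<otimes> f x) \<in> carrier T"
proof -
  have "{x. c \<otimes> f x \<noteq> \<zero>} \<subseteq> {x. f x \<noteq> \<zero>}" using assms by auto
  then have "finite {x. c \<otimes> f x \<noteq> \<zero>}" by (rule finite_subset) (use assms finite_supp in auto)
  then show ?thesis using assms by (auto simp: monoid_algebra_carrier)
qed

lemma basis_elem_closed: "x \<in> carrier M \<Longrightarrow> basis_elem F x \<in> carrier T"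
  by (auto simp: monoid_algebra_carrier basis_elem_def)

lemma pairing_add:
  assumes "f \<in> carrier T" "g \<in> carrier T" "\<phi> \<in> UNIV \<rightarrow> carrier F"
  shows "pairing F (\<lambda>x. f x \<oplus> g x) \<phi> = pairing F f \<phi> \<oplus> pairing F g \<phi>"
proof -
  define X where "X = {x. f x \<noteq> \<zero>} \<union> {x. g x \<noteq> \<zero>}"
  have X: "finite X" "{x. f x \<noteq> \<zero>} \<subseteq> X" "{x. g x \<noteq> \<zero>} \<subseteq> X" "{x. f x \<oplus> g x \<noteq> \<zero>} \<subseteq> X"
    using assms finite_supp by (auto simp: X_def)
  have "pairing F (\<lambda>x. f x \<oplus> g x) \<phi> = (\<Oplus>x\<in>X. (f x \<oplus> g x) \<otimes> \<phi> x)"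
    using assms X by (intro pairing_eq_finsum T_add_closed) auto
  also have "\<dots> = (\<Oplus>x\<in>X. f x \<otimes> \<phi> x \<oplus> g x \<otimes> \<phi> x)"
    using assms by (intro finsum_cong') (auto simp: l_distr Pi_def)
  also have "\<dots> = (\<Oplus>x\<in>X. f x \<otimes> \<phi> x) \<oplus> (\<Oplus>x\<in>X. g x \<otimes> \<phi> x)"
    using assms by (intro finsum_addf) auto
  finally show ?thesis using assms X by (simp add: pairing_eq_finsum)
qed

lemma pairing_smult:
  assumes "f \<in> carrier T" "c \<in> carrier F" "\<phi> \<in> UNIV \<rightarrow> carrier F"
  shows "pairing F (\<lambda>x. c \<otimes> f x) \<phi> = c \<otimes> pairing F f \<phi>"
proof -
  define X where "X = {x. f x \<noteq> \<zero>}"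
  have X: "finite X" "{x. f x \<noteq> \<zero>} \<subseteq> X" "{x. c \<otimes> f x \<noteq> \<zero>} \<subseteq> X"
    using assms finite_supp by (auto simp: X_def)
  have "pairing F (\<lambda>x. c \<otimes> f x) \<phi> = (\<Oplus>x\<in>X. (c \<otimes> f x) \<otimes> \<phi> x)"
    using assms X by (intro pairing_eq_finsum T_smult_closed) auto
  also have "\<dots> = (\<Oplus>x\<in>X. c \<otimes> (f x \<otimes> \<phi> x))"
    using assms by (intro finsum_cong') (auto simp: m_assoc Pi_def)
  also have "\<dots> = c \<otimes> (\<Oplus>x\<in>X. f x \<otimes> \<phi> x)"
    using assms X by (subst finsum_rdistr) auto
  finally show ?thesis using assms X by (simp add: pairing_eq_finsum)
qed

lemma pairing_add_right:
  assumes "f \<in> carrier T" "\<phi> \<in> UNIV \<rightarrow> carrier F" "\<psi> \<in> UNIV \<rightarrow> carrier F"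
  shows "pairing F f (\<lambda>x. \<phi> x \<oplus> \<psi> x) = pairing F f \<phi> \<oplus> pairing F f \<psi>"
proof -
  have "pairing F f (\<lambda>x. \<phi> x \<oplus> \<psi> x) = (\<Oplus>x\<in>{x. f x \<noteq> \<zero>}. f x \<otimes> \<phi> x \<oplus> f x \<otimes> \<psi> x)"
    unfolding pairing_def using assms by (intro finsum_cong') (auto simp: r_distr Pi_def)
  also have "\<dots> = pairing F f \<phi> \<oplus> pairing F f \<psi>"
    unfolding pairing_def using assms by (intro finsum_addf) auto
  finally show ?thesis .
qed

lemma pairing_smult_right:
  assumes "f \<in> carrier T" "c \<in> carrier F" "\<phi> \<in> UNIV \<rightarrow> carrier F"
  shows "pairing F f (\<lambda>x. c \<otimes> \<phi> x) = c \<otimes> pairing F f \<phi>"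
proof -
  have "pairing F f (\<lambda>x. c \<otimes> \<phi> x) = (\<Oplus>x\<in>{x. f x \<noteq> \<zero>}. c \<otimes> (f x \<otimes> \<phi> x))"
    unfolding pairing_def using assms by (intro finsum_cong') (auto simp: m_lcomm Pi_def)
  also have "\<dots> = c \<otimes> pairing F f \<phi>"
    unfolding pairing_def using assms finite_supp by (subst finsum_rdistr) auto
  finally show ?thesis .
qed

lemma pairing_zero_right: "f \<in> carrier T \<Longrightarrow> pairing F f (\<lambda>x. \<zero>) = \<zero>"
  unfolding pairing_def by (rule add.finprod_one_eqI) auto

lemma pairing_basis_right:
  assumes "f \<in> carrier T" shows "pairing F f (basis_elem F z) = f z"
proof -
  have "pairing F f (basis_elem F z) = (\<Oplus>x\<in>insert z {x. f x \<noteq> \<zero>}. f x \<otimes> basis_elem F z x)"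
    using assms finite_supp by (intro pairing_eq_finsum) (auto simp: basis_elem_def)
  also have "\<dots> = (\<Oplus>x\<in>insert z {x. f x \<noteq> \<zero>}. if z = x then f x else \<zero>)"
    using assms by (intro finsum_cong') (auto simp: basis_elem_def)
  also have "\<dots> = f z" using assms finite_supp by (intro finsum_singleton) auto
  finally show ?thesis .
qed

lemma pairing_basis:
  assumes "\<phi> \<in> UNIV \<rightarrow> carrier F" "z \<in> carrier M" shows "pairing F (basis_elem F z) \<phi> = \<phi> z"
proof -
  have "pairing F (basis_elem F z) \<phi> = (\<Oplus>x\<in>{z}. basis_elem F z x \<otimes> \<phi> x)"
    using assms basis_elem_closed by (intro pairing_eq_finsum) (auto simp: basis_elem_def)
  also have "\<dots> = \<phi> z" using assms by (subst finsum_insert) (auto simp: basis_elem_def Pi_def)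
  finally show ?thesis .
qed

text \<open>The indicator functions \<open>basis_elem F x\<close> are among the test functions and
  recover the coefficients.\<close>

lemma T_eqI:
  assumes "f \<in> carrier T" "g \<in> carrier T" "\<And>\<phi>. \<phi> \<in> UNIV \<rightarrow> carrier F \<Longrightarrow> pairing F f \<phi> = pairing F g \<phi>"
  shows "f = g"
proof
  fix x
  have "pairing F f (basis_elem F x) = pairing F g (basis_elem F x)"
    by (rule assms(3)) (auto simp: basis_elem_def)
  then show "f x = g x" using assms by (simp add: pairing_basis_right)
qed

lemma mult_eq: "(f \<otimes>\<^bsub>T\<^esub> g) z = (\<Oplus>p\<in>{p \<in> {x. f x \<noteq> \<zero>} \<times> {y. g y \<noteq> \<zero>}. fst p \<otimes>\<^bsub>M\<^esub> snd p
    = z}. f (fst p) \<otimes> g (snd p))"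
proof -
  have "{p \<in> {x. f x \<noteq> \<zero>} \<times> {y. g y \<noteq> \<zero>}. fst p \<otimes>\<^bsub>M\<^esub> snd p = z} =
     {(x, y). f x \<noteq> \<zero> \<and> g y \<noteq> \<zero> \<and> x \<otimes>\<^bsub>M\<^esub> y = z}" by auto
  then show ?thesis by (simp add: monoid_algebra_def)
qed

lemma mult_eq_zero: 
  assumes "\<And>x y. x \<in> carrier M \<Longrightarrow> y \<in> carrier M \<Longrightarrow> x \<otimes>\<^bsub>M\<^esub> y = z \<Longrightarrow> f x = \<zero> \<or> g y = \<zero>"
    and fg: "f \<in> carrier T" "g \<in> carrier T"
  shows "(f \<otimes>\<^bsub>T\<^esub> g) z = \<zero>"
proof -
  have "x \<in> carrier M" if "f x \<noteq> \<zero> \<or> g x \<noteq> \<zero>" for x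
    using that fg by (auto simp: monoid_algebra_carrier)
  then have "\<not> (f x \<noteq> \<zero> \<and> g y \<noteq> \<zero> \<and> x \<otimes>\<^bsub>M\<^esub> y = z)" for x y
    using assms(1)[of x y] by blast
  then have "{p \<in> {x. f x \<noteq> \<zero>} \<times> {y. g y \<noteq> \<zero>}. fst p \<otimes>\<^bsub>M\<^esub> snd p = z} = {}"
    by auto
  then show ?thesis unfolding mult_eq by (simp only: finsum_empty)
qed

lemma T_mult_closed:
  assumes fg: "f \<in> carrier T" "g \<in> carrier T" shows "f \<otimes>\<^bsub>T\<^esub> g \<in> carrier T"
proof -
  let ?Z = "(\<lambda>p. fst p \<otimes>\<^bsub>M\<^esub> snd p) ` ({x. f x \<noteq> \<zero>} \<times> {y. g y \<noteq> \<zero>})"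
  have "(f \<otimes>\<^bsub>T\<^esub> g) z = \<zero>" if "z \<notin> ?Z" for z
  proof (rule mult_eq_zero[OF _ fg])
    fix x y assume "x \<otimes>\<^bsub>M\<^esub> y = z"
    then show "f x = \<zero> \<or> g y = \<zero>" using that by force
  qed
  then have "{z. (f \<otimes>\<^bsub>T\<^esub> g) z \<noteq> \<zero>} \<subseteq> ?Z" by blast
  moreover have "finite ?Z" using fg finite_supp by auto
  ultimately have "finite {z. (f \<otimes>\<^bsub>T\<^esub> g) z \<noteq> \<zero>}" by (rule finite_subset)
  moreover have "(f \<otimes>\<^bsub>T\<^esub> g) z \<in> carrier F" for z
    unfolding mult_eq using fg by (intro finsum_closed) auto
  moreover have "(f \<otimes>\<^bsub>T\<^esub> g) z = \<zero>" if "z \<notin> carrier M" for z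
    by (rule mult_eq_zero[OF _ fg]) (use that in auto)
  ultimately show ?thesis unfolding monoid_algebra_carrier by blast
qed

text \<open>Grouping the finite double sum by the value of the product, as in Fubini's theorem,
  removes the convolution. Associativity, the unit laws and distributivity are read off from this
  formula, and later the ideal property of the kernel of all bilinear forms.\<close>

lemma pairing_mult:
  assumes fg: "f \<in> carrier T" "g \<in> carrier T" and \<phi>: "\<phi> \<in> UNIV \<rightarrow> carrier F"
  shows "pairing F (f \<otimes>\<^bsub>T\<^esub> g) \<phi> = pairing F f (\<lambda>x. pairing F g (\<lambda>y. \<phi> (x \<otimes>\<^bsub>M\<^esub> y)))"
proof -
  define X where "X = {x. f x \<noteq> \<zero>}"
  define Y where "Y = {x. g x \<noteq> \<zero>}"
  define h where "h = (\<lambda>p. fst p \<otimes>\<^bsub>M\<^esub> snd p)"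
  have fin: "finite X" "finite Y" using fg finite_supp by (auto simp: X_def Y_def)
  have \<phi>': "\<phi> z \<in> carrier F" for z using \<phi> by auto
  have supp: "{z. (f \<otimes>\<^bsub>T\<^esub> g) z \<noteq> \<zero>} \<subseteq> h ` (X \<times> Y)"
  proof -
    have "(f \<otimes>\<^bsub>T\<^esub> g) z = \<zero>" if "z \<notin> h ` (X \<times> Y)" for z
    proof (rule mult_eq_zero[OF _ fg])
      fix x y assume "x \<otimes>\<^bsub>M\<^esub> y = z"
      then show "f x = \<zero> \<or> g y = \<zero>" using that unfolding h_def X_def Y_def by force
    qed
    then show ?thesis by blast
  qed
  have "pairing F (f \<otimes>\<^bsub>T\<^esub> g) \<phi> = (\<Oplus>z\<in>h ` (X \<times> Y). (f \<otimes>\<^bsub>T\<^esub> g) z \<otimes> \<phi> z)"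
    using fg \<phi> fin supp by (intro pairing_eq_finsum T_mult_closed) auto
  also have "\<dots> = (\<Oplus>z\<in>h ` (X \<times> Y). \<Oplus>p\<in>{p \<in> X \<times> Y. h p = z}. f (fst p) \<otimes> g (snd p) \<otimes> \<phi> (h p))"
  proof (rule finsum_cong', simp)
    fix z
    have "(f \<otimes>\<^bsub>T\<^esub> g) z \<otimes> \<phi> z = (\<Oplus>p\<in>{p \<in> X \<times> Y. h p = z}. f (fst p) \<otimes> g (snd p) \<otimes> \<phi> z)"
      unfolding mult_eq X_def[symmetric] Y_def[symmetric] h_def[symmetric]
      using fg fin \<phi>' by (subst finsum_ldistr) (auto simp: h_def)
    also have "\<dots> = (\<Oplus>p\<in>{p \<in> X \<times> Y. h p = z}. f (fst p) \<otimes> g (snd p) \<otimes> \<phi> (h p))"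
      using fg \<phi>' by (intro finsum_cong') auto
    finally show "(f \<otimes>\<^bsub>T\<^esub> g) z \<otimes> \<phi> z = (\<Oplus>p\<in>{p \<in> X \<times> Y. h p = z}. f (fst p) \<otimes> g (snd p) \<otimes> \<phi> (h p))" .
  qed (use fg \<phi>' in \<open>auto intro!: finsum_closed\<close>)
  also have "\<dots> = (\<Oplus>p\<in>X \<times> Y. f (fst p) \<otimes> g (snd p) \<otimes> \<phi> (h p))"
    using fg \<phi>' fin by (intro finsum_fibers[symmetric]) auto
  also have "\<dots> = (\<Oplus>x\<in>X. \<Oplus>y\<in>Y. f x \<otimes> g y \<otimes> \<phi> (x \<otimes>\<^bsub>M\<^esub> y))"
    using fg \<phi>' fin by (subst finsum_Times) (auto simp: h_def)
  also have "\<dots> = (\<Oplus>x\<in>X. f x \<otimes> pairing F g (\<lambda>y. \<phi> (x \<otimes>\<^bsub>M\<^esub> y)))"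
  proof (rule finsum_cong', simp)
    fix x
    have "(\<Oplus>y\<in>Y. f x \<otimes> g y \<otimes> \<phi> (x \<otimes>\<^bsub>M\<^esub> y)) = (\<Oplus>y\<in>Y. f x \<otimes> (g y \<otimes> \<phi> (x \<otimes>\<^bsub>M\<^esub> y)))"
      using fg \<phi>' by (intro finsum_cong') (auto simp: m_assoc)
    also have "\<dots> = f x \<otimes> (\<Oplus>y\<in>Y. g y \<otimes> \<phi> (x \<otimes>\<^bsub>M\<^esub> y))"
      using fg \<phi>' fin by (subst finsum_rdistr) auto
    finally show "(\<Oplus>y\<in>Y. f x \<otimes> g y \<otimes> \<phi> (x \<otimes>\<^bsub>M\<^esub> y)) = f x \<otimes> pairing F g (\<lambda>y. \<phi> (x \<otimes>\<^bsub>M\<^esub> y))"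
      by (simp add: pairing_def Y_def)
  qed (use fg \<phi>' in auto)
  also have "\<dots> = pairing F f (\<lambda>x. pairing F g (\<lambda>y. \<phi> (x \<otimes>\<^bsub>M\<^esub> y)))"
    by (simp add: pairing_def[of F f] X_def)
  finally show ?thesis .
qed

end

locale field_algebra = vectorspace F A + A?: ring A
  for F :: "('f, 'r) ring_scheme" and A :: "('f, 'a, 's) module_scheme" +
  assumes smult_mult_left: "\<lbrakk>c \<in> carrier F; a \<in> carrier A; b \<in> carrier A\<rbrakk> \<Longrightarrow>
      (c \<odot>\<^bsub>A\<^esub> a) \<otimes>\<^bsub>A\<^esub> b = c \<odot>\<^bsub>A\<^esub> (a \<otimes>\<^bsub>A\<^esub> b)"
    and smult_mult_right: "\<lbrakk>c \<in> carrier F; a \<in> carrier A; b \<in> carrier A\<rbrakk> \<Longrightarrow>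
      a \<otimes>\<^bsub>A\<^esub> (c \<odot>\<^bsub>A\<^esub> b) = c \<odot>\<^bsub>A\<^esub> (a \<otimes>\<^bsub>A\<^esub> b)"

context monoid_algebra_data
begin

lemma T_abelian_group: "abelian_group T"
proof (rule abelian_groupI)
  show "x \<oplus>\<^bsub>T\<^esub> y \<in> carrier T" if "x \<in> carrier T" "y \<in> carrier T" for x y
    using T_add_closed that by (simp add: monoid_algebra_simps)
  show "\<zero>\<^bsub>T\<^esub> \<in> carrier T" by (simp add: monoid_algebra_simps monoid_algebra_carrier)
  show "\<exists>y\<in>carrier T. y \<oplus>\<^bsub>T\<^esub> x = \<zero>\<^bsub>T\<^esub>" if "x \<in> carrier T" for x
  proof (rule bexI)
    show "(\<lambda>z. (\<ominus> \<one>) \<otimes> x z) \<oplus>\<^bsub>T\<^esub> x = \<zero>\<^bsub>T\<^esub>"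
      using that by (simp add: monoid_algebra_simps l_minus l_neg)
    show "(\<lambda>z. (\<ominus> \<one>) \<otimes> x z) \<in> carrier T" using that by (intro T_smult_closed) auto
  qed
qed (auto simp: monoid_algebra_simps fun_eq_iff a_ac)

lemma T_ring: "ring T"
proof (rule ringI[OF T_abelian_group])
  show "monoid T"
  proof (rule monoidI)
    show "\<one>\<^bsub>T\<^esub> \<in> carrier T" by (simp add: monoid_algebra_simps basis_elem_closed)
    show "x \<otimes>\<^bsub>T\<^esub> y \<otimes>\<^bsub>T\<^esub> z = x \<otimes>\<^bsub>T\<^esub> (y \<otimes>\<^bsub>T\<^esub> z)"
      if "x \<in> carrier T" "y \<in> carrier T" "z \<in> carrier T" for x y z
    proof (rule T_eqI)
      fix \<phi> :: "'m \<Rightarrow> 'f" assume \<phi>: "\<phi> \<in> UNIV \<rightarrow> carrier F"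
      have "pairing F (x \<otimes>\<^bsub>T\<^esub> y \<otimes>\<^bsub>T\<^esub> z) \<phi> =
          pairing F x (\<lambda>a. pairing F y (\<lambda>b. pairing F z (\<lambda>c. \<phi> (a \<otimes>\<^bsub>M\<^esub> b \<otimes>\<^bsub>M\<^esub> c))))"
        using that \<phi> by (simp add: pairing_mult T_mult_closed Pi_def)
      also have "\<dots> = pairing F x (\<lambda>a. pairing F y (\<lambda>b. pairing F z (\<lambda>c. \<phi> (a \<otimes>\<^bsub>M\<^esub> (b \<otimes>\<^bsub>M\<^esub> c)))))"
        using that \<phi> by (intro pairing_cong) (auto simp: M.m_assoc)
      also have "\<dots> = pairing F (x \<otimes>\<^bsub>T\<^esub> (y \<otimes>\<^bsub>T\<^esub> z)) \<phi>"
        using that \<phi> by (simp add: pairing_mult T_mult_closed Pi_def)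
      finally show "pairing F (x \<otimes>\<^bsub>T\<^esub> y \<otimes>\<^bsub>T\<^esub> z) \<phi> = pairing F (x \<otimes>\<^bsub>T\<^esub> (y \<otimes>\<^bsub>T\<^esub> z)) \<phi>" .
    qed (use that in \<open>auto intro!: T_mult_closed\<close>)
    show "\<one>\<^bsub>T\<^esub> \<otimes>\<^bsub>T\<^esub> x = x" if "x \<in> carrier T" for x
      unfolding monoid_algebra_simps(2)
    proof (rule T_eqI)
      fix \<phi> :: "'m \<Rightarrow> 'f" assume \<phi>: "\<phi> \<in> UNIV \<rightarrow> carrier F"
      have "pairing F (basis_elem F \<one>\<^bsub>M\<^esub> \<otimes>\<^bsub>T\<^esub> x) \<phi> = pairing F x (\<lambda>y. \<phi> (\<one>\<^bsub>M\<^esub> \<otimes>\<^bsub>M\<^esub> y))"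
        using that \<phi> by (simp add: pairing_mult basis_elem_closed pairing_basis Pi_def)
      also have "\<dots> = pairing F x \<phi>" using that \<phi> by (intro pairing_cong) auto
      finally show "pairing F (basis_elem F \<one>\<^bsub>M\<^esub> \<otimes>\<^bsub>T\<^esub> x) \<phi> = pairing F x \<phi>" .
    qed (use that in \<open>auto intro!: T_mult_closed basis_elem_closed\<close>)
    show "x \<otimes>\<^bsub>T\<^esub> \<one>\<^bsub>T\<^esub> = x" if "x \<in> carrier T" for x
      unfolding monoid_algebra_simps(2)
    proof (rule T_eqI)
      fix \<phi> :: "'m \<Rightarrow> 'f" assume \<phi>: "\<phi> \<in> UNIV \<rightarrow> carrier F"
      have "pairing F (x \<otimes>\<^bsub>T\<^esub> basis_elem F \<one>\<^bsub>M\<^esub>) \<phi> = pairing F x (\<lambda>y. \<phi> (y \<otimes>\<^bsub>M\<^esub> \<one>\<^bsub>M\<^esub>))"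
        using that \<phi> by (simp add: pairing_mult basis_elem_closed pairing_basis Pi_def)
      also have "\<dots> = pairing F x \<phi>" using that \<phi> by (intro pairing_cong) auto
      finally show "pairing F (x \<otimes>\<^bsub>T\<^esub> basis_elem F \<one>\<^bsub>M\<^esub>) \<phi> = pairing F x \<phi>" .
    qed (use that in \<open>auto intro!: T_mult_closed basis_elem_closed\<close>)
  qed (rule T_mult_closed)
  fix x y z assume xyz: "x \<in> carrier T" "y \<in> carrier T" "z \<in> carrier T"
  show "(x \<oplus>\<^bsub>T\<^esub> y) \<otimes>\<^bsub>T\<^esub> z = x \<otimes>\<^bsub>T\<^esub> z \<oplus>\<^bsub>T\<^esub> y \<otimes>\<^bsub>T\<^esub> z"
    unfolding monoid_algebra_simps
    by (rule T_eqI) (use xyz in \<open>simp_all add: T_mult_closed T_add_closed pairing_mult pairing_add Pi_def\<close>)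
  show "z \<otimes>\<^bsub>T\<^esub> (x \<oplus>\<^bsub>T\<^esub> y) = z \<otimes>\<^bsub>T\<^esub> x \<oplus>\<^bsub>T\<^esub> z \<otimes>\<^bsub>T\<^esub> y"
    unfolding monoid_algebra_simps
    by (rule T_eqI) (use xyz in \<open>simp_all add: T_mult_closed T_add_closed pairing_mult pairing_add pairing_add_right Pi_def\<close>)
qed

lemma T_field_algebra: "field_algebra F T"
proof -
  interpret T: ring T by (rule T_ring)
  have "module F T"
    by (rule moduleI[OF F.is_cring T_abelian_group])
      (simp_all add: monoid_algebra_simps(3,4) T_smult_closed l_distr r_distr m_assoc)
  then interpret module F T .
  interpret vectorspace F T ..
  show ?thesis
  proof
    fix c a b assume cab: "c \<in> carrier F" "a \<in> carrier T" "b \<in> carrier T"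
    show "(c \<odot>\<^bsub>T\<^esub> a) \<otimes>\<^bsub>T\<^esub> b = c \<odot>\<^bsub>T\<^esub> (a \<otimes>\<^bsub>T\<^esub> b)"
      unfolding monoid_algebra_simps
      by (rule T_eqI) (use cab in \<open>simp_all add: T_mult_closed T_smult_closed pairing_mult pairing_smult Pi_def\<close>)
    show "a \<otimes>\<^bsub>T\<^esub> (c \<odot>\<^bsub>T\<^esub> b) = c \<odot>\<^bsub>T\<^esub> (a \<otimes>\<^bsub>T\<^esub> b)"
      unfolding monoid_algebra_simps
      by (rule T_eqI) (use cab in \<open>simp_all add: T_mult_closed T_smult_closed pairing_mult pairing_smult pairing_smult_right Pi_def\<close>)
  qed
qed

lemma basis_mult:
  assumes "x \<in> carrier M" "y \<in> carrier M"
  shows "basis_elem F x \<otimes>\<^bsub>T\<^esub> basis_elem F y = basis_elem F (x \<otimes>\<^bsub>M\<^esub> y)"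
  by (rule T_eqI) (use assms in \<open>simp_all add: T_mult_closed basis_elem_closed pairing_mult pairing_basis Pi_def\<close>)

end

section \<open>Quotients and powers of generating spaces\<close>

lemma field_algebra_image:
  assumes "field_algebra F A" and car: "carrier B = h ` carrier A"
    and add: "\<And>x y. x \<in> carrier A \<Longrightarrow> y \<in> carrier A \<Longrightarrow> h x \<oplus>\<^bsub>B\<^esub> h y = h (x \<oplus>\<^bsub>A\<^esub> y)"
    and mult: "\<And>x y. x \<in> carrier A \<Longrightarrow> y \<in> carrier A \<Longrightarrow> h x \<otimes>\<^bsub>B\<^esub> h y = h (x \<otimes>\<^bsub>A\<^esub> y)"
    and smult: "\<And>c x. c \<in> carrier F \<Longrightarrow> x \<in> carrier A \<Longrightarrow> c \<odot>\<^bsub>B\<^esub> h x = h (c \<odot>\<^bsub>A\<^esub> x)"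
    and one: "\<one>\<^bsub>B\<^esub> = h \<one>\<^bsub>A\<^esub>" and zero: "\<zero>\<^bsub>B\<^esub> = h \<zero>\<^bsub>A\<^esub>"
  shows "field_algebra F B"
proof -
  interpret A: field_algebra F A by fact
  have ag: "abelian_group B"
  proof (rule abelian_groupI)
    fix x assume "x \<in> carrier B"
    then obtain a where a: "a \<in> carrier A" "x = h a" using car by auto
    have "h (\<ominus>\<^bsub>A\<^esub> a) \<oplus>\<^bsub>B\<^esub> x = \<zero>\<^bsub>B\<^esub>" using a add zero by (simp add: A.l_neg)
    then show "\<exists>y\<in>carrier B. y \<oplus>\<^bsub>B\<^esub> x = \<zero>\<^bsub>B\<^esub>" using a car by blast
  qed (auto simp: car add zero A.a_ac)
  have ring: "ring B"
  proof (rule ringI[OF ag])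
    show "monoid B" by (rule monoidI) (auto simp: car mult one A.m_assoc)
  qed (auto simp: car mult add A.l_distr A.r_distr)
  have mod: "module F B"
    by (rule moduleI[OF A.R.is_cring ag])
      (auto simp: car smult add A.smult_l_distr A.smult_r_distr A.smult_assoc1)
  interpret B: ring B by fact
  interpret B: module F B by fact
  interpret B: vectorspace F B ..
  show ?thesis
    by unfold_locales (auto simp: car smult mult A.smult_mult_left A.smult_mult_right)
qed

locale algebra_quotient = field_algebra F A + ideal I A
  for F :: "('f, 'r) ring_scheme" and A :: "('f, 'a, 's) module_scheme" and I
begin

abbreviation "Q \<equiv> quot_algebra A I"
definition proj where "proj x = I +>\<^bsub>A\<^esub> x"

lemma proj_eq_iff: "x \<in> carrier A \<Longrightarrow> y \<in> carrier A \<Longrightarrow> proj x = proj y \<longleftrightarrow> x \<ominus>\<^bsub>A\<^esub> y \<in> I"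
  unfolding proj_def using a_rcos_module_minus[OF A.ring_axioms, of y x]
  by (metis a_repr_independence' a_rcos_self)

text \<open>A scalar multiple is the product with a multiple of the unit, so a ring ideal is
  automatically a subspace.\<close>

lemma I_smult: "c \<in> carrier F \<Longrightarrow> x \<in> I \<Longrightarrow> c \<odot>\<^bsub>A\<^esub> x \<in> I"
proof -
  assume cx: "c \<in> carrier F" "x \<in> I"
  then have "(c \<odot>\<^bsub>A\<^esub> \<one>\<^bsub>A\<^esub>) \<otimes>\<^bsub>A\<^esub> x \<in> I" by (intro I_l_closed) auto
  then show ?thesis using cx by (simp add: smult_mult_left)
qed

lemma proj_simps:
  "carrier Q = proj ` carrier A"
  "x \<in> carrier A \<Longrightarrow> y \<in> carrier A \<Longrightarrow> proj x \<oplus>\<^bsub>Q\<^esub> proj y = proj (x \<oplus>\<^bsub>A\<^esub> y)"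
  "x \<in> carrier A \<Longrightarrow> y \<in> carrier A \<Longrightarrow> proj x \<otimes>\<^bsub>Q\<^esub> proj y = proj (x \<otimes>\<^bsub>A\<^esub> y)"
  "\<one>\<^bsub>Q\<^esub> = proj \<one>\<^bsub>A\<^esub>" "\<zero>\<^bsub>Q\<^esub> = proj \<zero>\<^bsub>A\<^esub>"
proof -
  show "carrier Q = proj ` carrier A"
    by (auto simp: quot_algebra_def FactRing_def A_RCOSETS_def' proj_def)
  show "proj x \<oplus>\<^bsub>Q\<^esub> proj y = proj (x \<oplus>\<^bsub>A\<^esub> y)" if "x \<in> carrier A" "y \<in> carrier A"
    using that by (simp add: quot_algebra_def FactRing_def proj_def a_rcos_sum)
  show "proj x \<otimes>\<^bsub>Q\<^esub> proj y = proj (x \<otimes>\<^bsub>A\<^esub> y)" if "x \<in> carrier A" "y \<in> carrier A"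
    using that by (simp add: quot_algebra_def FactRing_def proj_def rcoset_mult_add)
  show "\<one>\<^bsub>Q\<^esub> = proj \<one>\<^bsub>A\<^esub>" by (simp add: quot_algebra_def FactRing_def proj_def)
  show "\<zero>\<^bsub>Q\<^esub> = proj \<zero>\<^bsub>A\<^esub>"
    using a_coset_add_zero[OF a_subset] by (simp add: quot_algebra_def FactRing_def proj_def)
qed

text \<open>The definition takes a union over all representatives; as \<open>I\<close> is stable
  under scalars, all members of this union are the same coset.\<close>

lemma proj_smult:
  assumes c: "c \<in> carrier F" "x \<in> carrier A" shows "c \<odot>\<^bsub>Q\<^esub> proj x = proj (c \<odot>\<^bsub>A\<^esub> x)"
proof -
  have *: "proj (c \<odot>\<^bsub>A\<^esub> y) = proj (c \<odot>\<^bsub>A\<^esub> x)" if "y \<in> proj x" for y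
  proof -
    have y: "y \<in> carrier A" using that c by (metis a_elemrcos_carrier proj_def)
    have "proj y = proj x" using that c y unfolding proj_def by (metis a_repr_independence')
    then have "y \<ominus>\<^bsub>A\<^esub> x \<in> I" using proj_eq_iff y c by simp
    then have "c \<odot>\<^bsub>A\<^esub> (y \<ominus>\<^bsub>A\<^esub> x) \<in> I" using I_smult c by simp
    moreover have "c \<odot>\<^bsub>A\<^esub> (y \<ominus>\<^bsub>A\<^esub> x) = c \<odot>\<^bsub>A\<^esub> y \<ominus>\<^bsub>A\<^esub> c \<odot>\<^bsub>A\<^esub> x"
      using c y by (simp add: a_minus_def smult_r_distr smult_r_minus)
    ultimately show ?thesis using proj_eq_iff c y by simp
  qed
  have "x \<in> proj x" using c by (simp add: proj_def a_rcos_self)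
  have "c \<odot>\<^bsub>Q\<^esub> proj x = (\<Union>y\<in>proj x. proj (c \<odot>\<^bsub>A\<^esub> y))" by (simp add: quot_algebra_def proj_def)
  also have "\<dots> = (\<Union>y\<in>proj x. proj (c \<odot>\<^bsub>A\<^esub> x))" by (rule SUP_cong[OF refl *])
  also have "\<dots> = proj (c \<odot>\<^bsub>A\<^esub> x)" using \<open>x \<in> proj x\<close> by blast
  finally show ?thesis .
qed

lemma quotient_field_algebra: "field_algebra F Q"
  by (rule field_algebra_image[OF field_algebra_axioms,
      where h = proj]) (use proj_simps proj_smult in auto)

end

section \<open>Powers of a subspace and the choice of the generating space\<close>

context field_algebra
begin

abbreviation "prods V n \<equiv> {foldr (mult A) us \<one>\<^bsub>A\<^esub> | us. length us = n \<and> set us \<subseteq> V}"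

lemma submoduleI:
  assumes "N \<subseteq> carrier A" "\<zero>\<^bsub>A\<^esub> \<in> N" "\<And>x y. x \<in> N \<Longrightarrow> y \<in> N \<Longrightarrow> x \<oplus>\<^bsub>A\<^esub> y \<in> N"
    "\<And>c x. c \<in> carrier F \<Longrightarrow> x \<in> N \<Longrightarrow> c \<odot>\<^bsub>A\<^esub> x \<in> N"
  shows "LinearCombinations.submodule F N A"
  by (rule LinearCombinations.submodule.intro) (use assms module_axioms in auto)

lemmas submoduleD = submodule.m_closed submodule.zero_closed submodule.smult_closed

lemma span_submodule: "X \<subseteq> carrier A \<Longrightarrow> LinearCombinations.submodule F (span X) A"
  by (rule span_is_submodule)

lemma span_carrier: "X \<subseteq> carrier A \<Longrightarrow> span X \<subseteq> carrier A"
  by (rule span_is_subset2)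

lemma submodule_subspace: "LinearCombinations.submodule F N A \<Longrightarrow> subspace F N A"
  using vectorspace_axioms by (simp add: subspace_def)

text \<open>Bilinear extension, one factor at a time: the elements with the desired property form a
  submodule, which contains the span as soon as it contains the generators.\<close>

lemma span_mult_mem:
  assumes X: "X \<subseteq> carrier A" "Y \<subseteq> carrier A" and N: "LinearCombinations.submodule F N A"
    and XY: "\<And>x y. x \<in> X \<Longrightarrow> y \<in> Y \<Longrightarrow> x \<otimes>\<^bsub>A\<^esub> y \<in> N" and ab: "a \<in> span X" "b \<in> span Y"
  shows "a \<otimes>\<^bsub>A\<^esub> b \<in> N"
proof -
  have 1: "x \<otimes>\<^bsub>A\<^esub> b \<in> N" if "x \<in> X" for x
  proof -
    have x: "x \<in> carrier A" using that X by auto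
    have "LinearCombinations.submodule F {b \<in> carrier A. x \<otimes>\<^bsub>A\<^esub> b \<in> N} A"
      by (rule submoduleI) (use x submoduleD[OF N] in \<open>auto simp: A.r_distr smult_mult_right\<close>)
    then have "span Y \<subseteq> {b \<in> carrier A. x \<otimes>\<^bsub>A\<^esub> b \<in> N}"
      by (intro span_is_subset) (use X XY that in auto)
    then show ?thesis using ab by auto
  qed
  have b: "b \<in> carrier A" using ab span_carrier[OF X(2)] by auto
  have "LinearCombinations.submodule F {a \<in> carrier A. a \<otimes>\<^bsub>A\<^esub> b \<in> N} A"
    by (rule submoduleI) (use b submoduleD[OF N] in \<open>auto simp: A.l_distr smult_mult_left\<close>)
  then have "span X \<subseteq> {a \<in> carrier A. a \<otimes>\<^bsub>A\<^esub> b \<in> N}"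
    by (intro span_is_subset) (use X 1 in auto)
  then show ?thesis using ab by auto
qed

lemma prod_closed: "set us \<subseteq> carrier A \<Longrightarrow> foldr (mult A) us \<one>\<^bsub>A\<^esub> \<in> carrier A"
  by (induction us) auto

lemma prods_carrier: "V \<subseteq> carrier A \<Longrightarrow> prods V n \<subseteq> carrier A"
  using prod_closed by blast

lemma prod_append:
  "set us \<subseteq> carrier A \<Longrightarrow> set ws \<subseteq> carrier A \<Longrightarrow>
    foldr (mult A) (us @ ws) \<one>\<^bsub>A\<^esub> = foldr (mult A) us \<one>\<^bsub>A\<^esub> \<otimes>\<^bsub>A\<^esub> foldr (mult A) ws \<one>\<^bsub>A\<^esub>"
proof (induction us)
  case Nil
  then show ?case using prod_closed[of ws] by simp
next
  case (Cons u us)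
  have c: "u \<in> carrier A" "set us \<subseteq> carrier A" using Cons.prems by auto
  have "foldr (mult A) ((u # us) @ ws) \<one>\<^bsub>A\<^esub> = u \<otimes>\<^bsub>A\<^esub> foldr (mult A) (us @ ws) \<one>\<^bsub>A\<^esub>"
    by (simp only: append_Cons foldr.simps comp_def)
  also have "\<dots> = u \<otimes>\<^bsub>A\<^esub> (foldr (mult A) us \<one>\<^bsub>A\<^esub> \<otimes>\<^bsub>A\<^esub> foldr (mult A) ws \<one>\<^bsub>A\<^esub>)"
    using Cons.IH[OF c(2) Cons.prems(2)] by (simp only:)
  finally show ?case using c prod_closed[OF c(2)] prod_closed[OF Cons.prems(2)]
      by (simp only: foldr.simps comp_def A.m_assoc)
qed

lemma space_power_submodule: "V \<subseteq> carrier A \<Longrightarrow> LinearCombinations.submodule F (space_power F A V n) A"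
  unfolding space_power_def by (rule span_submodule[OF prods_carrier])

lemma space_power_mult:
  assumes V: "V \<subseteq> carrier A" and "a \<in> space_power F A V m" "b \<in> space_power F A V n"
  shows "a \<otimes>\<^bsub>A\<^esub> b \<in> space_power F A V (m + n)"
proof (rule span_mult_mem[of "prods V m" "prods V n"])
  fix x y assume "x \<in> prods V m" "y \<in> prods V n"
  then obtain us ws where "length us = m" "set us \<subseteq> V" "length ws = n" "set ws \<subseteq> V"
    "x = foldr (mult A) us \<one>\<^bsub>A\<^esub>" "y = foldr (mult A) ws \<one>\<^bsub>A\<^esub>" by blast
  then have "x \<otimes>\<^bsub>A\<^esub> y \<in> prods V (m + n)"
    using V prod_append[of us ws] by (intro CollectI exI[of _ "us @ ws"]) (auto simp del: foldr_append)
  then show "x \<otimes>\<^bsub>A\<^esub> y \<in> space_power F A V (m + n)"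
    unfolding space_power_def using in_own_span[OF prods_carrier[OF V]] by blast
qed (use assms prods_carrier[OF V] space_power_submodule in \<open>auto simp: space_power_def\<close>)

lemma space_power_span_subset:
  assumes X: "X \<subseteq> carrier A" and Y: "Y \<subseteq> carrier A" "X \<subseteq> space_power F A Y s"
  shows "space_power F A (span X) n \<subseteq> space_power F A Y (s * n)"
proof -
  have sX: "span X \<subseteq> space_power F A Y s"
    using space_power_submodule[OF Y(1)] Y(2) by (intro span_is_subset)
  have one: "\<one>\<^bsub>A\<^esub> \<in> space_power F A Y 0"
    unfolding space_power_def using in_own_span[of "prods Y 0"] by auto
  have "foldr (mult A) us \<one>\<^bsub>A\<^esub> \<in> space_power F A Y (s * length us)" if "set us \<subseteq> span X" for us
    using that
  proof (induction us)
    case Nil then show ?case using one by simp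
  next
    case (Cons v us)
    then have "v \<otimes>\<^bsub>A\<^esub> foldr (mult A) us \<one>\<^bsub>A\<^esub> \<in> space_power F A Y (s + s * length us)"
      using sX by (intro space_power_mult[OF Y(1)]) auto
    then show ?case by simp
  qed
  then show ?thesis
    unfolding space_power_def[of F A "span X" n]
    by (intro span_is_subset space_power_submodule[OF Y(1)]) auto
qed

text \<open>Products are padded with copies of the unit.\<close>

lemma space_power_mono:
  assumes V: "V \<subseteq> carrier A" "\<one>\<^bsub>A\<^esub> \<in> V" and "m \<le> n"
  shows "space_power F A V m \<subseteq> space_power F A V n"
proof -
  have "prods V m \<subseteq> prods V n"
  proof
    fix x assume "x \<in> prods V m"
    then obtain us where us: "length us = m" "set us \<subseteq> V" "x = foldr (mult A) us \<one>\<^bsub>A\<^esub>" by blast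
    have "foldr (mult A) (replicate k \<one>\<^bsub>A\<^esub>) \<one>\<^bsub>A\<^esub> = \<one>\<^bsub>A\<^esub>" for k by (induction k) auto
    then have "x = foldr (mult A) (us @ replicate (n - m) \<one>\<^bsub>A\<^esub>) \<one>\<^bsub>A\<^esub>" using us by simp
    moreover have "length (us @ replicate (n - m) \<one>\<^bsub>A\<^esub>) = n" "set (us @ replicate (n - m) \<one>\<^bsub>A\<^esub>) \<subseteq> V"
      using us assms by auto
    ultimately show "x \<in> prods V n" by blast
  qed
  then show ?thesis unfolding space_power_def by (rule span_is_monotone)
qed

lemma subset_space_power_1: "V \<subseteq> carrier A \<Longrightarrow> V \<subseteq> space_power F A V 1"
proof
  fix v assume V: "V \<subseteq> carrier A" "v \<in> V"
  then have "v \<in> prods V 1" by (intro CollectI exI[of _ "[v]"]) auto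
  then show "v \<in> space_power F A V 1" unfolding space_power_def
      using in_own_span[OF prods_carrier[OF V(1)]] by blast
qed

text \<open>The powers form an increasing chain and multiply into each other, so their union is a
  subalgebra containing \<open>V\<close>.\<close>

lemma generated_eq_Union_powers:
  assumes V: "V \<subseteq> carrier A" "\<one>\<^bsub>A\<^esub> \<in> V"
  shows "algebra_generated F A V \<subseteq> (\<Union>n. space_power F A V n)"
  unfolding algebra_generated_def
proof (rule Inter_lower, safe)
  let ?U = "\<Union>n. space_power F A V n"
  note sub = space_power_submodule[OF V(1)]
  have common: "\<exists>n. x \<in> space_power F A V n \<and> y \<in> space_power F A V n" if "x \<in> ?U" "y \<in> ?U" for x y
    using that space_power_mono[OF V] by (metis UN_E max.cobounded1 max.cobounded2 subsetD)
  show sm: "r \<odot>\<^bsub>A\<^esub> s \<in> ?U" if "r \<in> carrier F" "s \<in> space_power F A V n" for r s n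
    using submoduleD(3)[OF sub] that by blast
  show "subring ?U A"
  proof (rule A.subringI)
    show "?U \<subseteq> carrier A" using sub submodule.subset by blast
    show "\<one>\<^bsub>A\<^esub> \<in> ?U" using V subset_space_power_1 by blast
    show "\<ominus>\<^bsub>A\<^esub> h \<in> ?U" if h: "h \<in> ?U" for h
    proof -
      have "h \<in> carrier A" using h sub submodule.subset by blast
      then have "\<ominus>\<^bsub>A\<^esub> h = (\<ominus>\<^bsub>F\<^esub> \<one>\<^bsub>F\<^esub>) \<odot>\<^bsub>A\<^esub> h" by (simp add: smult_minus_1)
      then show ?thesis using sm h by auto
    qed
    show "x \<otimes>\<^bsub>A\<^esub> y \<in> ?U" if "x \<in> ?U" "y \<in> ?U" for x y
      using that space_power_mult[OF V(1)] by blast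
    show "x \<oplus>\<^bsub>A\<^esub> y \<in> ?U" if "x \<in> ?U" "y \<in> ?U" for x y
      using common[OF that] submoduleD(1)[OF sub] by blast
  qed
  show "v \<in> ?U" if "v \<in> V" for v using V subset_space_power_1 that by blast
qed

end

lemma (in field) left_inverse_exists: "a \<in> carrier R \<Longrightarrow> a \<noteq> \<zero> \<Longrightarrow> \<exists>i\<in>carrier R. i \<otimes> a = \<one>"
  using field_Units Units_l_inv Units_inv_closed by blast

context field_algebra
begin

abbreviation "sdim N \<equiv> vectorspace.dim F (A\<lparr>carrier := N\<rparr>)"

lemma sdim_span:
  assumes "finite B" "lin_indpt B" "B \<subseteq> carrier A" shows "sdim (span B) = card B"
proof -
  have sub: "LinearCombinations.submodule F (span B) A" using assms by (intro span_submodule)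
  interpret U: vectorspace F "A\<lparr>carrier := span B\<rparr>"
      by (rule subspace_is_vs[OF submodule_subspace[OF sub]])
  have B: "B \<subseteq> span B" by (rule in_own_span[OF assms(3)])
  have "U.basis B"
    unfolding U.basis_def using span_li_not_depend[OF B sub] assms B by simp
  then show ?thesis by (rule U.dim_basis[OF assms(1)])
qed

text \<open>An independent subset of \<open>N\<close> stays independent in the finite-dimensional
  span of \<open>B\<close>, so its size is bounded and a maximal one exists; it is a basis of
  \<open>N\<close>. Finite dimension of \<open>N\<close> is thus a result and not an
  assumption.\<close>

lemma sdim_mono:
  assumes N: "LinearCombinations.submodule F N A" and B: "finite B" "B \<subseteq> carrier A" "N \<subseteq> span B"
  shows "sdim N \<le> sdim (span B)" "vectorspace.fin_dim F (A\<lparr>carrier := N\<rparr>)"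
    "\<exists>C. finite C \<and> C \<subseteq> N \<and> span C = N"
    "X \<subseteq> N \<Longrightarrow> lin_indpt X \<Longrightarrow> finite X \<Longrightarrow> card X \<le> sdim N"
proof -
  have sub: "LinearCombinations.submodule F (span B) A" using B by (intro span_submodule)
  interpret W: vectorspace F "A\<lparr>carrier := span B\<rparr>"
      by (rule subspace_is_vs[OF submodule_subspace[OF sub]])
  interpret U: vectorspace F "A\<lparr>carrier := N\<rparr>" by (rule subspace_is_vs[OF submodule_subspace[OF N]])
  have Bs: "B \<subseteq> span B" by (rule in_own_span[OF B(2)])
  have Wfin: "W.fin_dim" unfolding W.fin_dim_def
    using span_li_not_depend[OF Bs sub] B Bs by auto
  have li_U: "card X \<le> W.dim \<and> finite X" if X: "X \<subseteq> N" "U.lin_indpt X" for X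
  proof -
    have "lin_indpt X" using span_li_not_depend(2)[OF X(1) N] X(2) by simp
    then have "W.lin_indpt X" using span_li_not_depend(2)[OF _ sub, of X] X(1) B(3) by auto
    moreover have "X \<subseteq> carrier (A\<lparr>carrier := span B\<rparr>)" using X(1) B(3) by simp
    ultimately show ?thesis using W.li_le_dim Wfin W.fin_dim_li_fin by blast
  qed
  have "\<exists>C. finite C \<and> maximal C (\<lambda>S. S \<subseteq> carrier (A\<lparr>carrier := N\<rparr>) \<and> U.lin_indpt S)"
  proof (rule maximal_exists[of _ "W.dim" "{}"])
    show "\<And>X. X \<subseteq> carrier (A\<lparr>carrier := N\<rparr>) \<and> U.lin_indpt X \<Longrightarrow> finite X \<and> card X \<le> W.dim" using li_U
        by auto
    show "{} \<subseteq> carrier (A\<lparr>carrier := N\<rparr>) \<and> U.lin_indpt {}" by (simp add: U.lin_dep_def)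
  qed
  then obtain C where C: "finite C" "maximal C (\<lambda>S. S \<subseteq> carrier (A\<lparr>carrier := N\<rparr>) \<and> U.lin_indpt S)"
      by blast
  then have Cb: "U.basis C" by (intro U.max_li_is_basis)
  then have C': "C \<subseteq> N" "U.lin_indpt C" "U.span C = N" by (auto simp: U.basis_def)
  then show "\<exists>C. finite C \<and> C \<subseteq> N \<and> span C = N" using C(1) span_li_not_depend(1)[OF C'(1) N] by auto
  show Ufin: "U.fin_dim" unfolding U.fin_dim_def using C(1) C' by auto
  have "sdim N = card C" by (rule U.dim_basis[OF C(1) Cb])
  then show "sdim N \<le> sdim (span B)" using li_U[OF C'(1,2)] by simp
  show "card X \<le> sdim N" if "X \<subseteq> N" "lin_indpt X" "finite X"
    using U.li_le_dim[OF Ufin, of X] that span_li_not_depend(2)[OF that(1) N] by auto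
qed

lemma generating_space_finite:
  assumes "generating_space F A V"
  shows "\<exists>B. finite B \<and> B \<subseteq> V \<and> span B = V \<and> V \<subseteq> carrier A"
proof -
  have sub: "LinearCombinations.submodule F V A" and fd: "vectorspace.fin_dim F (A\<lparr>carrier := V\<rparr>)"
    using assms by (auto simp: generating_space_def subspace_def)
  interpret U: vectorspace F "A\<lparr>carrier := V\<rparr>" by (rule subspace_is_vs[OF submodule_subspace[OF sub]])
  obtain B where B: "finite B" "B \<subseteq> V" "U.span B = V" using fd unfolding U.fin_dim_def by auto
  then show ?thesis using span_li_not_depend(1)[OF B(2) sub] submodule.subset[OF sub] by auto
qed

lemma finite_prods: "finite B \<Longrightarrow> finite (prods B n)"
proof -
  assume "finite B"
  then have "finite {us. set us \<subseteq> B \<and> length us = n}" by (rule finite_lists_length_eq)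
  then have "finite ((\<lambda>us. foldr (mult A) us \<one>\<^bsub>A\<^esub>) ` {us. set us \<subseteq> B \<and> length us = n})" by simp
  then show ?thesis by (rule rev_finite_subset) auto
qed

lemma space_power_span_eq:
  assumes "B \<subseteq> carrier A" shows "space_power F A (span B) n = space_power F A B n"
proof
  show "space_power F A (span B) n \<subseteq> space_power F A B n"
    using space_power_span_subset[OF assms assms, of 1 n] subset_space_power_1[OF assms] by simp
  show "space_power F A B n \<subseteq> space_power F A (span B) n"
    unfolding space_power_def using in_own_span[OF assms] by (intro span_is_monotone) blast
qed

text \<open>A finite spanning set of \<open>V\<close> lies in a single power of \<open>W\<close>,
  say the power s. Then the n-th power of \<open>V\<close> lies in the power s n of
  \<open>W\<close>, and rescaling the argument does not change the exponent.\<close>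

lemma growth_exponent_le:
  assumes one: "\<one>\<^bsub>A\<^esub> \<noteq> \<zero>\<^bsub>A\<^esub>" and V: "generating_space F A V" and W: "generating_space F A W"
  shows "growth_exponent F A V \<le> growth_exponent F A W"
proof -
  obtain B where B: "finite B" "B \<subseteq> V" "span B = V" "V \<subseteq> carrier A" using generating_space_finite[OF V]
      by blast
  obtain C where C: "finite C" "C \<subseteq> W" "span C = W" "W \<subseteq> carrier A" using generating_space_finite[OF W]
      by blast
  have cB: "B \<subseteq> carrier A" "C \<subseteq> carrier A" using B C by auto
  have oneW: "\<one>\<^bsub>A\<^esub> \<in> W" and gW: "algebra_generated F A W = carrier A" using W
      by (auto simp: generating_space_def)
  have oneV: "\<one>\<^bsub>A\<^esub> \<in> V" using V by (auto simp: generating_space_def)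
  have "\<forall>b\<in>B. \<exists>n. b \<in> space_power F A W n"
    using generated_eq_Union_powers[OF C(4) oneW] gW cB by blast
  then obtain n where n: "\<And>b. b \<in> B \<Longrightarrow> b \<in> space_power F A W (n b)" by metis
  \<comment> \<open>One exponent that works for all elements of \<open>B\<close>; the successor
    makes it positive.\<close>
  define s where "s = Suc (sum n B)"
  have "b \<in> space_power F A W s" if "b \<in> B" for b
  proof -
    have "n b \<le> s" unfolding s_def using member_le_sum[of b B n] that B(1) by simp
    then show ?thesis using space_power_mono[OF C(4) oneW] n[OF that] by blast
  qed
  then have Bs: "B \<subseteq> space_power F A C s" using space_power_span_eq[OF cB(2)] C(3) by auto
  have le: "sdim (space_power F A V n) \<le> sdim (space_power F A W (s * n))" for n
  proof -
    have "space_power F A V n \<subseteq> space_power F A C (s * n)"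
      using space_power_span_subset[OF cB Bs] B(3) by simp
    then have "sdim (space_power F A V n) \<le> sdim (space_power F A C (s * n))"
      using sdim_mono(1)[OF space_power_submodule[OF B(4)] finite_prods[OF C(1)] prods_carrier[OF cB(2)], of n "s * n"]
      by (simp add: space_power_def)
    then show ?thesis using space_power_span_eq[OF cB(2)] C(3) by simp
  qed
  \<comment> \<open>The nonzero unit lies in every power, so logarithms are taken only of numbers
    that are at least 1.\<close>
  have pos: "1 \<le> sdim (space_power F A V n)" for n
  proof -
    have "lin_indpt {\<one>\<^bsub>A\<^esub>}"
    proof (rule finite_lin_indpt2)
      fix a assume a: "a \<in> {\<one>\<^bsub>A\<^esub>} \<rightarrow> carrier F" "lincomb a {\<one>\<^bsub>A\<^esub>} = \<zero>\<^bsub>A\<^esub>"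
      then have e: "a \<one>\<^bsub>A\<^esub> \<odot>\<^bsub>A\<^esub> \<one>\<^bsub>A\<^esub> = \<zero>\<^bsub>A\<^esub>" by (simp add: lincomb_def)
      have "a \<one>\<^bsub>A\<^esub> = \<zero>\<^bsub>F\<^esub>"
      proof (rule ccontr)
        assume n0: "a \<one>\<^bsub>A\<^esub> \<noteq> \<zero>\<^bsub>F\<^esub>"
        have c: "a \<one>\<^bsub>A\<^esub> \<in> carrier F" using a by auto
        obtain i where i: "i \<in> carrier F" "i \<otimes>\<^bsub>F\<^esub> a \<one>\<^bsub>A\<^esub> = \<one>\<^bsub>F\<^esub>"
          using left_inverse_exists[OF c n0] by blast
        have "\<one>\<^bsub>A\<^esub> = (i \<otimes>\<^bsub>F\<^esub> a \<one>\<^bsub>A\<^esub>) \<odot>\<^bsub>A\<^esub> \<one>\<^bsub>A\<^esub>" unfolding i(2) by simp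
        also have "\<dots> = i \<odot>\<^bsub>A\<^esub> (a \<one>\<^bsub>A\<^esub> \<odot>\<^bsub>A\<^esub> \<one>\<^bsub>A\<^esub>)" using i(1) c by (intro smult_assoc1) auto
        also have "\<dots> = \<zero>\<^bsub>A\<^esub>" using i e by simp
        finally show False using one by simp
      qed
      then show "\<forall>v\<in>{\<one>\<^bsub>A\<^esub>}. a v = \<zero>\<^bsub>F\<^esub>" by simp
    qed auto
    moreover have "\<one>\<^bsub>A\<^esub> \<in> space_power F A V n"
    proof -
      have "foldr (mult A) (replicate k \<one>\<^bsub>A\<^esub>) \<one>\<^bsub>A\<^esub> = \<one>\<^bsub>A\<^esub>" for k by (induction k) auto
      then have "\<one>\<^bsub>A\<^esub> \<in> prods V n" using oneV by (intro CollectI exI[of _ "replicate n \<one>\<^bsub>A\<^esub>"]) auto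
      then show ?thesis unfolding space_power_def using in_own_span[OF prods_carrier[OF B(4)]] by blast
    qed
    moreover have "space_power F A V n = span (prods B n)"
      using space_power_span_eq[OF cB(1)] B(3) by (simp add: space_power_def)
    ultimately show ?thesis
      using sdim_mono(4)[OF space_power_submodule[OF B(4)] finite_prods[OF B(1)] prods_carrier[OF cB(1)], of n n "{\<one>\<^bsub>A\<^esub>}"] by simp
  qed
  show ?thesis unfolding growth_exponent_def
    by (rule limsup_ln_rescale[of s]) (use le pos in \<open>auto simp: s_def\<close>)
qed

lemma GKdim_eq:
  assumes "\<one>\<^bsub>A\<^esub> \<noteq> \<zero>\<^bsub>A\<^esub>" "generating_space F A V"
  shows "GKdim F A = growth_exponent F A V"
proof -
  have "generating_space F A (SOME V. generating_space F A V)"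
      by (rule someI[of "generating_space F A", OF assms(2)])
  then show ?thesis unfolding GKdim_def using growth_exponent_le[OF assms(1)] assms(2) by (intro antisym)
qed

end

text \<open>
  \<open>M\<close> is the monoid of monomials, \<open>e\<close> sends a monomial to its class, and \<open>S\<close> is the set of the
  monomials that do not vanish. Linear independence is expressed through coefficient functionals \<open>\<kappa>\<close>.
\<close>
locale contracted_monoid_algebra = field_algebra F A + M: monoid M
  for F :: "('f, 'r) ring_scheme" and A :: "('f, 'a, 's) module_scheme"
      and M :: "('m, 't) monoid_scheme" +
  fixes S :: "'m set" and e :: "'m \<Rightarrow> 'a" and \<kappa> :: "'m \<Rightarrow> 'a \<Rightarrow> 'f"
  assumes S_sub: "S \<subseteq> carrier M" and one_S: "\<one>\<^bsub>M\<^esub> \<in> S"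
    and e_closed: "x \<in> carrier M \<Longrightarrow> e x \<in> carrier A"
    and e_mult: "x \<in> carrier M \<Longrightarrow> y \<in> carrier M \<Longrightarrow> e x \<otimes>\<^bsub>A\<^esub> e y = e (x \<otimes>\<^bsub>M\<^esub> y)"
    and e_one: "e \<one>\<^bsub>M\<^esub> = \<one>\<^bsub>A\<^esub>"
    and e_zero: "x \<in> carrier M \<Longrightarrow> x \<notin> S \<Longrightarrow> e x = \<zero>\<^bsub>A\<^esub>"
    and span_e: "span (e ` carrier M) = carrier A"
    and \<kappa>_closed: "x \<in> S \<Longrightarrow> a \<in> carrier A \<Longrightarrow> \<kappa> x a \<in> carrier F"
    and \<kappa>_add: "x \<in> S \<Longrightarrow> a \<in> carrier A \<Longrightarrow> b \<in> carrier A \<Longrightarrow> \<kappa> x (a \<oplus>\<^bsub>A\<^esub> b) = \<kappa> x a \<oplus>\<^bsub>F\<^esub> \<kappa> x b"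
    and \<kappa>_smult: "x \<in> S \<Longrightarrow> c \<in> carrier F \<Longrightarrow> a \<in> carrier A \<Longrightarrow> \<kappa> x (c \<odot>\<^bsub>A\<^esub> a) = c \<otimes>\<^bsub>F\<^esub> \<kappa> x a"
    and \<kappa>_e: "x \<in> S \<Longrightarrow> y \<in> S \<Longrightarrow> \<kappa> x (e y) = (if x = y then \<one>\<^bsub>F\<^esub> else \<zero>\<^bsub>F\<^esub>)"
begin

lemma \<kappa>_zero: "x \<in> S \<Longrightarrow> \<kappa> x \<zero>\<^bsub>A\<^esub> = \<zero>\<^bsub>F\<^esub>"
  using \<kappa>_smult[of x "\<zero>\<^bsub>F\<^esub>" "\<zero>\<^bsub>A\<^esub>"] \<kappa>_closed[of x "\<zero>\<^bsub>A\<^esub>"] by simp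

lemma inj_e: "inj_on e S"
proof (rule inj_onI)
  fix x y assume "x \<in> S" "y \<in> S" "e x = e y"
  then show "x = y" using \<kappa>_e[of x x] \<kappa>_e[of x y] by (auto split: if_splits)
qed

lemma \<kappa>_lincomb:
  assumes "finite X" "X \<subseteq> S" "a \<in> e ` X \<rightarrow> carrier F" "x \<in> S"
  shows "\<kappa> x (lincomb a (e ` X)) = (if x \<in> X then a (e x) else \<zero>\<^bsub>F\<^esub>)"
  using assms
proof (induction X)
  case empty
  then show ?case using \<kappa>_zero by (simp add: lincomb_def)
next
  case (insert y X)
  have y: "y \<in> S" "e y \<in> carrier A" "e y \<notin> e ` X" "e ` X \<subseteq> carrier A"
    using insert S_sub e_closed inj_e by (auto dest: inj_onD)
  have a: "a (e y) \<in> carrier F" "a \<in> e ` X \<rightarrow> carrier F" using insert by auto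
  have l: "lincomb a (e ` X) \<in> carrier A" using a y by (intro lincomb_closed) auto
  have "lincomb a (e ` insert y X) = a (e y) \<odot>\<^bsub>A\<^esub> e y \<oplus>\<^bsub>A\<^esub> lincomb a (e ` X)"
    unfolding lincomb_def image_insert
    by (rule finsum_insert) (use insert.hyps y a in \<open>auto simp: Pi_def\<close>)
  then have "\<kappa> x (lincomb a (e ` insert y X)) = a (e y) \<otimes>\<^bsub>F\<^esub> \<kappa> x (e y) \<oplus>\<^bsub>F\<^esub> \<kappa> x (lincomb a (e ` X))"
    using insert.prems y a l by (simp add: \<kappa>_add \<kappa>_smult)
  moreover have "x \<in> X \<Longrightarrow> a (e x) \<in> carrier F" using insert.prems by auto
  then have "a (e y) \<otimes>\<^bsub>F\<^esub> \<kappa> x (e y) \<oplus>\<^bsub>F\<^esub> \<kappa> x (lincomb a (e ` X)) = (if x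
      \<in> insert y X then a (e x) else \<zero>\<^bsub>F\<^esub>)"
    using insert.IH insert.prems insert.hyps a y by (auto simp: \<kappa>_e)
  ultimately show ?case by simp
qed

lemma lin_indpt_e: "finite X \<Longrightarrow> X \<subseteq> S \<Longrightarrow> lin_indpt (e ` X)"
proof (rule finite_lin_indpt2)
  fix a assume X: "finite X" "X \<subseteq> S" and a: "a \<in> e ` X \<rightarrow> carrier F" "lincomb a (e ` X) = \<zero>\<^bsub>A\<^esub>"
  show "\<forall>v\<in>e ` X. a v = \<zero>\<^bsub>F\<^esub>"
  proof safe
    fix x assume "x \<in> X"
    then have "x \<in> S" "\<kappa> x (lincomb a (e ` X)) = a (e x)" using \<kappa>_lincomb[OF X a(1)] X by auto
    then show "a (e x) = \<zero>\<^bsub>F\<^esub>" using a(2) \<kappa>_zero by simp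
  qed
qed (use S_sub e_closed in auto)

lemma one_not_zero: "\<one>\<^bsub>A\<^esub> \<noteq> \<zero>\<^bsub>A\<^esub>"
  using \<kappa>_e[OF one_S one_S] \<kappa>_zero[OF one_S] e_one by auto

lemma carrier_eq_span_S: "carrier A = span (e ` S)"
proof
  have cS: "e ` S \<subseteq> carrier A" using S_sub e_closed by auto
  have "e ` carrier M \<subseteq> span (e ` S)"
  proof safe
    fix x assume "x \<in> carrier M"
    then show "e x \<in> span (e ` S)"
      using e_zero in_own_span[OF cS] submoduleD(2)[OF span_submodule[OF cS]] by (cases "x \<in> S") auto
  qed
  then show "carrier A \<subseteq> span (e ` S)"
    using span_is_subset[OF _ span_submodule[OF cS]] span_e by blast
  show "span (e ` S) \<subseteq> carrier A" by (rule span_carrier[OF cS])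
qed

lemma decomposition:
  assumes "a \<in> carrier A"
  shows "\<exists>X c. finite X \<and> X \<subseteq> S \<and> c \<in> e ` X \<rightarrow> carrier F \<and> a = lincomb c (e ` X)"
proof -
  obtain c Y where Y: "finite Y" "Y \<subseteq> e ` S" "c \<in> Y \<rightarrow> carrier F" "a = lincomb c Y"
    using assms unfolding carrier_eq_span_S span_def by blast
  then obtain X where "X \<subseteq> S" "finite X" "Y = e ` X" by (meson finite_subset_image)
  then show ?thesis using Y by blast
qed

definition mprod where "mprod ws = foldr (mult M) ws \<one>\<^bsub>M\<^esub>"

lemma mprod_closed: "set ws \<subseteq> carrier M \<Longrightarrow> mprod ws \<in> carrier M"
  unfolding mprod_def by (induction ws) auto

lemma foldr_e: "set ws \<subseteq> carrier M \<Longrightarrow> foldr (mult A) (map e ws) \<one>\<^bsub>A\<^esub> = e (mprod ws)"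
proof (induction ws)
  case (Cons w ws)
  then show ?case using mprod_closed[of ws] by (simp add: e_mult mprod_def)
qed (simp add: e_one mprod_def)

lemma prods_e:
  assumes "G \<subseteq> carrier M"
  shows "prods (e ` G) n = e ` {mprod ws | ws. length ws = n \<and> set ws \<subseteq> G}"
proof safe
  fix us assume "n = length us" "set us \<subseteq> e ` G"
  then have us: "e (inv_into G e u) = u \<and> inv_into G e u \<in> G" if "u \<in> set us" for u
    using that f_inv_into_f[of u e G] inv_into_into[of u e G] by blast
  define ws where "ws = map (inv_into G e) us"
  have "map e ws = us" unfolding ws_def by (simp add: us comp_def map_idI)
  moreover have "set ws \<subseteq> G" using us by (auto simp: ws_def)
  ultimately have "us = map e ws" "set ws \<subseteq> G" by simp_all
  then show "foldr (mult A) us \<one>\<^bsub>A\<^esub> \<in> e ` {mprod ws | ws. length ws = length us \<and> set ws \<subseteq> G}"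
    using foldr_e[of ws] assms by auto
next
  fix ws assume "set ws \<subseteq> G"
  then show "\<exists>us. e (mprod ws) = foldr (mult A) us \<one>\<^bsub>A\<^esub> \<and> length us = length ws \<and> set us \<subseteq> e ` G"
    using foldr_e[of ws] assms by (intro exI[of _ "map e ws"]) auto
qed

text \<open>Products of generators that leave \<open>S\<close> vanish and contribute nothing to the
  span. This reduces the dimension of a power to a count of monomials.\<close>

lemma space_power_e:
  assumes "G \<subseteq> carrier M" and n: "{mprod ws | ws. length ws = n \<and> set ws \<subseteq> G} \<inter> S = X"
  shows "space_power F A (span (e ` G)) n = span (e ` X)"
proof -
  let ?P = "{mprod ws | ws. length ws = n \<and> set ws \<subseteq> G}"
  have P: "?P \<subseteq> carrier M" using assms(1) mprod_closed by blast
  have cP: "e ` ?P \<subseteq> carrier A" "e ` X \<subseteq> carrier A" "e ` G \<subseteq> carrier A" using P e_closed n assms(1)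
      by auto
  have "space_power F A (span (e ` G)) n = span (prods (e ` G) n)"
    unfolding space_power_span_eq[OF cP(3)] by (simp add: space_power_def)
  also have "\<dots> = span (e ` ?P)" unfolding prods_e[OF assms(1)] ..
  also have "\<dots> = span (e ` X)"
  proof
    show "span (e ` X) \<subseteq> span (e ` ?P)" using n by (intro span_is_monotone) auto
    have "e ` ?P \<subseteq> span (e ` X)"
    proof (rule image_subsetI)
      fix x assume x: "x \<in> ?P"
      show "e x \<in> span (e ` X)"
      proof (cases "x \<in> S")
        case True
        then show ?thesis using x n in_own_span[OF cP(2)] by blast
      next
        case False
        then show ?thesis using x P e_zero submoduleD(2)[OF span_submodule[OF cP(2)]] by auto
      qed
    qed
    then show "span (e ` ?P) \<subseteq> span (e ` X)" by (rule span_is_subset[OF _ span_submodule[OF cP(2)]])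
  qed
  finally show ?thesis .
qed

lemma generated_by_e:
  assumes G: "G \<subseteq> carrier M" and gen: "\<And>x. x \<in> S \<Longrightarrow> \<exists>ws. set ws \<subseteq> G \<and> x = mprod ws"
      and V: "e ` G \<subseteq> V" "V \<subseteq> carrier A"
  shows "algebra_generated F A V = carrier A"
proof
  show "algebra_generated F A V \<subseteq> carrier A"
    unfolding algebra_generated_def
    by (rule Inter_lower) (use A.carrier_is_subring V in auto)
  show "carrier A \<subseteq> algebra_generated F A V"
    unfolding algebra_generated_def
  proof (rule Inter_greatest, elim CollectE conjE)
    fix R assume R: "subring R A" "\<forall>r\<in>carrier F. \<forall>s\<in>R. r \<odot>\<^bsub>A\<^esub> s \<in> R" "V \<subseteq> R"
    have eR: "e (mprod ws) \<in> R" if "set ws \<subseteq> G" for ws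
      using that
    proof (induction ws)
      case Nil
      then show ?case using subringE(3)[OF R(1)] by (simp add: mprod_def e_one)
    next
      case (Cons w ws)
      then have "e w \<in> R" "e (mprod ws) \<in> R" using R(3) V by auto
      then have "e w \<otimes>\<^bsub>A\<^esub> e (mprod ws) \<in> R" by (rule subringE(6)[OF R(1)])
      moreover have "w \<in> carrier M" "mprod ws \<in> carrier M" using Cons.prems G mprod_closed[of ws] by auto
      ultimately have "e (w \<otimes>\<^bsub>M\<^esub> mprod ws) \<in> R" by (simp only: e_mult)
      then show ?case by (simp add: mprod_def)
    qed
    have "LinearCombinations.submodule F R A"
      by (rule submoduleI) (use subringE[OF R(1)] R(2) in auto)
    then have "span (e ` S) \<subseteq> R" using gen eR by (intro span_is_subset) auto
    then show "carrier A \<subseteq> R" using carrier_eq_span_S by simp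
  qed
qed

lemma finitely_generated_e:
  assumes "finite G" "G \<subseteq> carrier M" "\<And>x. x \<in> S \<Longrightarrow> \<exists>ws. set ws \<subseteq> G \<and> x = mprod ws"
  shows "finitely_generated_algebra F A"
  unfolding finitely_generated_algebra_def
proof (intro exI conjI)
  show "finite (e ` G)" using assms(1) by simp
  show c: "e ` G \<subseteq> carrier A" using assms(2) e_closed by auto
  show "algebra_generated F A (e ` G) = carrier A" by (rule generated_by_e[OF assms(2,3) order_refl c])
qed

text \<open>As \<open>G\<close> contains the unit, the span of its image is an admissible generating
  space; the dimensions of its powers are numbers of nonvanishing monomials, since these are
  independent.\<close>

lemma GKdim_e:
  assumes G: "finite G" "G \<subseteq> carrier M" "\<one>\<^bsub>M\<^esub> \<in> G" and gen: "\<And>x. x \<in> S \<Longrightarrow> \<exists>ws. set ws \<subseteq> G \<and> x = mprod ws"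
    and X: "\<And>n. {mprod ws | ws. length ws = n \<and> set ws \<subseteq> G} \<inter> S = X n"
  shows "GKdim F A = limsup (\<lambda>n. ereal (ln (real (card (X n))) / ln (real n)))"
proof -
  have cG: "e ` G \<subseteq> carrier A" using G e_closed by auto
  have V: "generating_space F A (span (e ` G))"
    unfolding generating_space_def
  proof (intro conjI)
    show "subspace F (span (e ` G)) A" by (rule submodule_subspace[OF span_submodule[OF cG]])
    show "vectorspace.fin_dim F (A\<lparr>carrier := span (e ` G)\<rparr>)"
      using sdim_mono(2)[OF span_submodule[OF cG], of "e ` G"] G cG by auto
    show "\<one>\<^bsub>A\<^esub> \<in> span (e ` G)" using in_own_span[OF cG] G e_one by force
    show "algebra_generated F A (span (e ` G)) = carrier A"
      by (rule generated_by_e[OF G(2) gen in_own_span[OF cG] span_carrier[OF cG]])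
  qed
  have "sdim (space_power F A (span (e ` G)) n) = card (X n)" for n
  proof -
    have "finite {ws. set ws \<subseteq> G \<and> length ws = n}" using G(1) by (rule finite_lists_length_eq)
    then have "finite (mprod ` {ws. set ws \<subseteq> G \<and> length ws = n})" by simp
    then have fX: "finite (X n)" unfolding X[symmetric] by (rule rev_finite_subset) auto
    have XS: "X n \<subseteq> S" using X by blast
    have "sdim (span (e ` X n)) = card (e ` X n)"
      using fX XS S_sub e_closed by (intro sdim_span lin_indpt_e) auto
    also have "\<dots> = card (X n)" using inj_e XS by (intro card_image) (blast intro: inj_on_subset)
    finally show ?thesis using space_power_e[OF G(2) X] by simp
  qed
  then show ?thesis unfolding GKdim_eq[OF one_not_zero V] growth_exponent_def by simp
qed

end

section \<open>Primitivity\<close>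

definition left_ideal :: "('a, 'r) ring_scheme \<Rightarrow> 'a set \<Rightarrow> bool" where
  "left_ideal A L \<longleftrightarrow> additive_subgroup L A \<and> (\<forall>a\<in>carrier A. \<forall>x\<in>L. a \<otimes>\<^bsub>A\<^esub> x \<in> L)"

text \<open>Cosets are sets of ring elements, so this module lives on the type that
  \<open>primitive_ring\<close> asks for.\<close>

definition left_quotient :: "('a, 'r) ring_scheme \<Rightarrow> 'a set \<Rightarrow> ('a, 'a set) module" where
  "left_quotient A L = \<lparr>carrier = a_rcosets\<^bsub>A\<^esub> L, mult = (\<lambda>x y. undefined), one = undefined, zero
      = L, add = set_add A,
    smult = (\<lambda>a C. \<Union>x\<in>C. L +>\<^bsub>A\<^esub> (a \<otimes>\<^bsub>A\<^esub> x))\<rparr>"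

context ring
begin

lemma left_idealI:
  assumes "L \<subseteq> carrier R" "\<zero> \<in> L" "\<And>x y. x \<in> L \<Longrightarrow> y \<in> L \<Longrightarrow> x \<oplus> y \<in> L"
    "\<And>a x. a \<in> carrier R \<Longrightarrow> x \<in> L \<Longrightarrow> a \<otimes> x \<in> L"
  shows "left_ideal R L"
proof -
  have "\<ominus> x \<in> L" if "x \<in> L" for x
  proof -
    have "(\<ominus> \<one>) \<otimes> x \<in> L" using that assms(4) by simp
    then show ?thesis using that assms(1) by (simp add: l_minus subsetD)
  qed
  then have "subgroup L (add_monoid R)"
    using assms by (intro add.subgroupI) (auto simp: a_inv_def)
  then show ?thesis using assms(4) by (simp add: left_ideal_def additive_subgroupI)
qed

lemma left_idealD:
  assumes "left_ideal R L"
  shows "L \<subseteq> carrier R" "\<zero> \<in> L" "x \<in> L \<Longrightarrow> y \<in> L \<Longrightarrow> x \<oplus> y \<in> L"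
    "a \<in> carrier R \<Longrightarrow> x \<in> L \<Longrightarrow> a \<otimes> x \<in> L"
proof -
  interpret additive_subgroup L R using assms by (simp add: left_ideal_def)
  show "L \<subseteq> carrier R" by (rule a_subset)
  show "\<zero> \<in> L" by (rule zero_closed)
  show "x \<in> L \<Longrightarrow> y \<in> L \<Longrightarrow> x \<oplus> y \<in> L" by (rule a_closed)
  show "a \<in> carrier R \<Longrightarrow> x \<in> L \<Longrightarrow> a \<otimes> x \<in> L" using assms by (simp add: left_ideal_def)
qed

context
  fixes L assumes L: "left_ideal R L"
begin

lemma left_ideal_abelian_subgroup: "abelian_subgroup L R"
  using L by (intro abelian_subgroupI3) (auto simp: left_ideal_def abelian_group_axioms)

interpretation L: abelian_subgroup L R by (rule left_ideal_abelian_subgroup)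

lemma left_quotient_simps:
  "carrier (left_quotient R L) = (+>) L ` carrier R"
  "x \<in> carrier R \<Longrightarrow> y \<in> carrier R \<Longrightarrow> (L +> x) \<oplus>\<^bsub>left_quotient R L\<^esub> (L +> y) = L +> (x \<oplus> y)"
  "\<zero>\<^bsub>left_quotient R L\<^esub> = L +> \<zero>"
  using a_coset_add_zero[OF L.a_subset]
  by (auto simp: left_quotient_def A_RCOSETS_def' L.a_rcos_sum)

lemma left_quotient_eq_iff:
  "x \<in> carrier R \<Longrightarrow> y \<in> carrier R \<Longrightarrow> L +> x = L +> y \<longleftrightarrow> x \<ominus> y \<in> L"
  using L.a_rcos_module_minus[OF ring_axioms, of y x] L.a_repr_independence' L.a_rcos_self by metis

lemma left_quotient_eq_zero_iff: "x \<in> carrier R \<Longrightarrow> L +> x = \<zero>\<^bsub>left_quotient R L\<^esub> \<longleftrightarrow> x \<in> L"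
  unfolding left_quotient_simps(3) by (subst left_quotient_eq_iff) (auto simp: a_minus_def)

lemma left_quotient_smult:
  assumes "a \<in> carrier R" "x \<in> carrier R"
  shows "a \<odot>\<^bsub>left_quotient R L\<^esub> (L +> x) = L +> (a \<otimes> x)"
proof -
  have *: "L +> (a \<otimes> y) = L +> (a \<otimes> x)" if "y \<in> L +> x" for y
  proof -
    have y: "y \<in> carrier R" using that assms L.a_elemrcos_carrier by blast
    have "L +> y = L +> x" using that assms y by (metis L.a_repr_independence')
    then have "y \<ominus> x \<in> L" using left_quotient_eq_iff y assms by simp
    then have "a \<otimes> (y \<ominus> x) \<in> L" using L assms unfolding left_ideal_def by blast
    then show ?thesis using left_quotient_eq_iff y assms by (simp add: a_minus_def r_distr r_minus)
  qed
  have "a \<odot>\<^bsub>left_quotient R L\<^esub> (L +> x) = (\<Union>y\<in>L +> x. L +> (a \<otimes> y))" by (simp add: left_quotient_def)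
  also have "\<dots> = (\<Union>y\<in>L +> x. L +> (a \<otimes> x))" by (rule SUP_cong[OF refl *])
  also have "\<dots> = L +> (a \<otimes> x)" using L.a_rcos_self[OF assms(2)] by blast
  finally show ?thesis .
qed

lemma left_quotient_module: "left_module R (left_quotient R L)"
proof -
  have "abelian_group (left_quotient R L)"
  proof (rule abelian_groupI)
    fix x assume "x \<in> carrier (left_quotient R L)"
    then obtain a where a: "a \<in> carrier R" "x = L +> a" by (auto simp: left_quotient_simps)
    then have "(L +> (\<ominus> a)) \<oplus>\<^bsub>left_quotient R L\<^esub> x = \<zero>\<^bsub>left_quotient R L\<^esub>"
      by (simp add: left_quotient_simps l_neg)
    then show "\<exists>y\<in>carrier (left_quotient R L). y \<oplus>\<^bsub>left_quotient R L\<^esub> x = \<zero>\<^bsub>left_quotient R L\<^esub>"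
      using a by (auto simp: left_quotient_simps(1))
  qed (auto simp: left_quotient_simps a_ac)
  then show ?thesis
    unfolding left_module_def left_module_axioms_def
    by (auto simp: ring_axioms left_quotient_simps left_quotient_smult l_distr r_distr m_assoc)
qed

end

text \<open>A maximal left ideal above \<open>J\<close> contains no nonzero two-sided ideal, so its quotient is faithful.\<close>

theorem primitive_criterion:
  assumes J: "left_ideal R J" "\<one> \<notin> J"
    and comax: "\<And>I. ideal I R \<Longrightarrow> I \<noteq> {\<zero>} \<Longrightarrow> \<exists>a\<in>I. \<one> \<ominus> a \<in> J"
  shows "primitive_ring R"
proof -
  let ?P = "{L. left_ideal R L \<and> J \<subseteq> L \<and> \<one> \<notin> L}"
  note sub = left_idealD
  \<comment> \<open>Properness is expressed by the absence of the unit and therefore survives unions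
    of chains.\<close>
  have "\<exists>L\<in>?P. \<forall>X\<in>?P. L \<subseteq> X \<longrightarrow> X = L"
  proof (rule subset_Zorn_nonempty)
    show "?P \<noteq> {}" using J by blast
    fix C assume C: "C \<noteq> {}" "subset.chain ?P C"
    have CP: "left_ideal R L" "J \<subseteq> L" "\<one> \<notin> L" if "L \<in> C" for L using that C
        by (auto simp: subset_chain_def)
    have "left_ideal R (\<Union>C)"
    proof (rule left_idealI)
      show "\<Union>C \<subseteq> carrier R" using CP sub(1) by blast
      show "\<zero> \<in> \<Union>C" using C(1) CP sub(2) by blast
      fix x y assume "x \<in> \<Union>C" "y \<in> \<Union>C"
      then obtain X Y where X: "x \<in> X" "X \<in> C" "y \<in> Y" "Y \<in> C" by blast
      then have "X \<subseteq> Y \<or> Y \<subseteq> X" using C(2) by (auto simp: subset_chain_def)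
      then show "x \<oplus> y \<in> \<Union>C" using X CP sub(3) by blast
    next
      fix a x assume "a \<in> carrier R" "x \<in> \<Union>C"
      then show "a \<otimes> x \<in> \<Union>C" using CP sub(4) by blast
    qed
    then show "\<Union>C \<in> ?P" using C(1) CP by blast
  qed
  then obtain L where LP: "L \<in> ?P" "\<forall>X\<in>?P. L \<subseteq> X \<longrightarrow> X = L" by (rule bexE)
  then have L: "left_ideal R L" "J \<subseteq> L" "\<one> \<notin> L" by simp_all
  have max: "X = L" if "left_ideal R X" "L \<subseteq> X" "\<one> \<notin> X" for X
  proof -
    have "X \<in> ?P" using that L(2) by simp
    then show ?thesis using LP(2) that(2) by blast
  qed
  let ?M = "left_quotient R L"
  note simps = left_quotient_simps[OF L(1)] left_quotient_smult[OF L(1)] left_quotient_eq_zero_iff[OF L(1)]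
  interpret M: left_module R ?M by (rule left_quotient_module[OF L(1)])
  have "simple_left_module R ?M"
    unfolding simple_left_module_def
  proof (intro conjI allI impI)
    show "left_module R ?M" by (rule left_quotient_module[OF L(1)])
    have "L +> \<one> \<noteq> \<zero>\<^bsub>?M\<^esub>" using simps(5)[of \<one>] L(3) by simp
    then show "carrier ?M \<noteq> {\<zero>\<^bsub>?M\<^esub>}" using simps(1) by auto
    fix N assume N: "Module.submodule N R ?M"
    have N0: "N \<subseteq> carrier ?M" "\<zero>\<^bsub>?M\<^esub> \<in> N" "x \<in> N \<Longrightarrow> y \<in> N \<Longrightarrow> x \<oplus>\<^bsub>?M\<^esub> y \<in> N"
      "a \<in> carrier R \<Longrightarrow> x \<in> N \<Longrightarrow> a \<odot>\<^bsub>?M\<^esub> x \<in> N" for a x y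
      using N subgroup.subset[of N "add_monoid ?M"] subgroup.one_closed[of N "add_monoid ?M"]
        subgroup.m_closed[of N "add_monoid ?M"]
      by (auto simp: Module.submodule_def Module.submodule_axioms_def)
    \<comment> \<open>The preimage of \<open>N\<close> in the ring, a left ideal above
      \<open>L\<close>; by maximality it is \<open>L\<close> or contains the unit.\<close>
    let ?X = "{x \<in> carrier R. L +> x \<in> N}"
    have X: "left_ideal R ?X"
    proof (rule left_idealI)
      show "\<zero> \<in> ?X" using N0(2) simps(3) by simp
      show "x \<oplus> y \<in> ?X" if "x \<in> ?X" "y \<in> ?X" for x y
        using that N0(3)[of "L +> x" "L +> y"] simps(2)[of x y] by simp
      show "a \<otimes> x \<in> ?X" if "a \<in> carrier R" "x \<in> ?X" for a x
        using that N0(4)[of a "L +> x"] simps(4)[of a x] by simp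
    qed auto
    have LX: "L \<subseteq> ?X"
    proof
      fix x assume x: "x \<in> L"
      then have "x \<in> carrier R" using sub(1)[OF L(1)] by blast
      then show "x \<in> ?X" using x simps(5)[of x] N0(2) by simp
    qed
    show "N = {\<zero>\<^bsub>?M\<^esub>} \<or> N = carrier ?M"
    proof (cases "\<one> \<in> ?X")
      case True
      have "x \<in> ?X" if "x \<in> carrier R" for x using sub(4)[OF X that True] that by simp
      then have "carrier ?M \<subseteq> N" unfolding simps(1) by blast
      then show ?thesis using N0(1) by blast
    next
      case False
      then have XL: "?X = L" using max[OF X LX] by blast
      have "N \<subseteq> {\<zero>\<^bsub>?M\<^esub>}"
      proof
        fix n assume n: "n \<in> N"
        then obtain x where x: "x \<in> carrier R" "n = L +> x" using N0(1) simps(1) by blast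
        then have "x \<in> ?X" using n by simp
        then have "x \<in> L" using XL by blast
        then show "n \<in> {\<zero>\<^bsub>?M\<^esub>}" using x simps(5)[of x] by simp
      qed
      then show ?thesis using N0(2) by blast
    qed
  qed
  moreover have "faithful_left_module R ?M"
    unfolding faithful_left_module_def
  proof (intro conjI ballI impI)
    show "left_module R ?M" by (rule left_quotient_module[OF L(1)])
    fix a assume a: "a \<in> carrier R" "\<forall>x\<in>carrier ?M. a \<odot>\<^bsub>?M\<^esub> x = \<zero>\<^bsub>?M\<^esub>"
    \<comment> \<open>The annihilator of the module, a two-sided ideal contained in
      \<open>L\<close>. If it were nonzero, \<open>comax\<close> would give an element
      \<open>b\<close> of it with \<open>\<one> \<ominus> b \<in> J\<close>, and \<open>L\<close>
      would contain the unit.\<close>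
    let ?I = "{b \<in> carrier R. \<forall>x\<in>carrier R. b \<otimes> x \<in> L}"
    have aI: "a \<in> ?I"
    proof (intro CollectI conjI ballI a(1))
      fix x assume x: "x \<in> carrier R"
      then have "a \<odot>\<^bsub>?M\<^esub> (L +> x) = \<zero>\<^bsub>?M\<^esub>" using a(2) simps(1) by blast
      then show "a \<otimes> x \<in> L" using simps(4)[OF a(1) x] simps(5)[of "a \<otimes> x"] a(1) x by simp
    qed
    have I: "ideal ?I R"
    proof (rule idealI[OF ring_axioms])
      have "left_ideal R ?I"
      proof (rule left_idealI)
        show "\<zero> \<in> ?I" using sub(2)[OF L(1)] by simp
        show "x \<oplus> y \<in> ?I" if "x \<in> ?I" "y \<in> ?I" for x y
          using that sub(3)[OF L(1)] by (simp add: l_distr)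
        show "c \<otimes> x \<in> ?I" if "c \<in> carrier R" "x \<in> ?I" for c x
          using that sub(4)[OF L(1)] by (simp add: m_assoc)
      qed auto
      then show "subgroup ?I (add_monoid R)" unfolding left_ideal_def using additive_subgroup.a_subgroup
          by blast
      show "c \<otimes> x \<in> ?I" if "x \<in> ?I" "c \<in> carrier R" for c x
        using that sub(4)[OF L(1)] by (simp add: m_assoc)
      show "x \<otimes> c \<in> ?I" if "x \<in> ?I" "c \<in> carrier R" for c x
        using that by (simp add: m_assoc)
    qed
    have "?I = {\<zero>}"
    proof (rule ccontr)
      assume "?I \<noteq> {\<zero>}"
      then obtain b where b: "b \<in> ?I" "\<one> \<ominus> b \<in> J" using comax[OF I] by blast
      then have bc: "b \<in> carrier R" by simp
      have "b \<otimes> \<one> \<in> L" using b(1) one_closed by blast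
      then have "b \<in> L" unfolding r_one[OF bc] .
      moreover have "\<one> \<ominus> b \<in> L" using b(2) L(2) by blast
      ultimately have "(\<one> \<ominus> b) \<oplus> b \<in> L" using sub(3)[OF L(1)] by blast
      moreover have "(\<one> \<ominus> b) \<oplus> b = \<one>" using bc by (simp add: a_minus_def a_assoc l_neg)
      ultimately show False using L(3) by simp
    qed
    then show "a = \<zero>" using aI by blast
  qed
  ultimately show ?thesis unfolding primitive_ring_def using ring_axioms by blast
qed

end

section \<open>Primitivity of the algebra of a recurrent language\<close>

lemma word_monoid_simps [simp]:
  "carrier (word_monoid d) = lists {..<d}" "mult (word_monoid d) = (@)" "one (word_monoid d) = []"
  by (simp_all add: word_monoid_def)

lemma (in ring) principal_left_ideal:
  assumes "d \<in> carrier R" shows "left_ideal R ((\<lambda>a. a \<otimes> d) ` carrier R)"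
proof (rule left_idealI)
  show "\<zero> \<in> (\<lambda>a. a \<otimes> d) ` carrier R" using assms by (intro image_eqI[of _ _ \<zero>]) auto
  show "x \<oplus> y \<in> (\<lambda>a. a \<otimes> d) ` carrier R" if "x \<in> (\<lambda>a. a \<otimes> d) ` carrier R" "y \<in> (\<lambda>a. a \<otimes> d) ` carrier R"
      for x y
    using that
  proof (elim imageE)
    fix a b assume "a \<in> carrier R" "b \<in> carrier R" "x = a \<otimes> d" "y = b \<otimes> d"
    then show ?thesis using assms by (intro image_eqI[of _ _ "a \<oplus> b"]) (simp_all add: l_distr)
  qed
  show "c \<otimes> x \<in> (\<lambda>a. a \<otimes> d) ` carrier R" if "c \<in> carrier R" "x \<in> (\<lambda>a. a \<otimes> d) ` carrier R" for c x
    using that(2)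
  proof (elim imageE)
    fix a assume "a \<in> carrier R" "x = a \<otimes> d"
    then show ?thesis using assms that(1) by (intro image_eqI[of _ _ "c \<otimes> a"]) (simp_all add: m_assoc)
  qed
qed (use assms in auto)

context contracted_monoid_algebra
begin

lemma \<kappa>_e_any: "x \<in> S \<Longrightarrow> y \<in> carrier M \<Longrightarrow> \<kappa> x (e y) = (if x = y then \<one>\<^bsub>F\<^esub> else \<zero>\<^bsub>F\<^esub>)"
  using \<kappa>_e[of x y] e_zero[of y] \<kappa>_zero[of x] by (cases "y \<in> S") auto

lemma finite_support: "a \<in> carrier A \<Longrightarrow> finite {x \<in> S. \<kappa> x a \<noteq> \<zero>\<^bsub>F\<^esub>}"
  and in_span_support: "a \<in> carrier A \<Longrightarrow> a \<in> span (e ` {x \<in> S. \<kappa> x a \<noteq> \<zero>\<^bsub>F\<^esub>})"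
proof -
  assume a: "a \<in> carrier A"
  obtain X c where X: "finite X" "X \<subseteq> S" "c \<in> e ` X \<rightarrow> carrier F" "a = lincomb c (e ` X)"
    using decomposition[OF a] by blast
  have \<kappa>: "\<kappa> x a = (if x \<in> X then c (e x) else \<zero>\<^bsub>F\<^esub>)" if "x \<in> S" for x
    using \<kappa>_lincomb[OF X(1-3) that] X(4) by simp
  then have sub: "{x \<in> S. \<kappa> x a \<noteq> \<zero>\<^bsub>F\<^esub>} \<subseteq> X" by (auto split: if_splits)
  then show "finite {x \<in> S. \<kappa> x a \<noteq> \<zero>\<^bsub>F\<^esub>}" using X(1) by (rule finite_subset)
  let ?Y = "{x \<in> S. \<kappa> x a \<noteq> \<zero>\<^bsub>F\<^esub>}"
  have cX: "e ` X \<subseteq> carrier A" using X(2) S_sub e_closed by auto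
  have "lincomb c (e ` ?Y) = lincomb c (e ` X)"
    unfolding lincomb_def
  proof (rule M.add.finprod_mono_neutral_cong_left)
    show "finite (e ` X)" "e ` ?Y \<subseteq> e ` X" using X(1) sub by auto
    show "c v \<odot>\<^bsub>A\<^esub> v = \<zero>\<^bsub>A\<^esub>" if v: "v \<in> e ` X - e ` ?Y" for v
    proof -
      obtain x where x: "x \<in> X" "v = e x" "x \<notin> ?Y" using v by blast
      then have "c v = \<zero>\<^bsub>F\<^esub>" using \<kappa>[of x] X(2) by auto
      then show ?thesis using v cX by auto
    qed
    show "(\<lambda>v. c v \<odot>\<^bsub>A\<^esub> v) \<in> e ` X \<rightarrow> carrier A" using X(3) cX by (auto simp: Pi_def)
  qed auto
  then have "a = lincomb c (e ` ?Y)" using X(4) by simp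
  moreover have "finite (e ` ?Y)" "c \<in> e ` ?Y \<rightarrow> carrier F" using X sub finite_subset by (blast, blast)
  ultimately show "a \<in> span (e ` ?Y)" unfolding span_def by blast
qed

lemma nonzero_support: "a \<in> carrier A \<Longrightarrow> a \<noteq> \<zero>\<^bsub>A\<^esub> \<Longrightarrow> \<exists>x\<in>S. \<kappa> x a \<noteq> \<zero>\<^bsub>F\<^esub>"
proof (rule ccontr)
  assume a: "a \<in> carrier A" "a \<noteq> \<zero>\<^bsub>A\<^esub>" "\<not> (\<exists>x\<in>S. \<kappa> x a \<noteq> \<zero>\<^bsub>F\<^esub>)"
  then have "{x \<in> S. \<kappa> x a \<noteq> \<zero>\<^bsub>F\<^esub>} = {}" by blast
  then have "a \<in> span {}" using in_span_support[OF a(1)] by (simp only: image_empty)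
  then show False using a(2) by (simp add: span_empty)
qed

end

locale word_algebra = contracted_monoid_algebra F A "word_monoid 2" L e \<kappa> + recurrent_language L
  for F :: "('f, 'r) ring_scheme" and A :: "('f, 'a, 's) module_scheme" and L e \<kappa>
begin

lemma ew_closed: "set w \<subseteq> {..<2} \<Longrightarrow> e w \<in> carrier A"
  using e_closed by auto

lemma ew_mult: "set v \<subseteq> {..<2} \<Longrightarrow> set w \<subseteq> {..<2} \<Longrightarrow> e v \<otimes>\<^bsub>A\<^esub> e w = e (v @ w)"
  using e_mult[of v w] by auto

lemma longest_in_support:
  assumes "a \<in> carrier A" "a \<noteq> \<zero>\<^bsub>A\<^esub>"
  shows "\<exists>x\<in>L. \<kappa> x a \<noteq> \<zero>\<^bsub>F\<^esub> \<and> (\<forall>y\<in>L. \<kappa> y a \<noteq> \<zero>\<^bsub>F\<^esub> \<longrightarrow> length y \<le> length x)"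
proof -
  let ?Y = "{x \<in> L. \<kappa> x a \<noteq> \<zero>\<^bsub>F\<^esub>}"
  have "finite ?Y" "?Y \<noteq> {}" using finite_support[OF assms(1)] nonzero_support[OF assms] by auto
  then have "Max (length ` ?Y) \<in> length ` ?Y" by (intro Max_in) auto
  then obtain x where x: "x \<in> ?Y" "length x = Max (length ` ?Y)" by auto
  then have "length y \<le> length x" if "y \<in> ?Y" for y using that \<open>finite ?Y\<close> by auto
  then show ?thesis using x(1) by blast
qed

text \<open>Let \<open>w\<close> be a longest word in the support of a nonzero \<open>a\<close> in
  the ideal. Multiplying by the isolating context \<open>u\<close>, \<open>v\<close> kills all other
  words of the support, as none of them is longer than \<open>w\<close>. What remains is a nonzero
  multiple of \<open>u @ w @ v\<close>.\<close>

lemma ideal_contains_word: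
  assumes I: "ideal I A" "I \<noteq> {\<zero>\<^bsub>A\<^esub>}"
  shows "\<exists>w\<in>L. e w \<in> I"
proof -
  interpret I: ideal I A by fact
  obtain a where a: "a \<in> I" "a \<noteq> \<zero>\<^bsub>A\<^esub>" using I(2) I.zero_closed by blast
  have ac: "a \<in> carrier A" using a(1) I.a_subset by blast
  obtain w where w: "w \<in> L" "\<kappa> w a \<noteq> \<zero>\<^bsub>F\<^esub>"
    and longest: "\<And>y. y \<in> L \<Longrightarrow> \<kappa> y a \<noteq> \<zero>\<^bsub>F\<^esub> \<Longrightarrow> length y \<le> length w" using longest_in_support[OF ac a(2)]
        by blast
  obtain u v where uv: "u @ w @ v \<in> L" "\<And>y. length y \<le> length w \<Longrightarrow> u @ y @ v \<in> L \<Longrightarrow> y = w"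
    using isolated[OF w(1)] by blast
  have l: "set u \<subseteq> {..<2}" "set v \<subseteq> {..<2}" using letters[OF uv(1)] by auto
  note uc = ew_closed[OF l(1)] and vc = ew_closed[OF l(2)] and zc = ew_closed[OF letters[OF uv(1)]]
  \<comment> \<open>On the span of the support of \<open>a\<close>, multiplying by the context
    amounts to reading the coefficient at \<open>w\<close>. This is a linear statement, so it is
    enough to verify it for the words of the support.\<close>
  let ?N = "{b \<in> carrier A. e u \<otimes>\<^bsub>A\<^esub> b \<otimes>\<^bsub>A\<^esub> e v = \<kappa> w b \<odot>\<^bsub>A\<^esub> e (u @ w @ v)}"
  have "LinearCombinations.submodule F ?N A"
  proof (rule submoduleI)
    show "\<zero>\<^bsub>A\<^esub> \<in> ?N" using uc vc zc w(1) by (simp add: \<kappa>_zero)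
    show "x \<oplus>\<^bsub>A\<^esub> y \<in> ?N" if "x \<in> ?N" "y \<in> ?N" for x y
      using that uc vc zc w(1) \<kappa>_closed[OF w(1)]
      by (simp add: A.l_distr A.r_distr \<kappa>_add smult_l_distr)
    show "c \<odot>\<^bsub>A\<^esub> x \<in> ?N" if "c \<in> carrier F" "x \<in> ?N" for c x
      using that uc vc zc w(1) \<kappa>_closed[OF w(1)]
      by (simp add: smult_mult_left smult_mult_right \<kappa>_smult smult_assoc1)
  qed auto
  moreover have "e ` {y \<in> L. \<kappa> y a \<noteq> \<zero>\<^bsub>F\<^esub>} \<subseteq> ?N"
  proof safe
    fix y assume y: "y \<in> L" "\<kappa> y a \<noteq> \<zero>\<^bsub>F\<^esub>"
    have yc: "set y \<subseteq> {..<2}" using letters[OF y(1)] .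
    show "e y \<in> carrier A" by (rule ew_closed[OF yc])
    have e: "e u \<otimes>\<^bsub>A\<^esub> e y \<otimes>\<^bsub>A\<^esub> e v = e (u @ y @ v)"
      using l yc by (simp add: ew_mult)
    show "e u \<otimes>\<^bsub>A\<^esub> e y \<otimes>\<^bsub>A\<^esub> e v = \<kappa> w (e y) \<odot>\<^bsub>A\<^esub> e (u @ w @ v)"
    proof (cases "y = w")
      case True
      then show ?thesis using e \<kappa>_e[OF w(1) y(1)] zc by simp
    next
      case False
      then have "u @ y @ v \<notin> L" using uv(2) longest[OF y] by blast
      then have "e (u @ y @ v) = \<zero>\<^bsub>A\<^esub>" using l yc by (intro e_zero) auto
      then show ?thesis using e False \<kappa>_e[OF w(1) y(1)] zc by simp
    qed
  qed
  ultimately have "span (e ` {y \<in> L. \<kappa> y a \<noteq> \<zero>\<^bsub>F\<^esub>}) \<subseteq> ?N" by (rule span_is_subset[rotated])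
  then have "a \<in> ?N" using in_span_support[OF ac] by blast
  then have eq: "e u \<otimes>\<^bsub>A\<^esub> a \<otimes>\<^bsub>A\<^esub> e v = \<kappa> w a \<odot>\<^bsub>A\<^esub> e (u @ w @ v)" by simp
  have "e u \<otimes>\<^bsub>A\<^esub> a \<otimes>\<^bsub>A\<^esub> e v \<in> I" using a(1) uc vc by (intro I.I_r_closed I.I_l_closed)
  then have kI: "\<kappa> w a \<odot>\<^bsub>A\<^esub> e (u @ w @ v) \<in> I" using eq by simp
  have kc: "\<kappa> w a \<in> carrier F" by (rule \<kappa>_closed[OF w(1) ac])
  obtain i where i: "i \<in> carrier F" "i \<otimes>\<^bsub>F\<^esub> \<kappa> w a = \<one>\<^bsub>F\<^esub>"
    using left_inverse_exists[OF kc w(2)] by blast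
  \<comment> \<open>Division by the coefficient stays in the ideal, because the scalar acts as a
    multiple of the unit.\<close>
  have "(i \<odot>\<^bsub>A\<^esub> \<one>\<^bsub>A\<^esub>) \<otimes>\<^bsub>A\<^esub> (\<kappa> w a \<odot>\<^bsub>A\<^esub> e (u @ w @ v)) \<in> I" using kI i(1) by (intro I.I_l_closed) auto
  also have "(i \<odot>\<^bsub>A\<^esub> \<one>\<^bsub>A\<^esub>) \<otimes>\<^bsub>A\<^esub> (\<kappa> w a \<odot>\<^bsub>A\<^esub> e (u @ w @ v)) = i \<odot>\<^bsub>A\<^esub> (\<kappa> w a \<odot>\<^bsub>A\<^esub> e (u @ w @ v))"
    using i(1) kc zc by (subst smult_mult_left) auto
  also have "\<dots> = (i \<otimes>\<^bsub>F\<^esub> \<kappa> w a) \<odot>\<^bsub>A\<^esub> e (u @ w @ v)" using i(1) kc zc by (intro smult_assoc1[symmetric])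
  also have "\<dots> = e (u @ w @ v)" unfolding i(2) using zc by simp
  finally show ?thesis using uv(1) by blast
qed

text \<open>Long words of \<open>L\<close> contain the word found in the ideal, and words outside
  \<open>L\<close> vanish.\<close>

lemma ideal_contains_all_long_words:
  assumes I: "ideal I A" "I \<noteq> {\<zero>\<^bsub>A\<^esub>}"
  shows "\<exists>N. \<forall>w. set w \<subseteq> {..<2} \<and> length w = N \<longrightarrow> e w \<in> I"
proof -
  interpret I: ideal I A by fact
  obtain u where u: "u \<in> L" "e u \<in> I" using ideal_contains_word[OF I] by blast
  obtain N where N: "\<And>w. w \<in> L \<Longrightarrow> N \<le> length w \<Longrightarrow> sublist u w" using recurrent[OF u(1)] by blast
  have "e w \<in> I" if w: "set w \<subseteq> {..<2}" "length w = N" for w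
  proof (cases "w \<in> L")
    case True
    then have "sublist u w" using N w by simp
    then obtain x y where e: "w = x @ u @ y" by (auto simp: sublist_def)
    have l: "set x \<subseteq> {..<2}" "set y \<subseteq> {..<2}" "set u \<subseteq> {..<2}" using w(1) e by auto
    have "e x \<otimes>\<^bsub>A\<^esub> e u \<otimes>\<^bsub>A\<^esub> e y \<in> I" using u(2) l by (intro I.I_r_closed I.I_l_closed ew_closed)
    then show ?thesis using e l by (simp add: ew_mult)
  next
    case False
    moreover have "w \<in> lists {..<2}" using w by auto
    ultimately show ?thesis using e_zero[of w] I.zero_closed by simp
  qed
  then show ?thesis by blast
qed

definition T where "T = e [0] \<oplus>\<^bsub>A\<^esub> e [1]"

lemma T_closed: "T \<in> carrier A" by (auto simp: T_def intro!: M.a_closed ew_closed)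

lemma word_T: "set w \<subseteq> {..<2} \<Longrightarrow> e w \<otimes>\<^bsub>A\<^esub> T = e (w @ [0]) \<oplus>\<^bsub>A\<^esub> e (w @ [1])"
  unfolding T_def by (subst A.r_distr) (auto simp: ew_mult intro!: ew_closed)

text \<open>The power expands to the sum of all words of length \<open>N\<close>. The sum is never
  written down: the factors \<open>T\<close> are absorbed one by one into a prefix \<open>w\<close>,
  by induction on the number of those left.\<close>

lemma T_power_in_ideal:
  assumes I: "ideal I A" and N: "\<And>w. set w \<subseteq> {..<2} \<Longrightarrow> length w = N \<Longrightarrow> e w \<in> I"
  shows "T [^]\<^bsub>A\<^esub> N \<in> I"
proof -
  interpret I: ideal I A by fact
  have "e w \<otimes>\<^bsub>A\<^esub> T [^]\<^bsub>A\<^esub> n \<in> I" if "set w \<subseteq> {..<2}" "length w + n = N" for w n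
    using that
  proof (induction n arbitrary: w)
    case 0
    then show ?case using N ew_closed by simp
  next
    case (Suc n)
    have "e w \<otimes>\<^bsub>A\<^esub> T [^]\<^bsub>A\<^esub> Suc n = (e w \<otimes>\<^bsub>A\<^esub> T) \<otimes>\<^bsub>A\<^esub> T [^]\<^bsub>A\<^esub> n"
      using T_closed ew_closed[OF Suc.prems(1)] by (simp only: A.nat_pow_Suc2 A.m_assoc A.nat_pow_closed)
    also have "\<dots> = e (w @ [0]) \<otimes>\<^bsub>A\<^esub> T [^]\<^bsub>A\<^esub> n \<oplus>\<^bsub>A\<^esub> e (w @ [1]) \<otimes>\<^bsub>A\<^esub> T [^]\<^bsub>A\<^esub> n"
      unfolding word_T[OF Suc.prems(1)] using T_closed Suc.prems(1) by (intro A.l_distr ew_closed) auto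
    also have "\<dots> \<in> I" using Suc by (intro I.a_closed Suc.IH) auto
    finally show ?case .
  qed
  from this[of "[]" N] show ?thesis using e_one T_closed by simp
qed

text \<open>Multiplying by \<open>T\<close> appends each letter once, and \<open>x @ [c]\<close>
  arises only from \<open>x\<close>.\<close>

lemma \<kappa>_mult_T:
  assumes "x @ [c] \<in> L" "a \<in> carrier A"
  shows "\<kappa> (x @ [c]) (a \<otimes>\<^bsub>A\<^esub> T) = \<kappa> x a"
proof -
  have x: "x \<in> L" using factor[OF assms(1), of x] by auto
  have c: "c < 2" using letters[OF assms(1)] by auto
  let ?N = "{a \<in> carrier A. \<kappa> (x @ [c]) (a \<otimes>\<^bsub>A\<^esub> T) = \<kappa> x a}"
  have "LinearCombinations.submodule F ?N A"
    by (rule submoduleI)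
      (use T_closed x assms(1) in \<open>auto simp: \<kappa>_zero \<kappa>_add \<kappa>_smult A.l_distr smult_mult_left\<close>)
  moreover have "e ` L \<subseteq> ?N"
  proof safe
    fix y assume y: "y \<in> L"
    note l = letters[OF y]
    show "e y \<in> carrier A" by (rule ew_closed[OF l])
    have "\<kappa> (x @ [c]) (e y \<otimes>\<^bsub>A\<^esub> T) = \<kappa> (x @ [c]) (e (y @ [0])) \<oplus>\<^bsub>F\<^esub> \<kappa> (x @ [c]) (e (y @ [1]))"
      unfolding word_T[OF l] using l by (intro \<kappa>_add assms(1) ew_closed) auto
    also have "\<dots> = \<kappa> x (e y)"
    proof -
      have "y @ [0] \<in> lists {..<2}" "y @ [1] \<in> lists {..<2}" using l by auto
      moreover have "c = 0 \<or> c = 1" using c by auto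
      ultimately show ?thesis
        using \<kappa>_e_any[OF assms(1), of "y @ [0]"] \<kappa>_e_any[OF assms(1), of "y @ [1]"] \<kappa>_e[OF x y] by auto
    qed
    finally show "\<kappa> (x @ [c]) (e y \<otimes>\<^bsub>A\<^esub> T) = \<kappa> x (e y)" .
  qed
  ultimately have "span (e ` L) \<subseteq> ?N" by (rule span_is_subset[rotated])
  then show ?thesis using assms(2) carrier_eq_span_S by blast
qed

text \<open>The left ideal is generated by 1 - T. It is comaximal with every nonzero ideal, because
  that ideal contains a power of \<open>T\<close>, and 1 minus a power of \<open>T\<close> is a left
  multiple of 1 - T. It is proper because a left inverse of 1 - T would have infinite
  support.\<close>

theorem primitive: "primitive_ring A"
proof (rule A.primitive_criterion)
  let ?D = "\<one>\<^bsub>A\<^esub> \<ominus>\<^bsub>A\<^esub> T"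
  let ?J = "(\<lambda>a. a \<otimes>\<^bsub>A\<^esub> ?D) ` carrier A"
  have D: "?D \<in> carrier A" using T_closed by simp
  show J: "left_ideal A ?J" by (rule A.principal_left_ideal[OF D])
  show "\<one>\<^bsub>A\<^esub> \<notin> ?J"
  proof
    assume "\<one>\<^bsub>A\<^esub> \<in> ?J"
    then obtain a where a: "\<one>\<^bsub>A\<^esub> = a \<otimes>\<^bsub>A\<^esub> ?D" "a \<in> carrier A" by (rule imageE)
    note a = a(2) a(1)
    then have "a \<noteq> \<zero>\<^bsub>A\<^esub>" using D one_not_zero by auto
    then obtain x where x: "x \<in> L" "\<kappa> x a \<noteq> \<zero>\<^bsub>F\<^esub>" "\<And>y. y \<in> L \<Longrightarrow> \<kappa> y a \<noteq> \<zero>\<^bsub>F\<^esub> \<Longrightarrow> length y \<le> length x"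
      using longest_in_support[OF a(1)] by blast
    obtain c where c: "x @ [c] \<in> L" using extendable[OF x(1)] by blast
    have aT: "a \<otimes>\<^bsub>A\<^esub> T \<in> carrier A" using a(1) T_closed by simp
    have "a = \<one>\<^bsub>A\<^esub> \<oplus>\<^bsub>A\<^esub> a \<otimes>\<^bsub>A\<^esub> T"
      using a(1) aT T_closed by (subst a(2)) (simp add: a_minus_def A.r_distr A.r_minus M.a_assoc M.l_neg)
    \<comment> \<open>The word \<open>x @ [c]\<close> is nonempty, so the unit has coefficient zero
      there, and it is longer than every word of the support of \<open>a\<close>. Yet the equation
      transfers the nonzero coefficient at \<open>x\<close> to it.\<close>
    then have "\<kappa> (x @ [c]) a = \<kappa> (x @ [c]) \<one>\<^bsub>A\<^esub> \<oplus>\<^bsub>F\<^esub> \<kappa> x a"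
      using \<kappa>_add[OF c A.one_closed aT] \<kappa>_mult_T[OF c a(1)] by simp
    moreover have "\<kappa> (x @ [c]) \<one>\<^bsub>A\<^esub> = \<zero>\<^bsub>F\<^esub>" using \<kappa>_e_any[OF c, of "[]"] e_one by simp
    ultimately have "\<kappa> (x @ [c]) a = \<kappa> x a" using \<kappa>_closed[OF x(1) a(1)] by simp
    then show False using x(2) x(3)[OF c] by simp
  qed
  fix I assume I: "ideal I A" "I \<noteq> {\<zero>\<^bsub>A\<^esub>}"
  obtain N where "\<And>w. set w \<subseteq> {..<2} \<Longrightarrow> length w = N \<Longrightarrow> e w \<in> I"
    using ideal_contains_all_long_words[OF I] by blast
  then have N: "T [^]\<^bsub>A\<^esub> N \<in> I" by (rule T_power_in_ideal[OF I(1)])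
  \<comment> \<open>Telescoping from the left: 1 - T^(n+1) = (1 - T) + T (1 - T^n).\<close>
  have "\<one>\<^bsub>A\<^esub> \<ominus>\<^bsub>A\<^esub> T [^]\<^bsub>A\<^esub> n \<in> ?J" for n :: nat
  proof (induction n)
    case 0
    have "\<one>\<^bsub>A\<^esub> \<ominus>\<^bsub>A\<^esub> T [^]\<^bsub>A\<^esub> (0::nat) = \<zero>\<^bsub>A\<^esub>" by (simp add: a_minus_def M.r_neg)
    then show ?case using A.left_idealD(2)[OF J] by (simp only:)
  next
    case (Suc n)
    have Tn: "T [^]\<^bsub>A\<^esub> n \<in> carrier A" using T_closed by simp
    have "?D \<in> ?J" by (rule image_eqI[where x =
        "\<one>\<^bsub>A\<^esub>", OF _ A.one_closed]) (rule A.l_one[OF D, symmetric])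
    moreover have "T \<otimes>\<^bsub>A\<^esub> (\<one>\<^bsub>A\<^esub> \<ominus>\<^bsub>A\<^esub> T [^]\<^bsub>A\<^esub> n) \<in> ?J" using A.left_idealD(4)[OF J T_closed Suc] .
    ultimately have "?D \<oplus>\<^bsub>A\<^esub> T \<otimes>\<^bsub>A\<^esub> (\<one>\<^bsub>A\<^esub> \<ominus>\<^bsub>A\<^esub> T [^]\<^bsub>A\<^esub> n) \<in> ?J" by (rule A.left_idealD(3)[OF J])
    moreover have "?D \<oplus>\<^bsub>A\<^esub> T \<otimes>\<^bsub>A\<^esub> (\<one>\<^bsub>A\<^esub> \<ominus>\<^bsub>A\<^esub> T [^]\<^bsub>A\<^esub> n) = \<one>\<^bsub>A\<^esub> \<ominus>\<^bsub>A\<^esub> T [^]\<^bsub>A\<^esub> Suc n"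
    proof -
      have "?D \<oplus>\<^bsub>A\<^esub> T \<otimes>\<^bsub>A\<^esub> (\<one>\<^bsub>A\<^esub> \<ominus>\<^bsub>A\<^esub> T [^]\<^bsub>A\<^esub> n) =
          \<one>\<^bsub>A\<^esub> \<oplus>\<^bsub>A\<^esub> ((\<ominus>\<^bsub>A\<^esub> T \<oplus>\<^bsub>A\<^esub> T) \<ominus>\<^bsub>A\<^esub> T \<otimes>\<^bsub>A\<^esub> T [^]\<^bsub>A\<^esub> n)"
        using T_closed Tn by (simp add: a_minus_def A.r_distr A.r_minus M.a_assoc)
      also have "\<dots> = \<one>\<^bsub>A\<^esub> \<ominus>\<^bsub>A\<^esub> T \<otimes>\<^bsub>A\<^esub> T [^]\<^bsub>A\<^esub> n"
        using T_closed Tn by (simp add: a_minus_def M.l_neg)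
      finally show ?thesis using T_closed by (simp only: A.nat_pow_Suc2)
    qed
    ultimately show ?case by (simp only:)
  qed
  then show "\<exists>a\<in>I. \<one>\<^bsub>A\<^esub> \<ominus>\<^bsub>A\<^esub> a \<in> ?J" using N by blast
qed

end

section \<open>Algebras of languages and their tensor products\<close>

context algebra_quotient
begin

text \<open>The function on the quotient that \<open>\<phi>\<close> induces, evaluated at an
  arbitrary representative. It is meaningful for additive \<open>\<phi>\<close> that vanish on
  \<open>I\<close>.\<close>

definition induced :: "('a \<Rightarrow> 'f) \<Rightarrow> 'a set \<Rightarrow> 'f" where
  "induced \<phi> C = \<phi> (SOME x. x \<in> C)"

lemma induced_proj:
  assumes add: "\<And>x y. x \<in> carrier A \<Longrightarrow> y \<in> carrier A \<Longrightarrow> \<phi> (x \<oplus>\<^bsub>A\<^esub> y) = \<phi> x \<oplus>\<^bsub>F\<^esub> \<phi> y"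
    and cl: "\<And>x. x \<in> carrier A \<Longrightarrow> \<phi> x \<in> carrier F"
    and I0: "\<And>x. x \<in> I \<Longrightarrow> \<phi> x = \<zero>\<^bsub>F\<^esub>" and x: "x \<in> carrier A"
  shows "induced \<phi> (proj x) = \<phi> x"
proof -
  have "x \<in> proj x" using x by (simp add: proj_def a_rcos_self)
  then have s: "(SOME y. y \<in> proj x) \<in> proj x" by (rule someI)
  obtain y where y: "y = (SOME y. y \<in> proj x)" "y \<in> proj x" using s by blast
  have yc: "y \<in> carrier A" using y(2) x by (metis a_elemrcos_carrier proj_def)
  have "proj y = proj x" using y(2) x yc unfolding proj_def by (metis a_repr_independence')
  then have d: "y \<ominus>\<^bsub>A\<^esub> x \<in> I" using proj_eq_iff yc x by simp
  have dc: "y \<ominus>\<^bsub>A\<^esub> x \<in> carrier A" using yc x by simp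
  have "(y \<ominus>\<^bsub>A\<^esub> x) \<oplus>\<^bsub>A\<^esub> x = y" using yc x by (simp add: a_minus_def M.a_assoc M.l_neg)
  then have "\<phi> y = \<phi> (y \<ominus>\<^bsub>A\<^esub> x) \<oplus>\<^bsub>F\<^esub> \<phi> x" using add[OF dc x] by simp
  then have "\<phi> y = \<phi> x" using I0[OF d] cl[OF x] by simp
  then show ?thesis by (simp add: induced_def y(1))
qed

lemma vimage_submodule:
  assumes N: "LinearCombinations.submodule F N Q"
  shows "LinearCombinations.submodule F {x \<in> carrier A. proj x \<in> N} A"
proof (rule submoduleI)
  show "\<zero>\<^bsub>A\<^esub> \<in> {x \<in> carrier A. proj x \<in> N}"
    using submodule.zero_closed[OF N] by (simp add: proj_simps(5))
  show "x \<oplus>\<^bsub>A\<^esub> y \<in> {x \<in> carrier A. proj x \<in> N}"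
      if "x \<in> {x \<in> carrier A. proj x \<in> N}" "y \<in> {x \<in> carrier A. proj x \<in> N}" for x y
    using that submodule.m_closed[OF N, of "proj x" "proj y"] by (simp add: proj_simps(2))
  show "c \<odot>\<^bsub>A\<^esub> x \<in> {x \<in> carrier A. proj x \<in> N}" if "c \<in> carrier F" "x \<in> {x \<in> carrier A. proj x \<in> N}"
      for c x
    using that submodule.smult_closed[OF N, of c "proj x"] by (simp add: proj_smult)
qed auto

end

context monoid_algebra_data
begin

lemma submodule_containing_basis:
  assumes N: "LinearCombinations.submodule F N T" and b: "\<And>x. x \<in> carrier M \<Longrightarrow> basis_elem F x \<in> N"
    and f: "f \<in> carrier T"
  shows "f \<in> N"
proof -
  have "f \<in> N" if "finite X" "f \<in> carrier T" "{x. f x \<noteq> \<zero>} \<subseteq> X" for X f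
    using that
  proof (induction X arbitrary: f)
    case empty
    then have "f = \<zero>\<^bsub>T\<^esub>" by (auto simp: monoid_algebra_simps)
    then show ?case using submodule.zero_closed[OF N] by (simp only:)
  next
    case (insert x X)
    define g where "g = (\<lambda>y. if y = x then \<zero> else f y)"
    have g: "g \<in> carrier T" "{y. g y \<noteq> \<zero>} \<subseteq> X"
    proof -
      have "{y. g y \<noteq> \<zero>} \<subseteq> {y. f y \<noteq> \<zero>}" by (auto simp: g_def)
      then have "finite {y. g y \<noteq> \<zero>}" using finite_supp[OF insert.prems(1)] finite_subset by blast
      then show "g \<in> carrier T" using insert.prems(1) by (auto simp: monoid_algebra_carrier g_def)
      show "{y. g y \<noteq> \<zero>} \<subseteq> X" using insert.prems(2) by (auto simp: g_def)
    qed
    then have gN: "g \<in> N" by (rule insert.IH)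
    show ?case
    proof (cases "x \<in> carrier M")
      case True
      have "f x \<odot>\<^bsub>T\<^esub> basis_elem F x \<in> N"
        using submodule.smult_closed[OF N] b[OF True] insert.prems(1)
            by (simp add: monoid_algebra_carrier)
      then have "g \<oplus>\<^bsub>T\<^esub> (f x \<odot>\<^bsub>T\<^esub> basis_elem F x) \<in> N" using gN submodule.m_closed[OF N] by blast
      moreover have "g \<oplus>\<^bsub>T\<^esub> (f x \<odot>\<^bsub>T\<^esub> basis_elem F x) = f"
        using carr[OF insert.prems(1)]
            by (auto simp: monoid_algebra_simps g_def basis_elem_def fun_eq_iff)
      ultimately show ?thesis by (simp only:)
    next
      case False
      then have "g = f" using insert.prems(1) by (auto simp: g_def monoid_algebra_carrier fun_eq_iff)
      then show ?thesis using gN by simp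
    qed
  qed
  then show ?thesis using f finite_supp[OF f] by blast
qed

lemma pairing_minus:
  assumes "f \<in> carrier T" "g \<in> carrier T" "\<phi> \<in> UNIV \<rightarrow> carrier F"
  shows "pairing F (f \<ominus>\<^bsub>T\<^esub> g) \<phi> = pairing F f \<phi> \<ominus> pairing F g \<phi>"
proof -
  interpret T: ring T by (rule T_ring)
  have c: "f \<ominus>\<^bsub>T\<^esub> g \<in> carrier T" using assms by simp
  have "(f \<ominus>\<^bsub>T\<^esub> g) \<oplus>\<^bsub>T\<^esub> g = f" using assms by (simp add: a_minus_def T.a_assoc T.l_neg)
  then have "pairing F f \<phi> = pairing F (f \<ominus>\<^bsub>T\<^esub> g) \<phi> \<oplus> pairing F g \<phi>"
    using pairing_add[OF c assms(2,3)] by (simp only: monoid_algebra_simps)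
  then show ?thesis using pairing_closed[OF c assms(3)] pairing_closed[OF assms(2,3)]
    by (simp add: a_minus_def F.a_assoc F.r_neg)
qed

text \<open>If both factors of an element of \<open>S\<close> lie in \<open>S\<close>, a product has
  a nonzero coefficient in \<open>S\<close> only if each of its factors has one. The result serves
  as an upper bound for an ideal that is given by generators.\<close>

lemma vanishing_ideal:
  assumes S: "\<And>x y. x \<in> carrier M \<Longrightarrow> y \<in> carrier M \<Longrightarrow> x \<otimes>\<^bsub>M\<^esub> y \<in> S \<Longrightarrow> x \<in> S \<and> y \<in> S"
  shows "ideal {f \<in> carrier T. \<forall>x\<in>S. f x = \<zero>} T"
proof (rule idealI[OF T_ring])
  interpret T: ring T by (rule T_ring)
  let ?J = "{f \<in> carrier T. \<forall>x\<in>S. f x = \<zero>}"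
  have J: "left_ideal T ?J"
  proof (rule T.left_idealI)
    show "x \<oplus>\<^bsub>T\<^esub> y \<in> ?J" if "x \<in> ?J" "y \<in> ?J" for x y
      using that T.a_closed[of x y] by (auto simp: monoid_algebra_simps)
    show "a \<otimes>\<^bsub>T\<^esub> x \<in> ?J" if "a \<in> carrier T" "x \<in> ?J" for a x
    proof -
      have "(a \<otimes>\<^bsub>T\<^esub> x) z = \<zero>" if z: "z \<in> S" for z
      proof (rule mult_eq_zero)
        fix u v assume "u \<in> carrier M" "v \<in> carrier M" "u \<otimes>\<^bsub>M\<^esub> v = z"
        then have "v \<in> S" using S[of u v] z by simp
        then show "a u = \<zero> \<or> x v = \<zero>" using \<open>x \<in> ?J\<close> by simp
      qed (use \<open>a \<in> carrier T\<close> \<open>x \<in> ?J\<close> in simp_all)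
      then show ?thesis using that by simp
    qed
  qed (auto simp: monoid_algebra_simps monoid_algebra_carrier)
  then show "subgroup ?J (add_monoid T)" unfolding left_ideal_def using additive_subgroup.a_subgroup
      by blast
  show "a \<otimes>\<^bsub>T\<^esub> x \<in> ?J" if "x \<in> ?J" "a \<in> carrier T" for a x using T.left_idealD(4)[OF J that(2,1)] .
  show "x \<otimes>\<^bsub>T\<^esub> a \<in> ?J" if "x \<in> ?J" "a \<in> carrier T" for a x
  proof -
      have "(x \<otimes>\<^bsub>T\<^esub> a) z = \<zero>" if z: "z \<in> S" for z
      proof (rule mult_eq_zero)
        fix u v assume "u \<in> carrier M" "v \<in> carrier M" "u \<otimes>\<^bsub>M\<^esub> v = z"
        then have "u \<in> S" using S[of u v] z by simp
        then show "x u = \<zero> \<or> a v = \<zero>" using \<open>x \<in> ?J\<close> by simp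
      qed (use \<open>a \<in> carrier T\<close> \<open>x \<in> ?J\<close> in simp_all)
    then show ?thesis using that by simp
  qed
qed

end

lemma word_monoid_monoid: "monoid (word_monoid d)"
  by unfold_locales auto

definition language_algebra :: "('f, 'r) ring_scheme \<Rightarrow> nat list set \<Rightarrow> ('f, (nat list \<Rightarrow> 'f) set) module"
    where
  "language_algebra F L = quot_algebra (free_algebra F 2) (Idl\<^bsub>free_algebra F 2\<^esub> (basis_elem F ` (lists {..<2} - L)))"

lemma monomial_language_algebra: "monomial_algebra F (language_algebra F L)"
  unfolding monomial_algebra_def language_algebra_def
  by (rule exI[of _ 2], rule exI[of _ "lists {..<2} - L"]) simp

text \<open>The words of \<open>L\<close> stay independent in the quotient: all relations lie in the
  ideal of the elements whose coefficients on \<open>L\<close> vanish, so these coefficients descend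
  to functionals \<open>\<kappa>\<close>. Closure of \<open>L\<close> under factors is what makes
  that set an ideal.\<close>

lemma word_algebra_language_algebra:
  assumes F: "field F" and L: "recurrent_language L"
  shows "\<exists>e \<kappa>. word_algebra F (language_algebra F L) L e \<kappa>"
proof -
  interpret L: recurrent_language L by fact
  interpret D: monoid_algebra_data F "word_monoid 2"
    using F word_monoid_monoid by (simp add: monoid_algebra_data_def)
  let ?T = "monoid_algebra F (word_monoid 2)"
  let ?I = "Idl\<^bsub>?T\<^esub> (basis_elem F ` (lists {..<2} - L))"
  interpret T: field_algebra F ?T by (rule D.T_field_algebra)
  have W: "basis_elem F ` (lists {..<2} - L) \<subseteq> carrier ?T" using D.basis_elem_closed by auto
  have I: "ideal ?I ?T" by (rule T.A.genideal_ideal[OF W])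
  interpret Q: algebra_quotient F ?T ?I using T.field_algebra_axioms I
      by (simp add: algebra_quotient_def)
  have A: "language_algebra F L = Q.Q" by (simp add: language_algebra_def free_algebra_def)
  have IJ: "?I \<subseteq> {f \<in> carrier ?T. \<forall>x\<in>L. f x = \<zero>\<^bsub>F\<^esub>}"
  proof (rule T.A.genideal_minimal)
    show "ideal {f \<in> carrier ?T. \<forall>x\<in>L. f x = \<zero>\<^bsub>F\<^esub>} ?T"
    proof (rule D.vanishing_ideal)
      fix x y assume "x \<otimes>\<^bsub>word_monoid 2\<^esub> y \<in> L"
      then have "x @ y \<in> L" by simp
      then show "x \<in> L \<and> y \<in> L" using L.factor[of "x @ y"] by auto
    qed
    show "basis_elem F ` (lists {..<2} - L) \<subseteq> {f \<in> carrier ?T. \<forall>x\<in>L. f x = \<zero>\<^bsub>F\<^esub>}"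
      using W by (auto simp: basis_elem_def)
  qed
  define e where "e w = Q.proj (basis_elem F w)" for w
  define \<kappa> where "\<kappa> w = Q.induced (\<lambda>f. f w)" for w :: "nat list"
  have \<kappa>: "\<kappa> w (Q.proj f) = f w" if "w \<in> L" "f \<in> carrier ?T" for w f
    unfolding \<kappa>_def by (rule Q.induced_proj) (use that IJ in \<open>auto simp: monoid_algebra_simps\<close>)
  interpret QA: field_algebra F Q.Q by (rule Q.quotient_field_algebra)
  have "[] \<in> L" using L.nonempty L.factor by auto
  have eC: "e x \<in> carrier Q.Q" if "x \<in> carrier (word_monoid 2)" for x
    using that D.basis_elem_closed by (auto simp: e_def Q.proj_simps(1))
  have span: "QA.span (e ` carrier (word_monoid 2)) = carrier Q.Q"
  proof
    have c: "e ` carrier (word_monoid 2) \<subseteq> carrier Q.Q" using eC by blast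
    show "QA.span (e ` carrier (word_monoid 2)) \<subseteq> carrier Q.Q" by (rule QA.span_carrier[OF c])
    have "f \<in> {f \<in> carrier ?T. Q.proj f \<in> QA.span (e ` carrier (word_monoid 2))}" if "f \<in> carrier ?T"
        for f
    proof (rule D.submodule_containing_basis[OF Q.vimage_submodule[OF QA.span_submodule[OF c]] _ that])
      show "basis_elem F x \<in> {f \<in> carrier ?T. Q.proj f \<in> QA.span (e ` carrier (word_monoid 2))}"
        if "x \<in> carrier (word_monoid 2)" for x
        using that D.basis_elem_closed[OF that] QA.in_own_span[OF c] by (auto simp: e_def)
    qed
    then show "carrier Q.Q \<subseteq> QA.span (e ` carrier (word_monoid 2))" by (auto simp: Q.proj_simps(1))
  qed
  have "contracted_monoid_algebra F Q.Q (word_monoid 2) L e \<kappa>"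
  proof (intro contracted_monoid_algebra.intro contracted_monoid_algebra_axioms.intro)
    show "field_algebra F Q.Q" by (rule Q.quotient_field_algebra)
    show "monoid (word_monoid 2)" by (rule word_monoid_monoid)
    show "L \<subseteq> carrier (word_monoid 2)" using L.letters by auto
    show "\<one>\<^bsub>word_monoid 2\<^esub> \<in> L" using \<open>[] \<in> L\<close> by simp
    show "e x \<in> carrier Q.Q" if "x \<in> carrier (word_monoid 2)" for x by (rule eC[OF that])
    show "e x \<otimes>\<^bsub>Q.Q\<^esub> e y = e (x \<otimes>\<^bsub>word_monoid 2\<^esub> y)"
      if "x \<in> carrier (word_monoid 2)" "y \<in> carrier (word_monoid 2)" for x y
      using D.basis_elem_closed[OF that(1)] D.basis_elem_closed[OF that(2)] D.basis_mult[OF that]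
      by (simp add: e_def Q.proj_simps(3))
    show "e \<one>\<^bsub>word_monoid 2\<^esub> = \<one>\<^bsub>Q.Q\<^esub>" by (simp add: e_def Q.proj_simps(4) monoid_algebra_simps)
    show "e x = \<zero>\<^bsub>Q.Q\<^esub>" if "x \<in> carrier (word_monoid 2)" "x \<notin> L" for x
    proof -
      have "basis_elem F x \<in> ?I" using T.A.genideal_self[OF W] that by auto
      then show ?thesis
        using D.basis_elem_closed[OF that(1)]
            by (simp add: e_def Q.proj_simps(5) Q.proj_eq_iff a_minus_def)
    qed
    show "QA.span (e ` carrier (word_monoid 2)) = carrier Q.Q" by (rule span)
    show "\<kappa> x a \<in> carrier F" if "x \<in> L" "a \<in> carrier Q.Q" for x a
      using that \<kappa>[OF that(1)] by (auto simp: Q.proj_simps(1))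
    show "\<kappa> x (a \<oplus>\<^bsub>Q.Q\<^esub> b) = \<kappa> x a \<oplus>\<^bsub>F\<^esub> \<kappa> x b" if "x \<in> L" "a \<in> carrier Q.Q" "b \<in> carrier Q.Q" for x a b
      using that \<kappa>[OF that(1)] by (auto simp: Q.proj_simps(1,2)) (simp add: monoid_algebra_simps)
    show "\<kappa> x (c \<odot>\<^bsub>Q.Q\<^esub> a) = c \<otimes>\<^bsub>F\<^esub> \<kappa> x a" if "x \<in> L" "c \<in> carrier F" "a \<in> carrier Q.Q" for x c a
      using that \<kappa>[OF that(1)] by (auto simp: Q.proj_simps(1) Q.proj_smult) (simp add: monoid_algebra_simps)
    show "\<kappa> x (e y) = (if x = y then \<one>\<^bsub>F\<^esub> else \<zero>\<^bsub>F\<^esub>)" if "x \<in> L" "y \<in> L" for x y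
    proof -
      have "y \<in> carrier (word_monoid 2)" using L.letters[OF that(2)] by auto
      then have "\<kappa> x (e y) = basis_elem F y x" unfolding e_def by (intro \<kappa> that(1) D.basis_elem_closed)
      then show ?thesis by (simp only: basis_elem_def)
    qed
  qed
  then have "word_algebra F Q.Q L e \<kappa>" using L by (simp add: word_algebra_def)
  then show ?thesis unfolding A by blast
qed

section \<open>Tensor products tested by bilinear forms\<close>

definition bilinear_form ::
  "('f, 'r) ring_scheme \<Rightarrow> ('f, 'a, 's) module_scheme \<Rightarrow> ('f, 'b, 't) module_scheme \<Rightarrow> ('a \<times> 'b \<Rightarrow> 'f) \<Rightarrow> bool" where
  "bilinear_form F A B \<psi> \<longleftrightarrow> \<psi> \<in> UNIV \<rightarrow> carrier F \<and>
    (\<forall>a\<in>carrier A. \<forall>a'\<in>carrier A. \<forall>b\<in>carrier B. \<psi> (a \<oplus>\<^bsub>A\<^esub> a', b) = \<psi> (a, b) \<oplus>\<^bsub>F\<^esub> \<psi> (a', b)) \<and>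
    (\<forall>a\<in>carrier A. \<forall>b\<in>carrier B. \<forall>b'\<in>carrier B. \<psi> (a, b \<oplus>\<^bsub>B\<^esub> b') = \<psi> (a, b) \<oplus>\<^bsub>F\<^esub> \<psi> (a, b')) \<and>
    (\<forall>r\<in>carrier F. \<forall>a\<in>carrier A. \<forall>b\<in>carrier B. \<psi> (r \<odot>\<^bsub>A\<^esub> a, b) = r \<otimes>\<^bsub>F\<^esub> \<psi> (a, b)) \<and>
    (\<forall>r\<in>carrier F. \<forall>a\<in>carrier A. \<forall>b\<in>carrier B. \<psi> (a, r \<odot>\<^bsub>B\<^esub> b) = r \<otimes>\<^bsub>F\<^esub> \<psi> (a, b))"

lemma bilinear_formD:
  assumes "bilinear_form F A B \<psi>"
  shows "\<psi> \<in> UNIV \<rightarrow> carrier F" "\<psi> x \<in> carrier F"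
    "a \<in> carrier A \<Longrightarrow> a' \<in> carrier A \<Longrightarrow> b \<in> carrier B \<Longrightarrow> \<psi> (a \<oplus>\<^bsub>A\<^esub> a', b) = \<psi> (a, b) \<oplus>\<^bsub>F\<^esub> \<psi> (a', b)"
    "a \<in> carrier A \<Longrightarrow> b \<in> carrier B \<Longrightarrow> b' \<in> carrier B \<Longrightarrow> \<psi> (a, b \<oplus>\<^bsub>B\<^esub> b') = \<psi> (a, b) \<oplus>\<^bsub>F\<^esub> \<psi> (a, b')"
    "r \<in> carrier F \<Longrightarrow> a \<in> carrier A \<Longrightarrow> b \<in> carrier B \<Longrightarrow> \<psi> (r \<odot>\<^bsub>A\<^esub> a, b) = r \<otimes>\<^bsub>F\<^esub> \<psi> (a, b)"
    "r \<in> carrier F \<Longrightarrow> a \<in> carrier A \<Longrightarrow> b \<in> carrier B \<Longrightarrow> \<psi> (a, r \<odot>\<^bsub>B\<^esub> b) = r \<otimes>\<^bsub>F\<^esub> \<psi> (a, b)"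
proof -
  show 1: "\<psi> \<in> UNIV \<rightarrow> carrier F" using assms by (simp only: bilinear_form_def)
  then show "\<psi> x \<in> carrier F" by (rule funcset_mem) simp
qed (use assms in \<open>simp_all add: bilinear_form_def\<close>)

text \<open>The tensor product is a quotient of the algebra over all pairs, by an ideal known only
  through generators. Bilinear forms supply functionals on this quotient, since each of them
  vanishes on the ideal; they prove independence in it.\<close>

locale algebra_pair = A: field_algebra F A + B: field_algebra F B
  for F :: "('f, 'r) ring_scheme" and A :: "('f, 'a, 's) module_scheme"
      and B :: "('f, 'b, 't) module_scheme"
begin

sublocale D: monoid_algebra_data F "A \<times>\<times> B"
  using A.field_axioms DirProd_monoid[OF A.A.monoid_axioms B.A.monoid_axioms]
  by (simp add: monoid_algebra_data_def)

abbreviation "T \<equiv> monoid_algebra F (A \<times>\<times> B)"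

sublocale T: field_algebra F T by (rule D.T_field_algebra)

lemma carrier_AB: "carrier (A \<times>\<times> B) = carrier A \<times> carrier B"
  and mult_AB: "(a, b) \<otimes>\<^bsub>A \<times>\<times> B\<^esub> (a', b') = (a \<otimes>\<^bsub>A\<^esub> a', b \<otimes>\<^bsub>B\<^esub> b')"
  and one_AB: "\<one>\<^bsub>A \<times>\<times> B\<^esub> = (\<one>\<^bsub>A\<^esub>, \<one>\<^bsub>B\<^esub>)"
  by (simp_all add: DirProd_def)

text \<open>
  With all bilinear forms at once it is evident that the kernel is an ideal: translating the argument
  of a bilinear form by a factor gives a bilinear form again.
\<close>
definition kernel where
  "kernel = {f \<in> carrier T. \<forall>\<psi>. bilinear_form F A B \<psi> \<longrightarrow> pairing F f \<psi> = \<zero>\<^bsub>F\<^esub>}"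

lemma basis_closed: "a \<in> carrier A \<Longrightarrow> b \<in> carrier B \<Longrightarrow> basis_elem F (a, b) \<in> carrier T"
  by (rule D.basis_elem_closed) (simp add: carrier_AB)

lemma bilinear_left_mult:
  assumes \<psi>: "bilinear_form F A B \<psi>" and x: "x \<in> carrier (A \<times>\<times> B)"
  shows "bilinear_form F A B (\<lambda>y. \<psi> (x \<otimes>\<^bsub>A \<times>\<times> B\<^esub> y))"
proof -
  obtain a b where ab: "x = (a, b)" "a \<in> carrier A" "b \<in> carrier B" using x by (auto simp: carrier_AB)
  note \<psi>' = bilinear_formD[OF \<psi>]
  show ?thesis unfolding bilinear_form_def ab(1) mult_AB
    using ab(2,3) \<psi>'(2)
    by (auto simp: A.A.r_distr B.A.r_distr A.smult_mult_right B.smult_mult_right mult_AB \<psi>'(3-6) Pi_def)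
qed

lemma bilinear_right_mult:
  assumes \<psi>: "bilinear_form F A B \<psi>" and g: "g \<in> carrier T"
  shows "bilinear_form F A B (\<lambda>x. pairing F g (\<lambda>y. \<psi> (x \<otimes>\<^bsub>A \<times>\<times> B\<^esub> y)))"
proof -
  note \<psi>' = bilinear_formD[OF \<psi>]
  have fn: "(\<lambda>y. \<psi> (x \<otimes>\<^bsub>A \<times>\<times> B\<^esub> y)) \<in> UNIV \<rightarrow> carrier F" for x using \<psi>'(2) by simp
  show ?thesis unfolding bilinear_form_def
  proof (intro conjI ballI)
    show "(\<lambda>x. pairing F g (\<lambda>y. \<psi> (x \<otimes>\<^bsub>A \<times>\<times> B\<^esub> y))) \<in> UNIV \<rightarrow> carrier F"
      using D.pairing_closed[OF g fn] by simp
    fix a b assume ab: "a \<in> carrier A" "b \<in> carrier B"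
    show "pairing F g (\<lambda>y. \<psi> ((a \<oplus>\<^bsub>A\<^esub> a', b) \<otimes>\<^bsub>A \<times>\<times> B\<^esub> y)) =
        pairing F g (\<lambda>y. \<psi> ((a, b) \<otimes>\<^bsub>A \<times>\<times> B\<^esub> y)) \<oplus>\<^bsub>F\<^esub> pairing F g (\<lambda>y. \<psi> ((a', b) \<otimes>\<^bsub>A \<times>\<times> B\<^esub> y))"
      if "a' \<in> carrier A" for a'
      unfolding D.pairing_add_right[OF g fn fn, symmetric]
      by (rule D.pairing_cong[OF g fn]) (use ab that in \<open>auto simp: carrier_AB mult_AB A.A.l_distr \<psi>'(3)\<close>)
    show "pairing F g (\<lambda>y. \<psi> ((a, b \<oplus>\<^bsub>B\<^esub> b') \<otimes>\<^bsub>A \<times>\<times> B\<^esub> y)) =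
        pairing F g (\<lambda>y. \<psi> ((a, b) \<otimes>\<^bsub>A \<times>\<times> B\<^esub> y)) \<oplus>\<^bsub>F\<^esub> pairing F g (\<lambda>y. \<psi> ((a, b') \<otimes>\<^bsub>A \<times>\<times> B\<^esub> y))"
      if "b' \<in> carrier B" for b'
      unfolding D.pairing_add_right[OF g fn fn, symmetric]
      by (rule D.pairing_cong[OF g fn]) (use ab that in \<open>auto simp: carrier_AB mult_AB B.A.l_distr \<psi>'(4)\<close>)
    show "pairing F g (\<lambda>y. \<psi> ((r \<odot>\<^bsub>A\<^esub> a, b) \<otimes>\<^bsub>A \<times>\<times> B\<^esub> y)) =
        r \<otimes>\<^bsub>F\<^esub> pairing F g (\<lambda>y. \<psi> ((a, b) \<otimes>\<^bsub>A \<times>\<times> B\<^esub> y))" if "r \<in> carrier F" for r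
      unfolding D.pairing_smult_right[OF g that fn, symmetric]
      by (rule D.pairing_cong[OF g fn]) (use ab that in \<open>auto simp: carrier_AB mult_AB A.smult_mult_left \<psi>'(5)\<close>)
    show "pairing F g (\<lambda>y. \<psi> ((a, r \<odot>\<^bsub>B\<^esub> b) \<otimes>\<^bsub>A \<times>\<times> B\<^esub> y)) =
        r \<otimes>\<^bsub>F\<^esub> pairing F g (\<lambda>y. \<psi> ((a, b) \<otimes>\<^bsub>A \<times>\<times> B\<^esub> y))" if "r \<in> carrier F" for r
      unfolding D.pairing_smult_right[OF g that fn, symmetric]
      by (rule D.pairing_cong[OF g fn]) (use ab that in \<open>auto simp: carrier_AB mult_AB B.smult_mult_left \<psi>'(6)\<close>)
  qed
qed

lemma kernel_ideal: "ideal kernel T"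
proof (rule idealI[OF D.T_ring])
  have K: "left_ideal T kernel"
  proof (rule T.A.left_idealI)
    show "kernel \<subseteq> carrier T" by (auto simp: kernel_def)
    have "pairing F \<zero>\<^bsub>T\<^esub> \<psi> = \<zero>\<^bsub>F\<^esub>" for \<psi> by (simp add: pairing_def monoid_algebra_simps)
    then show "\<zero>\<^bsub>T\<^esub> \<in> kernel" by (simp add: kernel_def)
    show "x \<oplus>\<^bsub>T\<^esub> y \<in> kernel" if "x \<in> kernel" "y \<in> kernel" for x y
    proof -
      have xy: "x \<in> carrier T" "y \<in> carrier T" using that by (auto simp: kernel_def)
      have "pairing F (x \<oplus>\<^bsub>T\<^esub> y) \<psi> = \<zero>\<^bsub>F\<^esub>" if \<psi>: "bilinear_form F A B \<psi>" for \<psi>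
        unfolding monoid_algebra_simps D.pairing_add[OF xy bilinear_formD(1)[OF \<psi>]]
        using \<open>x \<in> kernel\<close> \<open>y \<in> kernel\<close> \<psi> by (simp add: kernel_def)
      then show ?thesis using T.M.a_closed[OF xy] by (simp add: kernel_def)
    qed
    show "a \<otimes>\<^bsub>T\<^esub> x \<in> kernel" if a: "a \<in> carrier T" and x: "x \<in> kernel" for a x
    proof -
      have xc: "x \<in> carrier T" using x by (simp add: kernel_def)
      have "pairing F (a \<otimes>\<^bsub>T\<^esub> x) \<psi> = \<zero>\<^bsub>F\<^esub>" if \<psi>: "bilinear_form F A B \<psi>" for \<psi>
      proof -
        have "pairing F (a \<otimes>\<^bsub>T\<^esub> x) \<psi> = pairing F a (\<lambda>u. pairing F x (\<lambda>v. \<psi> (u \<otimes>\<^bsub>A \<times>\<times> B\<^esub> v)))"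
          by (rule D.pairing_mult[OF a xc bilinear_formD(1)[OF \<psi>]])
        also have "\<dots> = pairing F a (\<lambda>u. \<zero>\<^bsub>F\<^esub>)"
        proof (rule D.pairing_cong[OF a])
          show "(\<lambda>u. pairing F x (\<lambda>v. \<psi> (u \<otimes>\<^bsub>A \<times>\<times> B\<^esub> v))) \<in> UNIV \<rightarrow> carrier F"
            using bilinear_formD(2)[OF \<psi>] by (auto intro!: D.pairing_closed xc)
          show "pairing F x (\<lambda>v. \<psi> (u \<otimes>\<^bsub>A \<times>\<times> B\<^esub> v)) = \<zero>\<^bsub>F\<^esub>" if "u \<in> carrier (A \<times>\<times> B)" for u
            using x bilinear_left_mult[OF \<psi> that] by (simp add: kernel_def)
        qed
        also have "\<dots> = \<zero>\<^bsub>F\<^esub>" by (rule D.pairing_zero_right[OF a])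
        finally show ?thesis .
      qed
      then show ?thesis using a xc by (simp add: kernel_def)
    qed
  qed
  then show "subgroup kernel (add_monoid T)" unfolding left_ideal_def using additive_subgroup.a_subgroup
      by blast
  show "a \<otimes>\<^bsub>T\<^esub> x \<in> kernel" if "x \<in> kernel" "a \<in> carrier T" for a x
      using T.A.left_idealD(4)[OF K that(2,1)] .
  show "x \<otimes>\<^bsub>T\<^esub> a \<in> kernel" if x: "x \<in> kernel" and a: "a \<in> carrier T" for a x
  proof -
    have xc: "x \<in> carrier T" using x by (simp add: kernel_def)
    have "pairing F (x \<otimes>\<^bsub>T\<^esub> a) \<psi> = \<zero>\<^bsub>F\<^esub>" if \<psi>: "bilinear_form F A B \<psi>" for \<psi>
      using x bilinear_right_mult[OF \<psi> a]
          by (simp add: D.pairing_mult[OF xc a bilinear_formD(1)[OF \<psi>]] kernel_def)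
    then show ?thesis using a xc by (simp add: kernel_def)
  qed
qed

lemma relations_closed: "tensor_relations F A B \<subseteq> carrier T"
  unfolding tensor_relations_def Let_def
  by (auto intro!: T.M.minus_closed T.M.a_closed T.smult_closed basis_closed)

text \<open>Each kind of relation expresses one condition in \<open>bilinear_form\<close>, so every
  form pairs with it to zero.\<close>

lemma relations_kernel: "tensor_relations F A B \<subseteq> kernel"
proof -
  have pb: "pairing F (basis_elem F (a, b)) \<psi> = \<psi> (a, b)"
    if "bilinear_form F A B \<psi>" "a \<in> carrier A" "b \<in> carrier B" for \<psi> a b
    using that by (intro D.pairing_basis bilinear_formD(1)) (auto simp: carrier_AB)
  have pa: "pairing F (f \<oplus>\<^bsub>T\<^esub> g) \<psi> = pairing F f \<psi> \<oplus>\<^bsub>F\<^esub> pairing F g \<psi>"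
    if "bilinear_form F A B \<psi>" "f \<in> carrier T" "g \<in> carrier T" for f g \<psi>
    unfolding monoid_algebra_simps by (rule D.pairing_add[OF that(2,3) bilinear_formD(1)[OF that(1)]])
  have ps: "pairing F (c \<odot>\<^bsub>T\<^esub> f) \<psi> = c \<otimes>\<^bsub>F\<^esub> pairing F f \<psi>"
    if "bilinear_form F A B \<psi>" "f \<in> carrier T" "c \<in> carrier F" for f c \<psi>
    unfolding monoid_algebra_simps by (rule D.pairing_smult[OF that(2,3) bilinear_formD(1)[OF that(1)]])
  have K: "f \<ominus>\<^bsub>T\<^esub> g \<in> kernel"
    if "f \<in> carrier T" "g \<in> carrier T" "\<And>\<psi>. bilinear_form F A B \<psi> \<Longrightarrow> pairing F f \<psi> = pairing F g \<psi>"
        for f g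
  proof -
    have "pairing F (f \<ominus>\<^bsub>T\<^esub> g) \<psi> = \<zero>\<^bsub>F\<^esub>" if \<psi>: "bilinear_form F A B \<psi>" for \<psi>
      using D.pairing_minus[OF \<open>f \<in> carrier T\<close> \<open>g \<in> carrier T\<close> bilinear_formD(1)[OF \<psi>]]
        \<open>bilinear_form F A B \<psi> \<Longrightarrow> pairing F f \<psi> = pairing F g \<psi>\<close>[OF \<psi>]
        D.pairing_closed[OF \<open>g \<in> carrier T\<close> bilinear_formD(1)[OF \<psi>]] by (simp add: a_minus_def A.R.r_neg)
    then show ?thesis using that by (simp add: kernel_def)
  qed
  show ?thesis
    unfolding tensor_relations_def Let_def
    by (auto intro!: K T.M.a_closed T.smult_closed basis_closed simp: pb pa ps basis_closed bilinear_formD(3-6))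
qed

abbreviation "R \<equiv> Idl\<^bsub>T\<^esub> (tensor_relations F A B)"

sublocale Q: algebra_quotient F T R
  using T.field_algebra_axioms T.A.genideal_ideal[OF relations_closed]
      by (simp add: algebra_quotient_def)

lemma tensor_algebra_eq: "tensor_algebra F A B = Q.Q"
  by (simp add: tensor_algebra_def)

lemma R_kernel: "R \<subseteq> kernel"
  by (rule T.A.genideal_minimal[OF kernel_ideal relations_kernel])

definition tens where "tens a b = Q.proj (basis_elem F (a, b))"

lemma tens_closed: "a \<in> carrier A \<Longrightarrow> b \<in> carrier B \<Longrightarrow> tens a b \<in> carrier Q.Q"
  using basis_closed by (auto simp: tens_def Q.proj_simps(1))

lemma proj_relation:
  "f \<ominus>\<^bsub>T\<^esub> g \<in> tensor_relations F A B \<Longrightarrow> f \<in> carrier T \<Longrightarrow> g \<in> carrier T \<Longrightarrow> Q.proj f = Q.proj g"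
  using T.A.genideal_self[OF relations_closed] by (auto simp: Q.proj_eq_iff)

lemma tens_add_left:
  assumes "a \<in> carrier A" "a' \<in> carrier A" "b \<in> carrier B"
  shows "tens (a \<oplus>\<^bsub>A\<^esub> a') b = tens a b \<oplus>\<^bsub>Q.Q\<^esub> tens a' b"
proof -
  have "basis_elem F (a \<oplus>\<^bsub>A\<^esub> a', b) \<ominus>\<^bsub>T\<^esub> (basis_elem F (a, b) \<oplus>\<^bsub>T\<^esub> basis_elem F (a', b))
      \<in> tensor_relations F A B"
    unfolding tensor_relations_def Let_def using assms by blast
  then have "Q.proj (basis_elem F (a \<oplus>\<^bsub>A\<^esub> a', b))
      = Q.proj (basis_elem F (a, b) \<oplus>\<^bsub>T\<^esub> basis_elem F (a', b))"
    using assms by (intro proj_relation basis_closed T.M.a_closed T.smult_closed A.M.a_closed B.M.a_closed A.smult_closed B.smult_closed)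
  then show ?thesis using assms by (simp add: tens_def Q.proj_simps(2) basis_closed)
qed

lemma tens_add_right:
  assumes "a \<in> carrier A" "b \<in> carrier B" "b' \<in> carrier B"
  shows "tens a (b \<oplus>\<^bsub>B\<^esub> b') = tens a b \<oplus>\<^bsub>Q.Q\<^esub> tens a b'"
proof -
  have "basis_elem F (a, b \<oplus>\<^bsub>B\<^esub> b') \<ominus>\<^bsub>T\<^esub> (basis_elem F (a, b) \<oplus>\<^bsub>T\<^esub> basis_elem F (a, b'))
      \<in> tensor_relations F A B"
    unfolding tensor_relations_def Let_def using assms by blast
  then have "Q.proj (basis_elem F (a, b \<oplus>\<^bsub>B\<^esub> b'))
      = Q.proj (basis_elem F (a, b) \<oplus>\<^bsub>T\<^esub> basis_elem F (a, b'))"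
    using assms by (intro proj_relation basis_closed T.M.a_closed T.smult_closed A.M.a_closed B.M.a_closed A.smult_closed B.smult_closed)
  then show ?thesis using assms by (simp add: tens_def Q.proj_simps(2) basis_closed)
qed

lemma tens_smult_left:
  assumes "r \<in> carrier F" "a \<in> carrier A" "b \<in> carrier B"
  shows "tens (r \<odot>\<^bsub>A\<^esub> a) b = r \<odot>\<^bsub>Q.Q\<^esub> tens a b"
proof -
  have "basis_elem F (r \<odot>\<^bsub>A\<^esub> a, b) \<ominus>\<^bsub>T\<^esub> (r \<odot>\<^bsub>T\<^esub> basis_elem F (a, b)) \<in> tensor_relations F A B"
    unfolding tensor_relations_def Let_def using assms by blast
  then have "Q.proj (basis_elem F (r \<odot>\<^bsub>A\<^esub> a, b)) = Q.proj (r \<odot>\<^bsub>T\<^esub> basis_elem F (a, b))"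
    using assms by (intro proj_relation basis_closed T.M.a_closed T.smult_closed A.M.a_closed B.M.a_closed A.smult_closed B.smult_closed)
  then show ?thesis using assms by (simp add: tens_def Q.proj_smult basis_closed)
qed

lemma tens_smult_right:
  assumes "r \<in> carrier F" "a \<in> carrier A" "b \<in> carrier B"
  shows "tens a (r \<odot>\<^bsub>B\<^esub> b) = r \<odot>\<^bsub>Q.Q\<^esub> tens a b"
proof -
  have "basis_elem F (a, r \<odot>\<^bsub>B\<^esub> b) \<ominus>\<^bsub>T\<^esub> (r \<odot>\<^bsub>T\<^esub> basis_elem F (a, b)) \<in> tensor_relations F A B"
    unfolding tensor_relations_def Let_def using assms by blast
  then have "Q.proj (basis_elem F (a, r \<odot>\<^bsub>B\<^esub> b)) = Q.proj (r \<odot>\<^bsub>T\<^esub> basis_elem F (a, b))"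
    using assms by (intro proj_relation basis_closed T.M.a_closed T.smult_closed A.M.a_closed B.M.a_closed A.smult_closed B.smult_closed)
  then show ?thesis using assms by (simp add: tens_def Q.proj_smult basis_closed)
qed

lemma tens_mult: "a \<in> carrier A \<Longrightarrow> b \<in> carrier B \<Longrightarrow> a' \<in> carrier A \<Longrightarrow> b' \<in> carrier B \<Longrightarrow>
    tens a b \<otimes>\<^bsub>Q.Q\<^esub> tens a' b' = tens (a \<otimes>\<^bsub>A\<^esub> a') (b \<otimes>\<^bsub>B\<^esub> b')"
  unfolding tens_def
  by (simp add: Q.proj_simps(3) basis_closed D.basis_mult carrier_AB mult_AB)

lemma tens_one: "tens \<one>\<^bsub>A\<^esub> \<one>\<^bsub>B\<^esub> = \<one>\<^bsub>Q.Q\<^esub>"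
  by (simp add: tens_def Q.proj_simps(4) monoid_algebra_simps one_AB)

text \<open>The tensor product of two functionals. The value zero outside the carriers keeps it in
  \<open>carrier F\<close> on the whole type.\<close>

definition form where
  "form \<phi> \<psi> = (\<lambda>(a, b). if a \<in> carrier A \<and> b \<in> carrier B then \<phi> a \<otimes>\<^bsub>F\<^esub> \<psi> b else \<zero>\<^bsub>F\<^esub>)"

lemma bilinear_form_form:
  assumes \<phi>: "\<And>a. a \<in> carrier A \<Longrightarrow> \<phi> a \<in> carrier F" "\<And>a a'. a \<in> carrier A \<Longrightarrow> a' \<in> carrier A \<Longrightarrow> \<phi> (a \<oplus>\<^bsub>A\<^esub> a')
      = \<phi> a \<oplus>\<^bsub>F\<^esub> \<phi> a'"
      "\<And>r a. r \<in> carrier F \<Longrightarrow> a \<in> carrier A \<Longrightarrow> \<phi> (r \<odot>\<^bsub>A\<^esub> a) = r \<otimes>\<^bsub>F\<^esub> \<phi> a"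
    and \<psi>: "\<And>a. a \<in> carrier B \<Longrightarrow> \<psi> a \<in> carrier F" "\<And>a a'. a \<in> carrier B \<Longrightarrow> a' \<in> carrier B \<Longrightarrow> \<psi> (a \<oplus>\<^bsub>B\<^esub> a')
        = \<psi> a \<oplus>\<^bsub>F\<^esub> \<psi> a'"
      "\<And>r a. r \<in> carrier F \<Longrightarrow> a \<in> carrier B \<Longrightarrow> \<psi> (r \<odot>\<^bsub>B\<^esub> a) = r \<otimes>\<^bsub>F\<^esub> \<psi> a"
  shows "bilinear_form F A B (form \<phi> \<psi>)"
  unfolding bilinear_form_def form_def
  by (auto simp: \<phi> \<psi> A.R.l_distr A.R.r_distr A.R.m_assoc A.R.m_lcomm)

end

lemma DirProd_simps:
  "carrier (G \<times>\<times> H) = carrier G \<times> carrier H"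
  "x \<otimes>\<^bsub>G \<times>\<times> H\<^esub> y = (fst x \<otimes>\<^bsub>G\<^esub> fst y, snd x \<otimes>\<^bsub>H\<^esub> snd y)"
  "\<one>\<^bsub>G \<times>\<times> H\<^esub> = (\<one>\<^bsub>G\<^esub>, \<one>\<^bsub>H\<^esub>)"
  by (simp_all add: DirProd_def split_beta)

text \<open>The pairs of nonvanishing monomials become the basis. Products of coefficient
  functionals are bilinear, hence descend to the tensor product, and they separate these pairs; the
  spanning property follows by expanding both factors.\<close>

theorem tensor_contracted_monoid_algebra:
  assumes "contracted_monoid_algebra F A M1 S1 e1 \<kappa>1" and "contracted_monoid_algebra F B M2 S2 e2 \<kappa>2"
  shows "\<exists>e \<kappa>. contracted_monoid_algebra F (tensor_algebra F A B) (M1 \<times>\<times> M2) (S1 \<times> S2) e \<kappa>"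
proof -
  interpret A: contracted_monoid_algebra F A M1 S1 e1 \<kappa>1 by fact
  interpret B: contracted_monoid_algebra F B M2 S2 e2 \<kappa>2 by fact
  interpret P: algebra_pair F A B ..
  interpret QA: field_algebra F P.Q.Q by (rule P.Q.quotient_field_algebra)
  define e where "e p = P.tens (e1 (fst p)) (e2 (snd p))" for p
  define \<kappa> where "\<kappa> p = P.Q.induced (\<lambda>f. pairing F f (P.form (\<kappa>1 (fst p)) (\<kappa>2 (snd p))))" for p
  have bil: "bilinear_form F A B (P.form (\<kappa>1 u) (\<kappa>2 v))" if "u \<in> S1" "v \<in> S2" for u v
    by (rule P.bilinear_form_form) (use that A.\<kappa>_closed B.\<kappa>_closed A.\<kappa>_add B.\<kappa>_add A.\<kappa>_smult B.\<kappa>_smult in auto)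
  have \<kappa>: "\<kappa> (u, v) (P.Q.proj f) = pairing F f (P.form (\<kappa>1 u) (\<kappa>2 v))"
    if uv: "u \<in> S1" "v \<in> S2" and f: "f \<in> carrier P.T" for u v f
  proof -
    note b = bilinear_formD(1)[OF bil[OF uv]]
    have "P.Q.induced (\<lambda>f. pairing F f (P.form (\<kappa>1 u) (\<kappa>2 v))) (P.Q.proj f)
        = pairing F f (P.form (\<kappa>1 u) (\<kappa>2 v))"
    proof (rule P.Q.induced_proj[OF _ _ _ f])
      show "pairing F (x \<oplus>\<^bsub>P.T\<^esub> y) (P.form (\<kappa>1 u) (\<kappa>2 v))
          = pairing F x (P.form (\<kappa>1 u) (\<kappa>2 v)) \<oplus>\<^bsub>F\<^esub> pairing F y (P.form (\<kappa>1 u) (\<kappa>2 v))"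
        if "x \<in> carrier P.T" "y \<in> carrier P.T" for x y
        unfolding monoid_algebra_simps by (rule P.D.pairing_add[OF that b])
      show "pairing F x (P.form (\<kappa>1 u) (\<kappa>2 v)) \<in> carrier F" if "x \<in> carrier P.T" for x
        by (rule P.D.pairing_closed[OF that b])
      show "pairing F x (P.form (\<kappa>1 u) (\<kappa>2 v)) = \<zero>\<^bsub>F\<^esub>" if "x \<in> P.R" for x
        using that P.R_kernel bil[OF uv] by (auto simp: P.kernel_def)
    qed
    then show ?thesis by (simp add: \<kappa>_def)
  qed
  have eC: "e p \<in> carrier P.Q.Q" if "p \<in> carrier (M1 \<times>\<times> M2)" for p
    using that by (auto simp: e_def DirProd_simps intro!: P.tens_closed A.e_closed B.e_closed)
  \<comment> \<open>A zero factor equals zero times itself, and the scalar moves out of the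
    tensor.\<close>
  have tens0: "P.tens a b = \<zero>\<^bsub>P.Q.Q\<^esub>" if "a \<in> carrier A" "b \<in> carrier B" "a = \<zero>\<^bsub>A\<^esub> \<or> b = \<zero>\<^bsub>B\<^esub>" for a b
  proof -
    have t: "P.tens a b \<in> carrier P.Q.Q" using that by (intro P.tens_closed)
    then have "\<zero>\<^bsub>F\<^esub> \<odot>\<^bsub>P.Q.Q\<^esub> P.tens a b = \<zero>\<^bsub>P.Q.Q\<^esub>" by simp
    moreover have "\<zero>\<^bsub>F\<^esub> \<odot>\<^bsub>P.Q.Q\<^esub> P.tens a b = P.tens a b"
      using that(3)
    proof
      assume "a = \<zero>\<^bsub>A\<^esub>"
      then show ?thesis using P.tens_smult_left[of "\<zero>\<^bsub>F\<^esub>" a b] that(1,2) by simp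
    next
      assume "b = \<zero>\<^bsub>B\<^esub>"
      then show ?thesis using P.tens_smult_right[of "\<zero>\<^bsub>F\<^esub>" a b] that(1,2) by simp
    qed
    ultimately show ?thesis by simp
  qed
  have c: "e ` carrier (M1 \<times>\<times> M2) \<subseteq> carrier P.Q.Q" using eC by blast
  let ?N = "QA.span (e ` carrier (M1 \<times>\<times> M2))"
  note N = QA.span_submodule[OF c]
  have "P.tens a b \<in> ?N" if a: "a \<in> carrier A" and b: "b \<in> carrier B" for a b
  proof -
    \<comment> \<open>The left factor is expanded first, against a monomial on the right; afterwards
      the right factor is expanded.\<close>
    have 1: "P.tens a (e2 y) \<in> ?N" if y: "y \<in> carrier M2" for y
    proof -
      have yc: "e2 y \<in> carrier B" using y by (rule B.e_closed)
      have "LinearCombinations.submodule F {a \<in> carrier A. P.tens a (e2 y) \<in> ?N} A"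
      proof (rule A.submoduleI)
        show "\<zero>\<^bsub>A\<^esub> \<in> {a \<in> carrier A. P.tens a (e2 y) \<in> ?N}"
          using tens0[of "\<zero>\<^bsub>A\<^esub>" "e2 y"] yc submodule.zero_closed[OF N] by simp
      qed (use yc submodule.m_closed[OF N] submodule.smult_closed[OF N] in \<open>auto simp: P.tens_add_left P.tens_smult_left\<close>)
      moreover have "e1 ` carrier M1 \<subseteq> {a \<in> carrier A. P.tens a (e2 y) \<in> ?N}"
      proof (rule image_subsetI)
        fix x assume x: "x \<in> carrier M1"
        then have "e (x, y) \<in> ?N" using QA.in_own_span[OF c] y by (auto simp: DirProd_simps)
        then show "e1 x \<in> {a \<in> carrier A. P.tens a (e2 y) \<in> ?N}" using x A.e_closed by (simp add: e_def)
      qed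
      ultimately have "A.span (e1 ` carrier M1) \<subseteq> {a \<in> carrier A. P.tens a (e2 y) \<in> ?N}"
        by (rule A.span_is_subset[rotated])
      then show ?thesis using a A.span_e by blast
    qed
    have "LinearCombinations.submodule F {b \<in> carrier B. P.tens a b \<in> ?N} B"
    proof (rule B.submoduleI)
      show "\<zero>\<^bsub>B\<^esub> \<in> {b \<in> carrier B. P.tens a b \<in> ?N}"
        using tens0[of a "\<zero>\<^bsub>B\<^esub>"] a submodule.zero_closed[OF N] by simp
    qed (use a submodule.m_closed[OF N] submodule.smult_closed[OF N] in \<open>auto simp: P.tens_add_right P.tens_smult_right\<close>)
    moreover have "e2 ` carrier M2 \<subseteq> {b \<in> carrier B. P.tens a b \<in> ?N}"
      using 1 B.e_closed by blast
    ultimately have "B.span (e2 ` carrier M2) \<subseteq> {b \<in> carrier B. P.tens a b \<in> ?N}"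
      by (rule B.span_is_subset[rotated])
    then show ?thesis using b B.span_e by blast
  qed
  then have tensN: "basis_elem F x \<in> {f \<in> carrier P.T. P.Q.proj f \<in> ?N}" if "x \<in> carrier (A \<times>\<times> B)" for x
    using that P.basis_closed by (auto simp: P.carrier_AB P.tens_def)
  have span: "?N = carrier P.Q.Q"
  proof
    show "?N \<subseteq> carrier P.Q.Q" by (rule QA.span_carrier[OF c])
    have "f \<in> {f \<in> carrier P.T. P.Q.proj f \<in> ?N}" if "f \<in> carrier P.T" for f
      by (rule P.D.submodule_containing_basis[OF P.Q.vimage_submodule[OF N] tensN that])
    then show "carrier P.Q.Q \<subseteq> ?N" by (auto simp: P.Q.proj_simps(1))
  qed
  have "contracted_monoid_algebra F P.Q.Q (M1 \<times>\<times> M2) (S1 \<times> S2) e \<kappa>"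
  proof (intro contracted_monoid_algebra.intro contracted_monoid_algebra_axioms.intro)
    show "field_algebra F P.Q.Q" by (rule P.Q.quotient_field_algebra)
    show "monoid (M1 \<times>\<times> M2)" by (rule DirProd_monoid[OF A.M.monoid_axioms B.M.monoid_axioms])
    show "S1 \<times> S2 \<subseteq> carrier (M1 \<times>\<times> M2)" using A.S_sub B.S_sub by (auto simp: DirProd_simps)
    show "\<one>\<^bsub>M1 \<times>\<times> M2\<^esub> \<in> S1 \<times> S2" using A.one_S B.one_S by (simp add: DirProd_simps)
    show "e x \<in> carrier P.Q.Q" if "x \<in> carrier (M1 \<times>\<times> M2)" for x by (rule eC[OF that])
    show "e x \<otimes>\<^bsub>P.Q.Q\<^esub> e y = e (x \<otimes>\<^bsub>M1 \<times>\<times> M2\<^esub> y)" if "x \<in> carrier (M1 \<times>\<times> M2)" "y \<in> carrier (M1 \<times>\<times> M2)"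
        for x y
      using that by (auto simp: e_def DirProd_simps P.tens_mult A.e_closed B.e_closed A.e_mult B.e_mult)
    show "e \<one>\<^bsub>M1 \<times>\<times> M2\<^esub> = \<one>\<^bsub>P.Q.Q\<^esub>" by (simp add: e_def DirProd_simps A.e_one B.e_one P.tens_one)
    show "e x = \<zero>\<^bsub>P.Q.Q\<^esub>" if "x \<in> carrier (M1 \<times>\<times> M2)" "x \<notin> S1 \<times> S2" for x
    proof -
      have x: "fst x \<in> carrier M1" "snd x \<in> carrier M2" using that(1) by (auto simp: DirProd_simps)
      have "fst x \<notin> S1 \<or> snd x \<notin> S2" using that(2) by (auto simp: mem_Times_iff)
      then have "e1 (fst x) = \<zero>\<^bsub>A\<^esub> \<or> e2 (snd x) = \<zero>\<^bsub>B\<^esub>" using A.e_zero[OF x(1)] B.e_zero[OF x(2)]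
          by blast
      then show ?thesis unfolding e_def by (intro tens0 A.e_closed B.e_closed x)
    qed
    show "?N = carrier P.Q.Q" by (rule span)
    show "\<kappa> x a \<in> carrier F" if "x \<in> S1 \<times> S2" "a \<in> carrier P.Q.Q" for x a
      using that bil by (auto simp: P.Q.proj_simps(1) \<kappa> intro!: P.D.pairing_closed bilinear_formD(1))
    show "\<kappa> x (a \<oplus>\<^bsub>P.Q.Q\<^esub> b) = \<kappa> x a \<oplus>\<^bsub>F\<^esub> \<kappa> x b"
        if h: "x \<in> S1 \<times> S2" "a \<in> carrier P.Q.Q" "b \<in> carrier P.Q.Q" for x a b
    proof -
      obtain u v where 1: "x = (u, v)" "u \<in> S1" "v \<in> S2" using h(1) by auto
      obtain f where 2: "a = P.Q.proj f" "f \<in> carrier P.T" using h(2) unfolding P.Q.proj_simps(1)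
          by (rule imageE)
      obtain g where 3: "b = P.Q.proj g" "g \<in> carrier P.T" using h(3) unfolding P.Q.proj_simps(1)
          by (rule imageE)
      note o = 1 2 3
      have "f \<oplus>\<^bsub>P.T\<^esub> g \<in> carrier P.T" using o by (intro P.T.M.a_closed)
      then show ?thesis using o P.D.pairing_add[OF o(5,7) bilinear_formD(1)[OF bil[OF o(2,3)]]]
        by (simp add: P.Q.proj_simps(2) \<kappa>) (simp add: monoid_algebra_simps)
    qed
    show "\<kappa> x (c \<odot>\<^bsub>P.Q.Q\<^esub> a) = c \<otimes>\<^bsub>F\<^esub> \<kappa> x a" if h: "x \<in> S1 \<times> S2" "c \<in> carrier F" "a \<in> carrier P.Q.Q"
        for x c a
    proof -
      obtain u v where 1: "x = (u, v)" "u \<in> S1" "v \<in> S2" using h(1) by auto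
      obtain f where 2: "a = P.Q.proj f" "f \<in> carrier P.T" using h(3) unfolding P.Q.proj_simps(1)
          by (rule imageE)
      note o = 1 2
      have "c \<odot>\<^bsub>P.T\<^esub> f \<in> carrier P.T" using o h by (intro P.T.smult_closed)
      then show ?thesis using o h(2) P.D.pairing_smult[OF o(5) h(2) bilinear_formD(1)[OF bil[OF o(2,3)]]]
        by (simp add: P.Q.proj_smult \<kappa>) (simp add: monoid_algebra_simps)
    qed
    show "\<kappa> x (e y) = (if x = y then \<one>\<^bsub>F\<^esub> else \<zero>\<^bsub>F\<^esub>)" if xy: "x \<in> S1 \<times> S2" "y \<in> S1 \<times> S2" for x y
    proof -
      obtain u v u' v' where o: "x = (u, v)" "y = (u', v')" "u \<in> S1" "v \<in> S2" "u' \<in> S1" "v' \<in> S2"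
          using xy by auto
      have cl: "e1 u' \<in> carrier A" "e2 v' \<in> carrier B" using o A.S_sub B.S_sub A.e_closed B.e_closed
          by auto
      have "\<kappa> x (e y) = pairing F (basis_elem F (e1 u', e2 v')) (P.form (\<kappa>1 u) (\<kappa>2 v))"
        using o cl by (simp add: e_def P.tens_def \<kappa> P.basis_closed)
      also have "\<dots> = P.form (\<kappa>1 u) (\<kappa>2 v) (e1 u', e2 v')"
        using cl by (intro P.D.pairing_basis bilinear_formD(1)[OF bil[OF o(3,4)]]) (simp add: P.carrier_AB)
      also have "\<dots> = (if x = y then \<one>\<^bsub>F\<^esub> else \<zero>\<^bsub>F\<^esub>)"
        using o cl A.\<kappa>_e[OF o(3,5)] B.\<kappa>_e[OF o(4,6)] by (simp add: P.form_def)
      finally show ?thesis .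
    qed
  qed
  then show ?thesis unfolding P.tensor_algebra_eq by blast
qed

section \<open>Growth exponents\<close>

lemma word_padding:
  fixes w :: "'a list"
  assumes "length w \<le> n"
  shows "concat (map (\<lambda>c. [c]) w @ replicate (n - length w) []) = w"
    "length (map (\<lambda>c. [c]) w @ replicate (n - length w) []) = n"
  using assms by (auto simp: concat_map_singleton[of id, simplified])

lemma length_concat_le: "\<forall>w\<in>set ws. length w \<le> 1 \<Longrightarrow> length (concat ws) \<le> length ws"
  by (induction ws) auto

text \<open>With the empty word among the generators, products of exactly \<open>n\<close> of them
  yield all words of length at most \<open>n\<close>.\<close>

definition short_words :: "nat list set" where "short_words = {[], [0], [1]}"

lemma short_words_carrier: "w \<in> short_words \<Longrightarrow> length w \<le> 1 \<and> set w \<subseteq> {..<2}"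
  by (auto simp: short_words_def)

lemma set_padding: "set w \<subseteq> {..<2} \<Longrightarrow> set (map (\<lambda>c. [c]) w @ replicate k []) \<subseteq> short_words"
  by (auto simp: short_words_def less_2_cases_iff subset_iff) 

context word_algebra
begin

lemma mprod_concat: "mprod ws = concat ws"
  unfolding mprod_def by (induction ws) auto

lemma generated_by_letters: "w \<in> L \<Longrightarrow> \<exists>ws. set ws \<subseteq> short_words \<and> w = mprod ws"
  using set_padding[OF letters, of w 0] word_padding(1)[of w "length w"]
  by (intro exI[of _ "map (\<lambda>c. [c]) w"]) (auto simp: mprod_concat)

lemma finitely_generated: "finitely_generated_algebra F A"
  by (rule finitely_generated_e[of short_words]) (use generated_by_letters short_words_carrier in \<open>auto simp: short_words_def\<close>)

lemma GKdim_language: "GKdim F A = limsup (\<lambda>n. ereal (ln (real (card {w \<in> L. length w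
    \<le> n})) / ln (real n)))"
proof (rule GKdim_e[of short_words])
  show "{mprod ws | ws. length ws = n \<and> set ws \<subseteq> short_words} \<inter> L = {w \<in> L. length w \<le> n}" for n
  proof (intro equalityI subsetI)
    fix w assume "w \<in> {mprod ws | ws. length ws = n \<and> set ws \<subseteq> short_words} \<inter> L"
    then obtain ws where "w = concat ws" "length ws = n" "set ws \<subseteq> short_words" "w \<in> L"
        by (auto simp: mprod_concat)
    then show "w \<in> {w \<in> L. length w \<le> n}" using length_concat_le[of ws] short_words_carrier by blast
  next
    fix w assume w: "w \<in> {w \<in> L. length w \<le> n}"
    let ?ws = "map (\<lambda>c. [c]) w @ replicate (n - length w) []"
    have "w = mprod ?ws" "length ?ws = n" "set ?ws \<subseteq> short_words"
      using w word_padding[of w n] set_padding[OF letters, of w "n - length w"] unfolding mprod_concat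
          by simp_all
    then have "w \<in> {mprod ws | ws. length ws = n \<and> set ws \<subseteq> short_words}" by blast
    then show "w \<in> {mprod ws | ws. length ws = n \<and> set ws \<subseteq> short_words} \<inter> L" using w by blast
  qed
qed (use generated_by_letters short_words_carrier in \<open>auto simp: short_words_def\<close>)

end

text \<open>With pairs of short words as generators a single factor can advance in both words, so
  products of \<open>n\<close> generators reach precisely the pairs in which both lengths are at
  most \<open>n\<close>. The two counting functions are thus multiplied at the same
  \<open>n\<close>.\<close>

lemma GKdim_tensor_languages:
  assumes A: "word_algebra F A L1 e1 \<kappa>1" and B: "word_algebra F B L2 e2 \<kappa>2"
  shows "GKdim F (tensor_algebra F A B) =
    limsup (\<lambda>n. ereal (ln (real (card {w \<in> L1. length w \<le> n} * card {w \<in> L2. length w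
        \<le> n})) / ln (real n)))"
proof -
  interpret A: word_algebra F A L1 e1 \<kappa>1 by fact
  interpret B: word_algebra F B L2 e2 \<kappa>2 by fact
  obtain e \<kappa> where "contracted_monoid_algebra F (tensor_algebra F A B) (word_monoid 2 \<times>\<times> word_monoid 2) (L1 \<times> L2) e \<kappa>"
    using tensor_contracted_monoid_algebra[OF A.contracted_monoid_algebra_axioms B.contracted_monoid_algebra_axioms] by blast
  then interpret P: contracted_monoid_algebra F "tensor_algebra F A B" "word_monoid 2 \<times>\<times> word_monoid 2"
      "L1 \<times> L2" e \<kappa> .
  let ?G = "short_words \<times> short_words"
  have mp: "P.mprod ws = (concat (map fst ws), concat (map snd ws))" for ws
    unfolding P.mprod_def by (induction ws) (auto simp: DirProd_simps)
  have pad: "\<exists>ws. length ws = n \<and> set ws \<subseteq> ?G \<and> (u, v) = P.mprod ws"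
    if uv: "u \<in> L1" "v \<in> L2" "length u \<le> n" "length v \<le> n" for u v n
  proof -
    \<comment> \<open>Both words are padded to exactly \<open>n\<close> factors so that they can be
      zipped.\<close>
    let ?us = "map (\<lambda>c. [c]) u @ replicate (n - length u) []"
        and ?vs = "map (\<lambda>c. [c]) v @ replicate (n - length v) []"
    have l: "length ?us = n" "length ?vs = n" using word_padding(2) uv by blast+
    have ll: "length ?us = length ?vs" by (rule trans[OF l(1) l(2)[symmetric]])
    have "set (zip ?us ?vs) \<subseteq> set ?us \<times> set ?vs" by (auto dest: set_zip_leftD set_zip_rightD)
    also have "\<dots> \<subseteq> ?G" using set_padding[OF A.letters[OF uv(1)]] set_padding[OF B.letters[OF uv(2)]]
        by (intro Sigma_mono)
    finally have "set (zip ?us ?vs) \<subseteq> ?G" .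
    moreover have "P.mprod (zip ?us ?vs) = (u, v)"
      unfolding mp map_fst_zip[OF ll] map_snd_zip[OF ll]
      by (simp only: word_padding(1)[OF uv(3)] word_padding(1)[OF uv(4)])
    moreover have "length (zip ?us ?vs) = n" unfolding length_zip l by simp
    ultimately show ?thesis by (intro exI[of _ "zip ?us ?vs"]) (simp only: simp_thms)
  qed
  have "GKdim F (tensor_algebra F A B) =
    limsup (\<lambda>n. ereal (ln (real (card ({w \<in> L1. length w \<le> n} \<times> {w \<in> L2. length w
        \<le> n}))) / ln (real n)))"
  proof (rule P.GKdim_e[of ?G])
    show "\<exists>ws. set ws \<subseteq> ?G \<and> x = P.mprod ws" if x: "x \<in> L1 \<times> L2" for x
    proof -
      have "\<exists>ws. length ws = max (length (fst x)) (length (snd x)) \<and> set ws \<subseteq> ?G \<and> (fst x, snd x)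
          = P.mprod ws"
        by (rule pad) (use x in auto)
      then show ?thesis unfolding prod.collapse by blast
    qed
    show "{P.mprod ws | ws. length ws = n \<and> set ws \<subseteq> ?G} \<inter> (L1 \<times> L2) = {w \<in> L1. length w \<le> n} \<times> {w
        \<in> L2. length w \<le> n}" for n
    proof (intro equalityI subsetI)
      fix x assume "x \<in> {P.mprod ws | ws. length ws = n \<and> set ws \<subseteq> ?G} \<inter> (L1 \<times> L2)"
      then obtain ws where ws: "x = (concat (map fst ws), concat (map snd ws))" "length ws = n" "set ws
          \<subseteq> ?G" "x \<in> L1 \<times> L2"
        by (auto simp: mp)
      have "\<forall>w\<in>set (map fst ws). length w \<le> 1" "\<forall>w\<in>set (map snd ws). length w \<le> 1"
        using ws(3) short_words_carrier by auto
      then have "length (concat (map fst ws)) \<le> n" "length (concat (map snd ws)) \<le> n"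
        using length_concat_le[of "map fst ws"] length_concat_le[of "map snd ws"] ws(2) by auto
      then show "x \<in> {w \<in> L1. length w \<le> n} \<times> {w \<in> L2. length w \<le> n}" using ws by auto
    next
      fix x assume "x \<in> {w \<in> L1. length w \<le> n} \<times> {w \<in> L2. length w \<le> n}"
      then obtain u v where uv: "x = (u, v)" "u \<in> L1" "v \<in> L2" "length u \<le> n" "length v \<le> n" by auto
      have "\<exists>ws. length ws = n \<and> set ws \<subseteq> ?G \<and> x = P.mprod ws" unfolding uv(1) by (rule pad[OF uv(2-5)])
      then have "x \<in> {P.mprod ws | ws. length ws = n \<and> set ws \<subseteq> ?G}" by blast
      moreover have "x \<in> L1 \<times> L2" using uv by simp
      ultimately show "x \<in> {P.mprod ws | ws. length ws = n \<and> set ws \<subseteq> ?G} \<inter> (L1 \<times> L2)" by (rule IntI)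
    qed
  qed (use short_words_carrier in \<open>auto simp: short_words_def DirProd_simps\<close>)
  then show ?thesis by (simp add: card_cartesian_product)
qed

text \<open>On each segment the exponent is attained up to constants at a fixed multiple of the left
  end. The upper limit sees the largest exponent, which occurs infinitely often.\<close>

lemma limsup_ln_piecewise:
  fixes g s :: "nat \<Rightarrow> real" and N r :: "nat \<Rightarrow> nat" and c :: nat and K M :: real
  assumes N: "strict_mono N" "0 < N 0"
    and up: "\<And>k n. N k \<le> n \<Longrightarrow> n < N (Suc k) \<Longrightarrow> 0 < g n \<and> g n \<le> K * real n powr s k"
    and low: "\<And>k. real (N k) powr s k \<le> g (c * N k)" and c: "0 < c"
    and M: "\<And>k. s k \<le> M" "strict_mono r" "\<And>j. s (r j) = M"
  shows "limsup (\<lambda>n. ereal (ln (g n) / ln (real n))) = ereal M"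
\<comment> \<open>The factor \<open>real c powr (- M)\<close> makes up for evaluating at
  \<open>c * N (r j)\<close> in place of \<open>N (r j)\<close>.\<close>
proof (rule limsup_ln_eq[where \<nu> = "\<lambda>j. c * N (r j)" and \<kappa> = "real c powr (- M)" and K = K])
  show "eventually (\<lambda>n. 0 < g n \<and> g n \<le> K * real n powr M) sequentially"
    using eventually_ge_at_top[of "N 0"]
  proof eventually_elim
    case (elim n)
    \<comment> \<open>The index of the segment that contains \<open>n\<close>; minimality yields
      \<open>N ?k \<le> n\<close>.\<close>
    let ?k = "(LEAST k. n < N (Suc k))"
    have "n \<le> N n" by (rule strict_mono_imp_increasing[OF N(1)])
    also have "N n < N (Suc n)" using N(1) by (simp add: strict_mono_Suc_iff)
    finally have k: "n < N (Suc ?k)" by (rule LeastI)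
    have "N ?k \<le> n"
    proof (cases ?k)
      case 0 then show ?thesis using elim by simp
    next
      case (Suc i)
      then have "\<not> n < N (Suc i)" using not_less_Least[of i "\<lambda>k. n < N (Suc k)"] by simp
      then show ?thesis using Suc by simp
    qed
    then have g: "0 < g n" "g n \<le> K * real n powr s ?k" using up k by blast+
    have "1 \<le> n" using elim N(2) by simp
    then have "real n powr s ?k \<le> real n powr M" using M(1) by (intro powr_mono) auto
    moreover have "0 < K"
    proof -
      have "0 < K * real n powr s ?k" using g by linarith
      moreover have "0 < real n powr s ?k" using \<open>1 \<le> n\<close> by simp
      ultimately show ?thesis by (rule zero_less_mult_pos2)
    qed
    ultimately have "K * real n powr s ?k \<le> K * real n powr M" by (intro mult_left_mono) auto
    then show ?case using g by linarith
  qed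
  show "strict_mono (\<lambda>j. c * N (r j))" using N(1) M(2) c by (auto simp: strict_mono_def)
  show "(real c powr (- M)) * real (c * N (r j)) powr M \<le> g (c * N (r j))" for j
  proof -
    have "(real c powr (- M)) * real (c * N (r j)) powr M = real (N (r j)) powr M"
      using c by (simp add: powr_mult powr_minus)
    then show ?thesis using low[of "r j"] M(3)[of j] by simp
  qed
  show "0 < real c powr (- M)" using c by simp
qed

lemma language_with_exponents:
  fixes b :: nat and s :: "nat \<Rightarrow> real"
  defines "N \<equiv> (\<lambda>k. (36 * b + 7) ^ ((2 * b + 4) ^ k))"
  assumes b: "2 \<le> b" and s: "\<And>k. 2 \<le> s k \<and> s k \<le> real b"
  shows "\<exists>L. recurrent_language L \<and>
    (\<forall>k n. N k \<le> n \<and> n < N (Suc k) \<longrightarrow> real (card {w \<in> L. length w \<le> n})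
        \<le> 48 * (36 * b + 7) * real n powr s k) \<and>
    (\<forall>k. real (N k) powr s k \<le> real (card {w \<in> L. length w \<le> 4 * (36 * b + 7) * N k}))"
proof -
  \<comment> \<open>Five code words are the required minimum. As the power is at least 1, adding 5
    costs at most a factor 6, which turns the constant 8 into 48.\<close>
  define t where "t k = 5 + nat \<lfloor>real (N k) powr (s k - 2)\<rfloor>" for k
  have N7: "7 \<le> N k" for k
  proof -
    have "36 * b + 7 \<le> N k" unfolding N_def by (rule self_le_power) auto
    then show ?thesis by simp
  qed
  have ge1: "1 \<le> real (N k) powr (s k - 2)" for k using N7[of k] s[of k]
      by (intro ge_one_powr_ge_zero) auto
  have t_eq: "real (t k) = 5 + of_int \<lfloor>real (N k) powr (s k - 2)\<rfloor>" for k
    using ge1[of k] by (simp add: t_def)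
  have t_low: "real (N k) powr (s k - 2) \<le> real (t k)" for k unfolding t_eq by linarith
  have t_up: "real (t k) \<le> 6 * real (N k) powr (s k - 2)" for k using ge1[of k] unfolding t_eq
      by linarith
  have t_up': "real (t k) \<le> 5 + real (N k) powr (s k - 2)" for k unfolding t_eq by linarith
  have "5 \<le> t k \<and> t k \<le> N k ^ b" for k
  proof
    show "5 \<le> t k" by (simp add: t_def)
    have "real (N k) powr (s k - 2) \<le> real (N k) powr (real b - 2)" using N7[of k] s[of k]
        by (intro powr_mono) auto
    also have "\<dots> = real (N k) powr real (b - 2)" using b by (simp add: of_nat_diff)
    also have "\<dots> = real (N k ^ (b - 2))" using N7[of k] by (simp add: powr_realpow)
    finally have 1: "real (t k) \<le> real (5 + N k ^ (b - 2))" using t_up'[of k] by simp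
    have "1 \<le> N k ^ (b - 2)" using N7[of k] by simp
    moreover have "7 * 7 \<le> N k * N k" using N7[of k] by (intro mult_mono) auto
    then have "49 * N k ^ (b - 2) \<le> (N k * N k) * N k ^ (b - 2)" by (intro mult_right_mono) auto
    \<comment> \<open>The square of \<open>N k\<close> is at least 49 and absorbs the summand
      5.\<close>
    ultimately have "5 + N k ^ (b - 2) \<le> N k ^ 2 * N k ^ (b - 2)" unfolding power2_eq_square by linarith
    also have "\<dots> = N k ^ (2 + (b - 2))" by (rule power_add[symmetric])
    also have "2 + (b - 2) = b" using b by simp
    finally show "t k \<le> N k ^ b" using 1 by (metis of_nat_le_iff order_trans)
  qed
  then obtain L where L: "recurrent_language L"
    and up: "\<And>k n. N k \<le> n \<Longrightarrow> n < N (Suc k) \<Longrightarrow> card {w \<in> L. length w \<le> n} \<le> 8 * (36 * b + 7) * t k * n\<^sup>2"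
    and low: "\<And>k. t k * (N k)\<^sup>2 \<le> card {w \<in> L. length w \<le> 4 * (36 * b + 7) * N k}"
    using language_with_bursts[of t b] unfolding N_def by blast
  have "real (card {w \<in> L. length w \<le> n}) \<le> 48 * (36 * b + 7) * real n powr s k"
      if n: "N k \<le> n" "n < N (Suc k)" for k n
  proof -
    have np: "0 < n" using n N7[of k] by linarith
    have "real (card {w \<in> L. length w \<le> n}) \<le> real (8 * (36 * b + 7) * t k * n\<^sup>2)" using up[OF n]
        by (simp only: of_nat_le_iff)
    also have "\<dots> = 8 * (36 * b + 7) * (real (t k) * (real n)\<^sup>2)" by simp
    also have "\<dots> \<le> 8 * (36 * b + 7) * ((6 * real n powr (s k - 2)) * (real n)\<^sup>2)"
    proof (intro mult_left_mono mult_right_mono)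
      have "real (N k) powr (s k - 2) \<le> real n powr (s k - 2)" using n s[of k] by (intro powr_mono2) auto
      then show "real (t k) \<le> 6 * real n powr (s k - 2)" using t_up[of k] by linarith
    qed auto
    also have "\<dots> = 48 * (36 * b + 7) * (real n powr (s k - 2) * (real n)\<^sup>2)" by (simp add: algebra_simps)
    also have "real n powr (s k - 2) * (real n)\<^sup>2 = real n powr s k"
    proof -
      have "real n powr (s k - 2 + 2) = real n powr (s k - 2) * real n powr 2" by (rule powr_add)
      then show ?thesis using np by simp
    qed
    finally show ?thesis .
  qed
  moreover have "real (N k) powr s k \<le> real (card {w \<in> L. length w \<le> 4 * (36 * b + 7) * N k})" for k
  proof -
    have "real (N k) powr (s k - 2 + 2) = real (N k) powr (s k - 2) * real (N k) powr 2"
        by (rule powr_add)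
    then have "real (N k) powr s k = real (N k) powr (s k - 2) * (real (N k))\<^sup>2" using N7[of k] by simp
    also have "\<dots> \<le> real (t k) * (real (N k))\<^sup>2" using t_low by (intro mult_right_mono) auto
    also have "\<dots> = real (t k * (N k)\<^sup>2)" by simp
    also have "\<dots> \<le> real (card {w \<in> L. length w \<le> 4 * (36 * b + 7) * N k})" using low
        by (simp only: of_nat_le_iff)
    finally show ?thesis .
  qed
  ultimately show ?thesis using L by blast
qed

theorem theoremD:
  fixes F :: "('f, 'r) ring_scheme" and \<alpha> \<beta> \<gamma> :: real
  assumes "field F"
    and "2 \<le> \<gamma>" and "\<gamma> \<le> \<alpha>" and "\<alpha> \<le> \<beta>"
  shows "\<exists>A B :: ('f, (nat list \<Rightarrow> 'f) set) module.
    finitely_generated_algebra F A \<and> primitive_ring A \<and> monomial_algebra F A \<and>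
    finitely_generated_algebra F B \<and> primitive_ring B \<and> monomial_algebra F B \<and>
    GKdim F A = ereal \<alpha> \<and> GKdim F B = ereal \<beta> \<and>
    GKdim F (tensor_algebra F A B) = ereal (\<beta> + \<gamma>)"
proof -
  \<comment> \<open>An integer bound for all exponents of both languages, which makes their scales
    coincide.\<close>
  define b where "b = nat \<lceil>\<beta>\<rceil>"
  define D where "D = 36 * b + 7"
  define N where "N = (\<lambda>k. D ^ ((2 * b + 4) ^ k))"
  define s1 where "s1 k = (if even k then \<alpha> else \<gamma>)" for k :: nat
  define s2 where "s2 k = (if even k then 2 else \<beta>)" for k :: nat
  have b: "2 \<le> b" "\<beta> \<le> real b" using assms by (auto simp: b_def le_nat_iff)
  have s: "2 \<le> s1 k \<and> s1 k \<le> real b" "2 \<le> s2 k \<and> s2 k \<le> real b" for k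
    using assms b by (auto simp: s1_def s2_def)
  have N: "strict_mono N" "0 < N 0"
    unfolding N_def D_def strict_mono_Suc_iff by (auto intro!: power_strict_increasing)
  obtain L1 where L1: "recurrent_language L1"
    and up1: "\<And>k n. N k \<le> n \<Longrightarrow> n < N (Suc k) \<Longrightarrow> real (card {w \<in> L1. length w \<le> n})
        \<le> 48 * D * real n powr s1 k"
    and low1: "\<And>k. real (N k) powr s1 k \<le> real (card {w \<in> L1. length w \<le> 4 * D * N k})"
    using language_with_exponents[of b s1, OF b(1) s(1)] unfolding N_def D_def by blast
  obtain L2 where L2: "recurrent_language L2"
    and up2: "\<And>k n. N k \<le> n \<Longrightarrow> n < N (Suc k) \<Longrightarrow> real (card {w \<in> L2. length w \<le> n})
        \<le> 48 * D * real n powr s2 k"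
    and low2: "\<And>k. real (N k) powr s2 k \<le> real (card {w \<in> L2. length w \<le> 4 * D * N k})"
    using language_with_exponents[of b s2, OF b(1) s(2)] unfolding N_def D_def by blast
  have pos: "0 < real (card {w \<in> L. length w \<le> n})" if "recurrent_language L" for L n
  proof -
    interpret recurrent_language L by fact
    have "[] \<in> L" using nonempty factor by auto
    moreover have "{w \<in> L. length w \<le> n} \<subseteq> {w. set w \<subseteq> {..<2} \<and> length w \<le> n}" using letters by auto
    then have "finite {w \<in> L. length w \<le> n}" by (rule finite_subset) (rule finite_lists_length_le, simp)
    ultimately show ?thesis by (auto simp: card_gt_0_iff)
  qed
  obtain e1 \<kappa>1 where A: "word_algebra F (language_algebra F L1) L1 e1 \<kappa>1"
    using word_algebra_language_algebra[OF assms(1) L1] by blast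
  obtain e2 \<kappa>2 where B: "word_algebra F (language_algebra F L2) L2 e2 \<kappa>2"
    using word_algebra_language_algebra[OF assms(1) L2] by blast
  have D: "0 < 4 * D" by (simp add: D_def)
  have even_odd: "strict_mono (\<lambda>j::nat. 2 * j)" "strict_mono (\<lambda>j::nat. Suc (2 * j))"
      by (simp_all add: strict_mono_def)
  have "GKdim F (language_algebra F L1) = ereal \<alpha>"
    unfolding word_algebra.GKdim_language[OF A]
  proof (rule limsup_ln_piecewise[OF N _ low1 D _ even_odd(1)])
    fix k n assume n: "N k \<le> n" "n < N (Suc k)"
    show "0 < real (card {w \<in> L1. length w \<le> n}) \<and> real (card {w \<in> L1. length w \<le> n})
        \<le> (48 * D) * real n powr s1 k"
      using up1[OF n] pos[OF L1] by simp
  qed (use assms in \<open>auto simp: s1_def\<close>)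
  moreover have "GKdim F (language_algebra F L2) = ereal \<beta>"
    unfolding word_algebra.GKdim_language[OF B]
  proof (rule limsup_ln_piecewise[OF N _ low2 D _ even_odd(2)])
    fix k n assume n: "N k \<le> n" "n < N (Suc k)"
    show "0 < real (card {w \<in> L2. length w \<le> n}) \<and> real (card {w \<in> L2. length w \<le> n})
        \<le> (48 * D) * real n powr s2 k"
      using up2[OF n] pos[OF L2] by simp
  qed (use assms in \<open>auto simp: s2_def\<close>)
  moreover have "GKdim F (tensor_algebra F (language_algebra F L1) (language_algebra F L2))
      = ereal (\<beta> + \<gamma>)"
    unfolding GKdim_tensor_languages[OF A B]
  \<comment> \<open>The sum of the exponents is \<alpha> + 2 on even levels and \<gamma> + \<beta>
    on odd ones; the latter is the larger, because \<alpha> \<le> \<beta> and 2 \<le> \<gamma>.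
    Hence the odd levels form the subsequence.\<close>
  proof (rule limsup_ln_piecewise[OF N _ _ D _ even_odd(2), where s = "\<lambda>k. s1 k + s2 k"])
    fix k n assume n: "N k \<le> n" "n < N (Suc k)"
    have "real (card {w \<in> L1. length w \<le> n}) * real (card {w \<in> L2. length w \<le> n})
        \<le> (48 * D * real n powr s1 k) * (48 * D * real n powr s2 k)"
      using up1[OF n] up2[OF n] by (intro mult_mono) auto
    also have "\<dots> = (48 * D)\<^sup>2 * real n powr (s1 k + s2 k)" by (simp add: powr_add power2_eq_square)
    finally show "0 < real (card {w \<in> L1. length w \<le> n} * card {w \<in> L2. length w \<le> n}) \<and>
        real (card {w \<in> L1. length w \<le> n} * card {w \<in> L2. length w \<le> n})
            \<le> (48 * D)\<^sup>2 * real n powr (s1 k + s2 k)"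
      using pos[OF L1, of n] pos[OF L2, of n] by simp
  next
    fix k
    have "real (N k) powr (s1 k + s2 k) = real (N k) powr s1 k * real (N k) powr s2 k" by (rule powr_add)
    also have "\<dots> \<le> real (card {w \<in> L1. length w \<le> 4 * D * N k}) * real (card {w \<in> L2. length w
        \<le> 4 * D * N k})"
      using low1 low2 by (intro mult_mono) auto
    finally show "real (N k) powr (s1 k + s2 k) \<le> real (card {w \<in> L1. length w \<le> 4 * D * N k} * card {w
        \<in> L2. length w \<le> 4 * D * N k})"
      by simp
  qed (use assms in \<open>auto simp: s1_def s2_def\<close>)
  ultimately show ?thesis
    using word_algebra.finitely_generated[OF A] word_algebra.primitive[OF A] monomial_language_algebra[of F L1]
      word_algebra.finitely_generated[OF B] word_algebra.primitive[OF B] monomial_language_algebra[of F L2]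
    by blast
qed

end
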